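(* Let $$\mathcal F(g,\theta,\lambda,\nu_3,F_0^{1,1})=-2\pi\int_N\Big(\tfrac{15}{8}\lambda^2+\tfrac5{18}|\theta|^2_{g}+\tfrac14|\nu_3|^2_{g}+\tfrac14|F_0^{1,1}|^2_{g}\Big)dV_{g}$$ be the reduced $G_2$-Hilbert functional, on the compact $6$-manifold without boundary $N=M/\mathbb S^1$, within the constant fiber-length non-Kähler transverse ansatz: $\mathbb S^1$-invariant $G_2$-structures $\varphi=\eta\wedge\omega+\Omega_+$ on $M$ with $$d\Omega=\theta\wedge\Omega,\qquad d\omega=\tfrac23\theta\wedge\omega+\nu_3,\qquad d\eta=F=F_0^{1,1}+\lambda\omega,$$ subject to the compatibility condition $dF_0^{1,1}+(d\lambda+\tfrac23\lambda\theta)\wedge\omega+\lambda\nu_3=0$ (that is, $dF=0$), where $g=g_{(\omega,\Omega)}$. With respect to the $L^2$-pairing $$\langle V_1,V_2\rangle_{L^2}=\int_N\big(\langle k_1,k_2\rangle_g+\langle\beta_1,\beta_2\rangle_g+f_1f_2+\langle\mu_1,\mu_2\rangle_g+\langle\rho_1,\rho_2\rangle_g\big)dV_g$$ on variations $V=(k,\beta,f,\mu,\rho)=(\dot g,\dot\theta,\dot\lambda,\dot\nu_3,\dot F_0^{1,1})$, the positive gradient flow of $\mathcal F$ (for the formal gradient defined by testing against admissible variations, as described in the context) is given by the coupled system $$\partial_tg=-2\pi\Big[\big(\tfrac{15}{16}\lambda^2+\tfrac5{36}|\theta|^2+\tfrac18|\nu_3|^2+\tfrac18|F_0^{1,1}|^2\big)g-\tfrac5{18}\theta\otimes\theta-\tfrac14(\nu_3\circ\nu_3)-\tfrac14(F_0^{1,1}\circ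 F_0^{1,1})\Big],$$ $$\partial_t\theta=-\tfrac{10\pi}{9}\theta,\quad\partial_t\lambda=-\tfrac{15\pi}{2}\lambda,\quad\partial_t\nu_3=-\pi\nu_3,\quad\partial_tF_0^{1,1}=-\pi F_0^{1,1},$$ where $(\nu_3\circ\nu_3)_{ij}=\frac12(\nu_3)_{iab}(\nu_3)_j{}^{ab}$ and $(F_0^{1,1}\circ F_0^{1,1})_{ij}=(F_0^{1,1})_{ia}(F_0^{1,1})_j{}^a$. For initial data $(g_0,\theta_0,\lambda_0,\nu_{3,0},F_{0,0}^{1,1})$, the Lee form $\theta$, the trace curvature component $\lambda$, and the primitive torsion and curvature components $\nu_3$, $F_0^{1,1}$ evolve exponentially: $$\theta(t)=e^{-\frac{10\pi}{9}t}\theta_0,\quad\lambda(t)=e^{-\frac{15\pi}{2}t}\lambda_0,\quad\nu_3(t)=e^{-\pi t}\nu_{3,0},\quad F_0^{1,1}(t)=e^{-\pi t}F_{0,0}^{1,1}.$$ Consequently, the evolution of the metric $g(t)$ is governed by $$\begin{aligned}\partial_tg=-2\pi\Big[&\big(\tfrac{15}{16}e^{-15\pi t}\lambda_0^2+\tfrac5{36}e^{-\frac{20\pi}{9}t}|\theta_0|^2_{g(t)}+\tfrac18e^{-2\pi t}|\nu_{3,0}|^2_{g(t)}+\tfrac18e^{-2\pi t}|F_{0,0}^{1,1}|^2_{g(t)}\big)g(t)\\&-\tfrac5{18}e^{-\frac{20\pi}{9}t}\theta_0\otimes\theta_0-\tfrac14e^{-2\pi t}(\nu_{3,0}\circ_{g(t)}\nu_{3,0})-\tfrac14e^{-2\pi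 t}(F_{0,0}^{1,1}\circ_{g(t)}F_{0,0}^{1,1})\Big].\end{aligned}$$
   Context: $M$ is a $7$-manifold with a free $\mathbb S^1$-action; forms on $N=M/\mathbb S^1$ are identified with their pullbacks to $M$. An $SU(3)$-structure on $N$ is a pair $(\omega,\Omega)$ with $\omega$ a real non-degenerate $2$-form and $\Omega=\Omega_++i\Omega_-$ a complex volume form satisfying $\omega\wedge\Omega_+=0$, $\frac16\omega^3=\frac14\Omega_+\wedge\Omega_-$, with induced Riemannian metric $g_{(\omega,\Omega)}=\omega(\cdot,J\cdot)$, $J$ the almost complex structure determined by $\Omega_+$. The generator of the action has constant length $1$ (so $h=1$, where $h$ is the inverse squared length of the generator), and $\eta$ is a connection $1$-form on $M\to N$. Further, $\lambda$ is a function on $N$, $\theta$ a real $1$-form on $N$, $\nu_3$ a primitive $3$-form of type $W_3$ ($\nu_3\wedge\omega=0$, $\nu_3\wedge\Omega_\pm=0$), and $F_0^{1,1}$ a primitive real $(1,1)$-form ($F_0^{1,1}\wedge\omega^2=0$, $F_0^{1,1}\wedge\Omega_+=0$). The $G_2$-Hilbert functional is $\mathcal F(\varphi)=\int_M\big(\frac16\mathrm{Scal}(g_\varphi)-\frac13|T|^2-\frac16(\operatorname{tr}T)^2\big)dV_{g_\varphi}$, with $g_\varphi$ the metric induced by $\varphi$, $\mathrm{Scal}(g_\varphi)$ its scalar curvature and $T$ the full torsion tensor, $\nabla_i\varphi_{jkl}=T_i{}^m( *_\varphi\varphi)_{mjkl}$; the functional in the claim is its reduction to $N$ under the ansatz.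 Variations and gradient: the ansatz defines a constrained variation space, in which the reduced data are the tuple $(g,\theta,\lambda,\nu_3,F_0^{1,1})$. The variations preserve the ansatz: $\dot h=0$, and the linearized constraints $$d\dot\eta=\dot F_0^{1,1}+\dot\lambda\,\omega+\lambda\,\dot\omega,\qquad d\dot\Omega=\dot\theta\wedge\Omega+\theta\wedge\dot\Omega,\qquad d\dot\omega=\tfrac23(\dot\theta\wedge\omega+\theta\wedge\dot\omega)+\dot\nu_3$$ hold, together with the linearization of $dF=0$, $$d\dot F_0^{1,1}+d\dot\lambda\wedge\omega+d\lambda\wedge\dot\omega+\dot\lambda\,d\omega+\lambda\,d\dot\omega=0.$$ An admissible infinitesimal variation is represented by the vector $V=(k,\beta,f,\mu,\rho)=(\dot g,\dot\theta,\dot\lambda,\dot\nu_3,\dot F_0^{1,1})$. The formal gradient $\nabla\mathcal F$ is the unique element satisfying $\frac{d}{dt}|_{t=0}\mathcal F=\langle\nabla\mathcal F,V\rangle_{L^2}$ for every admissible variation $V$; the positive gradient flow is $\partial_t(g,\theta,\lambda,\nu_3,F_0^{1,1})=\nabla\mathcal F$. Norms and inner products of $p$-forms are the standard ones ($|\alpha|^2=\frac1{p!}\alpha_{i_1\cdots i_p}\alpha^{i_1\cdots i_p}$); for symmetric $2$-tensors $\langle S,k\rangle=S_{ij}k^{ij}$. The symbol $\circ_{g(t)}$ is the operation $\circ$ with indices raised by $g(t)$.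
   Formalization: Admissible variations do not determine a unique gradient (flat T^7→T^6 with zero data: constant λ-direction pairs to 0), so the stated gradient is shown to satisfy the identity for admissible variations, while uniqueness and flow ⇔ system are for all smooth variations. *)

theory Defs
  imports "HOL-Analysis.Analysis"
begin

section \<open>Smooth functions and smooth manifolds\<close>

text \<open>Both notions of smoothness below are meant for open sets \<open>U\<close>.\<close>

primrec Ck_on :: "nat \<Rightarrow> 'e::euclidean_space set \<Rightarrow> ('e \<Rightarrow> real) \<Rightarrow> bool" where
  "Ck_on 0 U f \<longleftrightarrow> continuous_on U f"
| "Ck_on (Suc k) U f \<longleftrightarrow>
     f differentiable_on U \<and> (\<forall>b\<in>Basis. Ck_on k U (\<lambda>x. frechet_derivative f (at x) b))"

definition smooth_on :: "'e::euclidean_space set \<Rightarrow> ('e \<Rightarrow> 'f::euclidean_space) \<Rightarrow> bool" where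
  "smooth_on U f \<longleftrightarrow> (\<forall>b\<in>Basis. \<forall>k. Ck_on k U (\<lambda>x. f x \<bullet> b))"

text \<open>A chart is a pair of an open set and a coordinate map that is used only on that set.
  A manifold (without boundary) of dimension \<open>CARD('n)\<close> is a Hausdorff, second countable type
  together with a smooth atlas.\<close>

type_synonym ('a, 'n) chart = "'a set \<times> ('a \<Rightarrow> real ^ 'n)"

definition chart_inv :: "('a, 'n::finite) chart \<Rightarrow> real ^ 'n \<Rightarrow> 'a" where
  "chart_inv c = inv_into (fst c) (snd c)"

definition is_chart :: "('a::topological_space, 'n::finite) chart \<Rightarrow> bool" where
  "is_chart c \<longleftrightarrow> open (fst c) \<and> open (snd c ` fst c) \<and>
     homeomorphism (fst c) (snd c ` fst c) (snd c) (chart_inv c)"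

definition smooth_atlas ::
    "('a::{t2_space,second_countable_topology}, 'n::finite) chart set \<Rightarrow> bool" where
  "smooth_atlas A \<longleftrightarrow> (\<forall>c\<in>A. is_chart c) \<and> (\<Union>c\<in>A. fst c) = UNIV \<and>
     (\<forall>c\<in>A. \<forall>d\<in>A. smooth_on (snd c ` (fst c \<inter> fst d)) (snd d \<circ> chart_inv c))"

text \<open>The tangent space at \<open>p\<close> is identified with \<open>real ^ 'n\<close> by means of one chosen chart
  around \<open>p\<close>. The choice depends on \<open>p\<close> in an arbitrary way, so smoothness of tensor fields
  is always tested in the charts of the atlas (\<open>in_chart\<close> below).\<close>

definition chart_at :: "('a, 'n::finite) chart set \<Rightarrow> 'a \<Rightarrow> ('a, 'n) chart" where
  "chart_at A p = (SOME c. c \<in> A \<and> p \<in> fst c)"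

text \<open>\<open>frame A c p\<close> turns the components of a tangent vector at \<open>p\<close> with respect to the
  chart \<open>c\<close> into the vector of the model tangent space at \<open>p\<close>.\<close>

definition frame :: "('a, 'n::finite) chart set \<Rightarrow> ('a, 'n) chart \<Rightarrow> 'a \<Rightarrow> real ^ 'n \<Rightarrow> real ^ 'n" where
  "frame A c p = frechet_derivative (snd (chart_at A p) \<circ> chart_inv c) (at (snd c p))"

definition smooth_map :: "('a::topological_space, 'n::finite) chart set \<Rightarrow>
    ('b::topological_space, 'm::finite) chart set \<Rightarrow> ('a \<Rightarrow> 'b) \<Rightarrow> bool" where
  "smooth_map A B f \<longleftrightarrow> continuous_on UNIV f \<and>
     (\<forall>c\<in>A. \<forall>d\<in>B. smooth_on (snd c ` (fst c \<inter> f -` fst d)) (snd d \<circ> f \<circ> chart_inv c))"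

definition tangent_map :: "('a, 'n::finite) chart set \<Rightarrow> ('b, 'm::finite) chart set \<Rightarrow>
    ('a \<Rightarrow> 'b) \<Rightarrow> 'a \<Rightarrow> real ^ 'n \<Rightarrow> real ^ 'm" where
  "tangent_map A B f p =
     frechet_derivative (snd (chart_at B (f p)) \<circ> f \<circ> chart_inv (chart_at A p))
       (at (snd (chart_at A p) p))"

section \<open>Covariant tensors and differential forms\<close>

text \<open>A covariant \<open>k\<close>-tensor on \<open>real ^ 'n\<close> is a function of lists of vectors; its value is
  relevant for lists of length \<open>k\<close> and is \<open>0\<close> for all other lists.\<close>

type_synonym 'n tensor = "(real ^ 'n) list \<Rightarrow> real"

definition multilinear :: "nat \<Rightarrow> 'n::finite tensor \<Rightarrow> bool" where
  "multilinear k \<alpha> \<longleftrightarrow> (\<forall>vs. length vs \<noteq> k \<longrightarrow> \<alpha> vs = 0) \<and>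
     (\<forall>vs i. length vs = k \<longrightarrow> i < k \<longrightarrow> linear (\<lambda>v. \<alpha> (vs[i := v])))"

definition alternating :: "'n::finite tensor \<Rightarrow> bool" where
  "alternating \<alpha> \<longleftrightarrow> (\<forall>vs i j. i < j \<longrightarrow> j < length vs \<longrightarrow> vs ! i = vs ! j \<longrightarrow> \<alpha> vs = 0)"

text \<open>The wedge product in its shuffle form: \<open>S\<close> is the set of positions fed to \<open>\<alpha>\<close>, and the
  sign is that of the shuffle. For a \<open>k\<close>-form and an \<open>l\<close>-form, only the sets with \<open>k\<close>
  elements contribute; \<open>(\<alpha> \<and>\<^sub>w \<beta>) [u, v] = \<alpha> [u] * \<beta> [v] - \<alpha> [v] * \<beta> [u]\<close> for 1-forms.\<close>

definition wedge :: "'n::finite tensor \<Rightarrow> 'n tensor \<Rightarrow> 'n tensor"  (infixl "\<and>\<^sub>w" 70) where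
  "\<alpha> \<and>\<^sub>w \<beta> = (\<lambda>vs. \<Sum>S\<in>Pow {..<length vs}.
     (- 1) ^ card {(i, j). i \<in> S \<and> j \<in> {..<length vs} - S \<and> j < i} *
     \<alpha> (nths vs S) * \<beta> (nths vs ({..<length vs} - S)))"

type_synonym ('a, 'n) tensor_field = "'a \<Rightarrow> 'n tensor"

definition in_chart :: "('a, 'n::finite) chart set \<Rightarrow> ('a, 'n) chart \<Rightarrow>
    ('a, 'n) tensor_field \<Rightarrow> real ^ 'n \<Rightarrow> 'n tensor" where
  "in_chart A c T x vs = T (chart_inv c x) (map (frame A c (chart_inv c x)) vs)"

definition smooth_tensor :: "('a, 'n::finite) chart set \<Rightarrow> nat \<Rightarrow> ('a, 'n) tensor_field \<Rightarrow> bool" where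
  "smooth_tensor A k T \<longleftrightarrow> (\<forall>p. multilinear k (T p)) \<and>
     (\<forall>c\<in>A. \<forall>vs. smooth_on (snd c ` fst c) (\<lambda>x. in_chart A c T x vs))"

definition smooth_form :: "('a, 'n::finite) chart set \<Rightarrow> nat \<Rightarrow> ('a, 'n) tensor_field \<Rightarrow> bool" where
  "smooth_form A k T \<longleftrightarrow> smooth_tensor A k T \<and> (\<forall>p. alternating (T p))"

definition form0 :: "('a \<Rightarrow> real) \<Rightarrow> ('a, 'n::finite) tensor_field" where
  "form0 f p = (\<lambda>vs. if vs = [] then f p else 0)"

definition smooth_function :: "('a, 'n::finite) chart set \<Rightarrow> ('a \<Rightarrow> real) \<Rightarrow> bool" where
  "smooth_function A f \<longleftrightarrow> (\<forall>c\<in>A. smooth_on (snd c ` fst c) (f \<circ> chart_inv c))"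

text \<open>The exterior derivative at \<open>p\<close>, by the coordinate formula in the chosen chart around \<open>p\<close>
  (where the components of tangent vectors at \<open>p\<close> are the vectors themselves).\<close>

definition ext_d :: "('a, 'n::finite) chart set \<Rightarrow> ('a, 'n) tensor_field \<Rightarrow> ('a, 'n) tensor_field" where
  "ext_d A \<alpha> p vs = (\<Sum>i<length vs. (- 1) ^ i *
     frechet_derivative (\<lambda>x. in_chart A (chart_at A p) \<alpha> x (take i vs @ drop (Suc i) vs))
       (at (snd (chart_at A p) p)) (vs ! i))"

definition pullback :: "('a, 'n::finite) chart set \<Rightarrow> ('b, 'm::finite) chart set \<Rightarrow> ('a \<Rightarrow> 'b) \<Rightarrow>
    ('b, 'm) tensor_field \<Rightarrow> ('a, 'n) tensor_field" where
  "pullback A B f \<alpha> p vs = \<alpha> (f p) (map (tangent_map A B f p) vs)"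

section \<open>Riemannian metrics, contractions and integration\<close>

definition riemannian_metric :: "('a, 'n::finite) chart set \<Rightarrow> ('a, 'n) tensor_field \<Rightarrow> bool" where
  "riemannian_metric A g \<longleftrightarrow> smooth_tensor A 2 g \<and> (\<forall>p u v. g p [u, v] = g p [v, u]) \<and>
     (\<forall>p v. v \<noteq> 0 \<longrightarrow> g p [v, v] > 0)"

definition e_vec :: "'n::finite \<Rightarrow> real ^ 'n" where
  "e_vec i = axis i 1"

definition gram :: "'n::finite tensor \<Rightarrow> real ^ 'n ^ 'n" where
  "gram g = (\<chi> i j. g [e_vec i, e_vec j])"

text \<open>\<open>contract g k \<alpha> \<beta>\<close> is \<open>\<alpha>\<close> with all \<open>k\<close> indices contracted with those of \<open>\<beta>\<close> by means of
  the inverse metric, without a combinatorial factor.\<close>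

definition contract :: "'n::finite tensor \<Rightarrow> nat \<Rightarrow> 'n tensor \<Rightarrow> 'n tensor \<Rightarrow> real" where
  "contract g k \<alpha> \<beta> = (\<Sum>is\<in>{is. length is = k}. \<Sum>js\<in>{js. length js = k}.
     \<alpha> (map e_vec is) * \<beta> (map e_vec js) * (\<Prod>r<k. matrix_inv (gram g) $ (is ! r) $ (js ! r)))"

definition form_inner :: "'n::finite tensor \<Rightarrow> nat \<Rightarrow> 'n tensor \<Rightarrow> 'n tensor \<Rightarrow> real" where
  "form_inner g k \<alpha> \<beta> = contract g k \<alpha> \<beta> / fact k"

definition form_sq :: "'n::finite tensor \<Rightarrow> nat \<Rightarrow> 'n tensor \<Rightarrow> real" where
  "form_sq g k \<alpha> = form_inner g k \<alpha> \<alpha>"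

text \<open>\<open>circ2\<close> and \<open>circ3\<close> are \<open>F\<^sub>i\<^sub>a F\<^sub>j\<^sup>a\<close> and \<open>(1/2) \<nu>\<^sub>i\<^sub>a\<^sub>b \<nu>\<^sub>j\<^sup>a\<^sup>b\<close>.\<close>

definition circ2 :: "'n::finite tensor \<Rightarrow> 'n tensor \<Rightarrow> 'n tensor" where
  "circ2 g F = (\<lambda>vs. if length vs = 2
     then contract g 1 (\<lambda>ws. F (vs ! 0 # ws)) (\<lambda>ws. F (vs ! 1 # ws)) else 0)"

definition circ3 :: "'n::finite tensor \<Rightarrow> 'n tensor \<Rightarrow> 'n tensor" where
  "circ3 g \<nu> = (\<lambda>vs. if length vs = 2
     then 1 / 2 * contract g 2 (\<lambda>ws. \<nu> (vs ! 0 # ws)) (\<lambda>ws. \<nu> (vs ! 1 # ws)) else 0)"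

definition tensor_square :: "'n::finite tensor \<Rightarrow> 'n tensor" where
  "tensor_square \<theta> = (\<lambda>vs. if length vs = 2 then \<theta> [vs ! 0] * \<theta> [vs ! 1] else 0)"

text \<open>The integral over a compact manifold against the Riemannian density: choose finitely many
  compact sets, each inside a chart domain, that cover the manifold, make them disjoint, and add
  up the coordinate integrals of \<open>f * sqrt (det g)\<close>. By the change of variables formula the
  result does not depend on the chosen cover.\<close>

definition compact_cover :: "('a::topological_space, 'n::finite) chart set \<Rightarrow>
    (('a, 'n) chart \<times> 'a set) list" where
  "compact_cover A = (SOME cs. (\<forall>(c, K)\<in>set cs. c \<in> A \<and> compact K \<and> K \<subseteq> fst c) \<and>
     (\<Union>(c, K)\<in>set cs. K) = UNIV)"

definition riem_integral :: "('a::topological_space, 'n::finite) chart set \<Rightarrow>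
    ('a, 'n) tensor_field \<Rightarrow> ('a \<Rightarrow> real) \<Rightarrow> real" where
  "riem_integral A g f = (let cs = compact_cover A in
     \<Sum>i<length cs. let c = fst (cs ! i) in
       set_lebesgue_integral lborel (snd c ` (snd (cs ! i) - (\<Union>j<i. snd (cs ! j))))
         (\<lambda>x. f (chart_inv c x) * sqrt (det (gram (in_chart A c g x)))))"

section \<open>Principal circle bundles and connections\<close>

definition circle_action ::
    "('m::topological_space, 'k::finite) chart set \<Rightarrow> (complex \<Rightarrow> 'm \<Rightarrow> 'm) \<Rightarrow> bool" where
  "circle_action B act \<longleftrightarrow>
     (\<forall>p. act 1 p = p) \<and>
     (\<forall>z w p. norm z = 1 \<longrightarrow> norm w = 1 \<longrightarrow> act (z * w) p = act z (act w p)) \<and>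
     continuous_on UNIV (\<lambda>(t, p). act (cis t) p) \<and>
     (\<forall>c\<in>B. \<forall>d\<in>B. smooth_on
        {(t, x). x \<in> snd c ` fst c \<and> act (cis t) (chart_inv c x) \<in> fst d}
        (\<lambda>(t, x). snd d (act (cis t) (chart_inv c x))))"

definition free_action :: "(complex \<Rightarrow> 'm \<Rightarrow> 'm) \<Rightarrow> bool" where
  "free_action act \<longleftrightarrow> (\<forall>z p. norm z = 1 \<longrightarrow> act z p = p \<longrightarrow> z = 1)"

definition generator :: "('m, 'k::finite) chart set \<Rightarrow> (complex \<Rightarrow> 'm \<Rightarrow> 'm) \<Rightarrow> 'm \<Rightarrow> real ^ 'k" where
  "generator B act p = vector_derivative (\<lambda>t. snd (chart_at B p) (act (cis t) p)) (at 0)"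

text \<open>\<open>\<pi>\<close> exhibits the manifold with atlas \<open>A\<close> as the orbit space, with its quotient smooth
  structure, of the circle action on the manifold with atlas \<open>B\<close>.\<close>

definition orbit_projection :: "('m::topological_space, 'k::finite) chart set \<Rightarrow>
    ('a::topological_space, 'n::finite) chart set \<Rightarrow> (complex \<Rightarrow> 'm \<Rightarrow> 'm) \<Rightarrow> ('m \<Rightarrow> 'a) \<Rightarrow> bool" where
  "orbit_projection B A act \<pi> \<longleftrightarrow> smooth_map B A \<pi> \<and> surj \<pi> \<and>
     (\<forall>p q. \<pi> p = \<pi> q \<longleftrightarrow> (\<exists>z. norm z = 1 \<and> q = act z p)) \<and>
     (\<forall>p. surj (tangent_map B A \<pi> p))"

definition invariant_form :: "('m, 'k::finite) chart set \<Rightarrow> (complex \<Rightarrow> 'm \<Rightarrow> 'm) \<Rightarrow>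
    ('m, 'k) tensor_field \<Rightarrow> bool" where
  "invariant_form B act \<alpha> \<longleftrightarrow> (\<forall>z. norm z = 1 \<longrightarrow> pullback B B (act z) \<alpha> = \<alpha>)"

definition connection_form :: "('m, 'k::finite) chart set \<Rightarrow> (complex \<Rightarrow> 'm \<Rightarrow> 'm) \<Rightarrow>
    ('m, 'k) tensor_field \<Rightarrow> bool" where
  "connection_form B act \<eta> \<longleftrightarrow> smooth_form B 1 \<eta> \<and> invariant_form B act \<eta> \<and>
     (\<forall>p. \<eta> p [generator B act p] = 1)"

section \<open>SU(3)-structures\<close>

text \<open>\<open>J\<close> is the almost complex structure for which \<open>\<Omega>\<^sub>+ + i \<Omega>\<^sub>-\<close> is a nonzero form of type
  (3,0). The two equations are the real and imaginary parts of
  \<open>\<Omega>(J u, v, w) = i \<Omega>(u, v, w)\<close>, and they determine \<open>J\<close>.\<close>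

definition complex_volume :: "(real ^ 6 \<Rightarrow> real ^ 6) \<Rightarrow> 6 tensor \<Rightarrow> 6 tensor \<Rightarrow> bool" where
  "complex_volume J \<Omega>p \<Omega>m \<longleftrightarrow> linear J \<and> (\<forall>v. J (J v) = - v) \<and>
     (\<forall>u v w. \<Omega>p [J u, v, w] = - \<Omega>m [u, v, w]) \<and>
     (\<forall>u v w. \<Omega>m [J u, v, w] = \<Omega>p [u, v, w]) \<and>
     (\<exists>u v w. \<Omega>p [u, v, w] \<noteq> 0)"

definition su3_metric :: "('a, 6) tensor_field \<Rightarrow> ('a \<Rightarrow> real ^ 6 \<Rightarrow> real ^ 6) \<Rightarrow> ('a, 6) tensor_field" where
  "su3_metric \<omega> J p = (\<lambda>vs. if length vs = 2 then \<omega> p [vs ! 0, J p (vs ! 1)] else 0)"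

definition su3_structure :: "('a, 6) chart set \<Rightarrow> ('a, 6) tensor_field \<Rightarrow> ('a, 6) tensor_field \<Rightarrow>
    ('a, 6) tensor_field \<Rightarrow> ('a \<Rightarrow> real ^ 6 \<Rightarrow> real ^ 6) \<Rightarrow> bool" where
  "su3_structure A \<omega> \<Omega>p \<Omega>m J \<longleftrightarrow>
     smooth_form A 2 \<omega> \<and> smooth_form A 3 \<Omega>p \<and> smooth_form A 3 \<Omega>m \<and>
     (\<forall>p u. (\<forall>v. \<omega> p [u, v] = 0) \<longrightarrow> u = 0) \<and>
     (\<forall>p. complex_volume (J p) (\<Omega>p p) (\<Omega>m p)) \<and>
     (\<forall>p vs. (\<omega> p \<and>\<^sub>w \<Omega>p p) vs = 0) \<and>
     (\<forall>p vs. 1 / 6 * (\<omega> p \<and>\<^sub>w \<omega> p \<and>\<^sub>w \<omega> p) vs = 1 / 4 * (\<Omega>p p \<and>\<^sub>w \<Omega>m p) vs) \<and>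
     riemannian_metric A (su3_metric \<omega> J)"

section \<open>The reduced data, the functional and the ansatz\<close>

text \<open>The tuples \<open>(g, \<theta>, \<lambda>, \<nu>\<^sub>3, F\<^sub>0)\<close>; the same type holds the variations \<open>(k, \<beta>, f, \<mu>, \<rho>)\<close>.\<close>

record 'a reduced =
  met :: "('a, 6) tensor_field"
  lee :: "('a, 6) tensor_field"
  lam :: "'a \<Rightarrow> real"
  tor :: "('a, 6) tensor_field"
  curv :: "('a, 6) tensor_field"

definition formal_variations :: "('a, 6) chart set \<Rightarrow> 'a reduced set" where
  "formal_variations A = {V. smooth_tensor A 2 (met V) \<and>
     (\<forall>p u v. met V p [u, v] = met V p [v, u]) \<and>
     smooth_form A 1 (lee V) \<and> smooth_function A (lam V) \<and>
     smooth_form A 3 (tor V) \<and> smooth_form A 2 (curv V)}"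

definition reduced_data :: "('a, 6) chart set \<Rightarrow> 'a reduced set" where
  "reduced_data A = {X. X \<in> formal_variations A \<and> riemannian_metric A (met X)}"

definition reduced_functional :: "('a::topological_space, 6) chart set \<Rightarrow> 'a reduced \<Rightarrow> real" where
  "reduced_functional A X = - 2 * pi * riem_integral A (met X) (\<lambda>p.
     15 / 8 * (lam X p)\<^sup>2 + 5 / 18 * form_sq (met X p) 1 (lee X p) +
     1 / 4 * form_sq (met X p) 3 (tor X p) + 1 / 4 * form_sq (met X p) 2 (curv X p))"

definition L2_pairing :: "('a::topological_space, 6) chart set \<Rightarrow> ('a, 6) tensor_field \<Rightarrow>
    'a reduced \<Rightarrow> 'a reduced \<Rightarrow> real" where
  "L2_pairing A g V W = riem_integral A g (\<lambda>p.
     contract (g p) 2 (met V p) (met W p) + form_inner (g p) 1 (lee V p) (lee W p) +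
     lam V p * lam W p + form_inner (g p) 3 (tor V p) (tor W p) +
     form_inner (g p) 2 (curv V p) (curv W p))"

text \<open>A transverse structure together with the connection form and the \<open>G\<^sub>2\<close>-form on the total
  space. There is no factor \<open>h\<close> in \<open>\<phi>\<close>: the generator has constant length 1.\<close>

record ('a, 'm) transverse =
  omega :: "('a, 6) tensor_field"
  Omega_re :: "('a, 6) tensor_field"
  Omega_im :: "('a, 6) tensor_field"
  acs :: "'a \<Rightarrow> real ^ 6 \<Rightarrow> real ^ 6"
  conn :: "('m, 7) tensor_field"
  phi :: "('m, 7) tensor_field"

definition ansatz :: "('a::topological_space, 6) chart set \<Rightarrow> ('m::topological_space, 7) chart set \<Rightarrow>
    (complex \<Rightarrow> 'm \<Rightarrow> 'm) \<Rightarrow> ('m \<Rightarrow> 'a) \<Rightarrow> ('a, 'm) transverse \<Rightarrow> 'a reduced \<Rightarrow> bool" where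
  "ansatz A B act \<pi> S X \<longleftrightarrow>
     su3_structure A (omega S) (Omega_re S) (Omega_im S) (acs S) \<and>
     met X = su3_metric (omega S) (acs S) \<and>
     smooth_form A 1 (lee X) \<and> smooth_function A (lam X) \<and>
     smooth_form A 3 (tor X) \<and> smooth_form A 2 (curv X) \<and>
     connection_form B act (conn S) \<and>
     (\<forall>p vs. phi S p vs =
        (conn S p \<and>\<^sub>w pullback B A \<pi> (omega S) p) vs + pullback B A \<pi> (Omega_re S) p vs) \<and>
     (\<forall>p vs. (tor X p \<and>\<^sub>w omega S p) vs = 0) \<and>
     (\<forall>p vs. (tor X p \<and>\<^sub>w Omega_re S p) vs = 0) \<and>
     (\<forall>p vs. (tor X p \<and>\<^sub>w Omega_im S p) vs = 0) \<and>
     (\<forall>p vs. (curv X p \<and>\<^sub>w omega S p \<and>\<^sub>w omega S p) vs = 0) \<and>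
     (\<forall>p vs. (curv X p \<and>\<^sub>w Omega_re S p) vs = 0) \<and>
     (\<forall>p vs. ext_d A (Omega_re S) p vs = (lee X p \<and>\<^sub>w Omega_re S p) vs) \<and>
     (\<forall>p vs. ext_d A (Omega_im S) p vs = (lee X p \<and>\<^sub>w Omega_im S p) vs) \<and>
     (\<forall>p vs. ext_d A (omega S) p vs = 2 / 3 * (lee X p \<and>\<^sub>w omega S p) vs + tor X p vs) \<and>
     (\<forall>p vs. ext_d B (conn S) p vs =
        pullback B A \<pi> (\<lambda>q ws. curv X q ws + lam X q * omega S q ws) p vs) \<and>
     (\<forall>p vs. ext_d A (curv X) p vs +
        ((\<lambda>ws. ext_d A (form0 (lam X)) p ws + 2 / 3 * lam X p * lee X p ws) \<and>\<^sub>w omega S p) vs +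
        lam X p * tor X p vs = 0)"

text \<open>Infinitesimal variations of the ansatz: the linearization of every condition above, where
  \<open>\<omega>', \<Omega>p', \<Omega>m', J', \<eta>'\<close> are the variations of \<open>\<omega>, \<Omega>\<^sub>+, \<Omega>\<^sub>-, J, \<eta>\<close>. In particular
  \<open>\<eta>'\<close> vanishes on the generator, whose length is not varied.\<close>

definition admissible_variations ::
    "('a::topological_space, 6) chart set \<Rightarrow> ('m::topological_space, 7) chart set \<Rightarrow>
     (complex \<Rightarrow> 'm \<Rightarrow> 'm) \<Rightarrow> ('m \<Rightarrow> 'a) \<Rightarrow> ('a, 'm) transverse \<Rightarrow> 'a reduced \<Rightarrow> 'a reduced set" where
  "admissible_variations A B act \<pi> S X = {V. V \<in> formal_variations A \<and>
     (\<exists>\<omega>' \<Omega>p' \<Omega>m' J' \<eta>'.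
       smooth_form A 2 \<omega>' \<and> smooth_form A 3 \<Omega>p' \<and> smooth_form A 3 \<Omega>m' \<and>
       \<comment> \<open>SU(3)-structure and its metric\<close>
       (\<forall>p vs. (\<omega>' p \<and>\<^sub>w Omega_re S p) vs + (omega S p \<and>\<^sub>w \<Omega>p' p) vs = 0) \<and>
       (\<forall>p vs. 1 / 2 * (\<omega>' p \<and>\<^sub>w omega S p \<and>\<^sub>w omega S p) vs =
          1 / 4 * ((\<Omega>p' p \<and>\<^sub>w Omega_im S p) vs + (Omega_re S p \<and>\<^sub>w \<Omega>m' p) vs)) \<and>
       (\<forall>p. linear (J' p) \<and> (\<forall>v. J' p (acs S p v) + acs S p (J' p v) = 0)) \<and>
       (\<forall>p u v w. \<Omega>p' p [acs S p u, v, w] + Omega_re S p [J' p u, v, w] = - \<Omega>m' p [u, v, w]) \<and>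
       (\<forall>p u v w. \<Omega>m' p [acs S p u, v, w] + Omega_im S p [J' p u, v, w] = \<Omega>p' p [u, v, w]) \<and>
       (\<forall>p u v. met V p [u, v] = \<omega>' p [u, acs S p v] + omega S p [u, J' p v]) \<and>
       \<comment> \<open>types of the torsion and curvature components\<close>
       (\<forall>p vs. (tor V p \<and>\<^sub>w omega S p) vs + (tor X p \<and>\<^sub>w \<omega>' p) vs = 0) \<and>
       (\<forall>p vs. (tor V p \<and>\<^sub>w Omega_re S p) vs + (tor X p \<and>\<^sub>w \<Omega>p' p) vs = 0) \<and>
       (\<forall>p vs. (tor V p \<and>\<^sub>w Omega_im S p) vs + (tor X p \<and>\<^sub>w \<Omega>m' p) vs = 0) \<and>
       (\<forall>p vs. (curv V p \<and>\<^sub>w omega S p \<and>\<^sub>w omega S p) vs +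
          2 * (curv X p \<and>\<^sub>w omega S p \<and>\<^sub>w \<omega>' p) vs = 0) \<and>
       (\<forall>p vs. (curv V p \<and>\<^sub>w Omega_re S p) vs + (curv X p \<and>\<^sub>w \<Omega>p' p) vs = 0) \<and>
       \<comment> \<open>structure equations\<close>
       smooth_form B 1 \<eta>' \<and> invariant_form B act \<eta>' \<and> (\<forall>p. \<eta>' p [generator B act p] = 0) \<and>
       (\<forall>p vs. ext_d B \<eta>' p vs =
          pullback B A \<pi>
            (\<lambda>q ws. curv V q ws + lam V q * omega S q ws + lam X q * \<omega>' q ws) p vs) \<and>
       (\<forall>p vs. ext_d A \<Omega>p' p vs = (lee V p \<and>\<^sub>w Omega_re S p) vs + (lee X p \<and>\<^sub>w \<Omega>p' p) vs) \<and>
       (\<forall>p vs. ext_d A \<Omega>m' p vs = (lee V p \<and>\<^sub>w Omega_im S p) vs + (lee X p \<and>\<^sub>w \<Omega>m' p) vs) \<and>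
       (\<forall>p vs. ext_d A \<omega>' p vs =
          2 / 3 * ((lee V p \<and>\<^sub>w omega S p) vs + (lee X p \<and>\<^sub>w \<omega>' p) vs) + tor V p vs) \<and>
       (\<forall>p vs. ext_d A (curv V) p vs + (ext_d A (form0 (lam V)) p \<and>\<^sub>w omega S p) vs +
          (ext_d A (form0 (lam X)) p \<and>\<^sub>w \<omega>' p) vs +
          lam V p * ext_d A (omega S) p vs + lam X p * ext_d A \<omega>' p vs = 0))}"

section \<open>Formal gradient and gradient flow\<close>

text \<open>\<open>has_velocity Y V t I\<close>: the tuple of derivatives of the curve \<open>Y\<close> at \<open>t\<close> is \<open>V\<close>. As the
  tangent spaces do not move, this is a pointwise condition.\<close>

definition has_velocity :: "(real \<Rightarrow> 'a reduced) \<Rightarrow> 'a reduced \<Rightarrow> real \<Rightarrow> real set \<Rightarrow> bool" where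
  "has_velocity Y V t I \<longleftrightarrow> (\<forall>p vs.
     ((\<lambda>s. met (Y s) p vs) has_real_derivative met V p vs) (at t within I) \<and>
     ((\<lambda>s. lee (Y s) p vs) has_real_derivative lee V p vs) (at t within I) \<and>
     ((\<lambda>s. lam (Y s) p) has_real_derivative lam V p) (at t within I) \<and>
     ((\<lambda>s. tor (Y s) p vs) has_real_derivative tor V p vs) (at t within I) \<and>
     ((\<lambda>s. curv (Y s) p vs) has_real_derivative curv V p vs) (at t within I))"

definition smooth_family :: "('a, 6) chart set \<Rightarrow> real \<Rightarrow> (real \<Rightarrow> 'a reduced) \<Rightarrow> bool" where
  "smooth_family A \<epsilon> Y \<longleftrightarrow> (\<forall>s\<in>{-\<epsilon><..<\<epsilon>}. Y s \<in> reduced_data A) \<and>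
     (\<forall>c\<in>A. let D = {-\<epsilon><..<\<epsilon>} \<times> snd c ` fst c in
        smooth_on D (\<lambda>(s, x). lam (Y s) (chart_inv c x)) \<and>
        (\<forall>vs. smooth_on D (\<lambda>(s, x). in_chart A c (met (Y s)) x vs) \<and>
              smooth_on D (\<lambda>(s, x). in_chart A c (lee (Y s)) x vs) \<and>
              smooth_on D (\<lambda>(s, x). in_chart A c (tor (Y s)) x vs) \<and>
              smooth_on D (\<lambda>(s, x). in_chart A c (curv (Y s)) x vs)))"

text \<open>\<open>G\<close> is a formal gradient at \<open>X\<close> with respect to a class \<open>\<V>\<close> of test variations.\<close>

definition formal_gradient :: "('a::topological_space, 6) chart set \<Rightarrow> 'a reduced set \<Rightarrow>
    'a reduced \<Rightarrow> 'a reduced \<Rightarrow> bool" where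
  "formal_gradient A \<V> X G \<longleftrightarrow> G \<in> formal_variations A \<and>
     (\<forall>V\<in>\<V>. \<forall>\<epsilon>>0. \<forall>Y. smooth_family A \<epsilon> Y \<longrightarrow> Y 0 = X \<longrightarrow> has_velocity Y V 0 UNIV \<longrightarrow>
        ((\<lambda>s. reduced_functional A (Y s)) has_real_derivative L2_pairing A (met X) G V) (at 0))"

definition positive_gradient_flow :: "('a::topological_space, 6) chart set \<Rightarrow>
    (real \<Rightarrow> 'a reduced set) \<Rightarrow> real set \<Rightarrow> (real \<Rightarrow> 'a reduced) \<Rightarrow> bool" where
  "positive_gradient_flow A \<V> I X \<longleftrightarrow>
     (\<forall>t\<in>I. \<exists>G. formal_gradient A (\<V> t) (X t) G \<and> has_velocity X G t I)"

definition flow_rhs :: "'a reduced \<Rightarrow> 'a reduced" where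
  "flow_rhs X = \<lparr>
     met = (\<lambda>p vs. - 2 * pi *
       ((15 / 16 * (lam X p)\<^sup>2 + 5 / 36 * form_sq (met X p) 1 (lee X p) +
         1 / 8 * form_sq (met X p) 3 (tor X p) + 1 / 8 * form_sq (met X p) 2 (curv X p)) *
           met X p vs
        - 5 / 18 * tensor_square (lee X p) vs
        - 1 / 4 * circ3 (met X p) (tor X p) vs
        - 1 / 4 * circ2 (met X p) (curv X p) vs)),
     lee = (\<lambda>p vs. - (10 * pi / 9) * lee X p vs),
     lam = (\<lambda>p. - (15 * pi / 2) * lam X p),
     tor = (\<lambda>p vs. - pi * tor X p vs),
     curv = (\<lambda>p vs. - pi * curv X p vs)\<rparr>"

definition coupled_system :: "real set \<Rightarrow> (real \<Rightarrow> 'a reduced) \<Rightarrow> bool" where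
  "coupled_system I X \<longleftrightarrow> (\<forall>t\<in>I. has_velocity X (flow_rhs (X t)) t I)"

end

theory Submission
  imports Defs
begin

text \<open>All quantities are evaluated in the charts of the atlas, where contractions with the inverse
  metric do not depend on the frame. Jacobi's formula \<open>d (det g) = det g * tr (g\<inverse> dg)\<close>,
  \<open>d (g\<inverse>) = - g\<inverse> (dg) g\<inverse>\<close> and the antisymmetry of forms give the pointwise first variation of the
  energy density times the Riemannian density; it is the pairing with \<open>flow_rhs\<close>, and it may be
  integrated because the integrand is continuously differentiable in the parameter on the
  compact pieces of the manifold.

  Along the straight line \<open>X + s V\<close>, which by compactness consists of Riemannian data for
  small \<open>s\<close>, a formal gradient \<open>G\<close> therefore satisfies \<open>\<langle>G, V\<rangle> = \<langle>flow_rhs X, V\<rangle>\<close>. Taking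
  \<open>V = G - flow_rhs X\<close> and using that the pairing is positive definite yields uniqueness. The
  equations for \<open>\<theta>\<close>, \<open>\<lambda>\<close>, \<open>\<nu>\<^sub>3\<close> and \<open>F\<^sub>0\<close> are decoupled linear equations at every point.\<close>


section \<open>Smooth functions\<close>

text \<open>Two obstacles shape the proof. The model tangent space at a point comes from an
  arbitrarily chosen chart, so components in it may jump from point to point. Velocities are given
  in these spaces, while smoothness is visible only in a fixed chart. Invariance of contractions
  under linear bijections connects the two: the same scalar can be differentiated at the point and
  integrated in a chart. Moreover, testing determines a gradient only through its pairings with the
  test class, and nothing makes the difference of two candidates admissible. Uniqueness is therefore
  obtained against all formal variations; among the admissible ones, \<open>flow_rhs\<close> is one
  gradient and the others are exactly those with the same pairings. A test family only has to
  consist of Riemannian data and need not satisfy the ansatz, so a straight line qualifies. Its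
  existence also keeps the test condition, which ranges over all families with a given velocity,
  from being empty.\<close>

lemma Ck_on_SucD:
  assumes "open U" "Ck_on (Suc k) U f" "x \<in> U"
  shows "(f has_derivative frechet_derivative f (at x)) (at x)"
proof -
  have "f differentiable (at x within U)" using assms(2,3) by (simp add: differentiable_on_def)
  then show ?thesis using assms(1,3) by (simp only: at_within_open frechet_derivative_works)
qed

text \<open>Openness is essential: agreement on an open set forces equal derivatives at its points,
  which is what the induction passes on to the next order.\<close>

lemma Ck_on_cong:
  assumes "open U" "\<And>x. x \<in> U \<Longrightarrow> f x = g x"
  shows "Ck_on k U f \<longleftrightarrow> Ck_on k U g"
proof -
  have *: "Ck_on k U f \<Longrightarrow> Ck_on k U g" if "\<And>x. x \<in> U \<Longrightarrow> f x = g x" for f g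
    using that
  proof (induction k arbitrary: f g)
    case 0
    then show ?case by (simp cong: continuous_on_cong)
  next
    case (Suc k)
    have d: "(g has_derivative frechet_derivative f (at x)) (at x)" if "x \<in> U" for x
      using Ck_on_SucD[OF assms(1) Suc.prems(1) that] assms(1) that Suc.prems(2)
      by (rule has_derivative_transform_within_open) auto
    have "g differentiable_on U"
      unfolding differentiable_on_def differentiable_def
      using has_derivative_at_withinI[OF d] by blast
    moreover have "Ck_on k U (\<lambda>x. frechet_derivative g (at x) b)" if "b \<in> Basis" for b
    proof (rule Suc.IH)
      show "Ck_on k U (\<lambda>x. frechet_derivative f (at x) b)"
        using Suc.prems(1) that by simp
    qed (use frechet_derivative_at[OF d] in metis)
    ultimately show ?case by simp
  qed
  show ?thesis using *[of f g] *[of g f] assms(2) by metis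
qed

text \<open>Accepts any explicit derivative in place of \<open>frechet_derivative\<close>, so that
  the closure properties below reduce to the usual differentiation rules.\<close>

lemma Ck_on_SucI:
  assumes "open U" "\<And>x. x \<in> U \<Longrightarrow> (f has_derivative f' x) (at x)"
    and "\<And>b. b \<in> Basis \<Longrightarrow> Ck_on k U (\<lambda>x. f' x b)"
  shows "Ck_on (Suc k) U f"
proof -
  have "f differentiable_on U"
    unfolding differentiable_on_def differentiable_def
    using has_derivative_at_withinI[OF assms(2)] by blast
  moreover have "Ck_on k U (\<lambda>x. frechet_derivative f (at x) b)" if "b \<in> Basis" for b
  proof (rule Ck_on_cong[OF assms(1), THEN iffD1, OF _ assms(3)[OF that]])
    show "f' x b = frechet_derivative f (at x) b" if "x \<in> U" for x
      using frechet_derivative_at[OF assms(2)[OF that]] by simp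
  qed
  ultimately show ?thesis by simp
qed

lemma Ck_on_deriv:
  "Ck_on (Suc k) U f \<Longrightarrow> b \<in> Basis \<Longrightarrow> Ck_on k U (\<lambda>x. frechet_derivative f (at x) b)"
  by simp

lemma Ck_on_lower: "open U \<Longrightarrow> Ck_on (Suc k) U f \<Longrightarrow> Ck_on k U f"
proof (induction k arbitrary: f)
  case 0
  then show ?case by (simp add: differentiable_imp_continuous_on)
next
  case (Suc k)
  show ?case
    by (rule Ck_on_SucI[OF Suc.prems(1) Ck_on_SucD[OF Suc.prems]])
       (assumption | rule Suc.IH[OF Suc.prems(1) Ck_on_deriv[OF Suc.prems(2)]])+
qed

lemma Ck_on_imp_continuous_on: "open U \<Longrightarrow> Ck_on k U f \<Longrightarrow> continuous_on U f"
proof (induction k)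
  case (Suc k)
  then show ?case using Ck_on_lower by blast
qed simp

lemma Ck_on_const: "open U \<Longrightarrow> Ck_on k U (\<lambda>x. c)"
proof (induction k arbitrary: c)
  case (Suc k)
  show ?case
    by (rule Ck_on_SucI[OF Suc.prems has_derivative_const]) (rule Suc.IH[OF Suc.prems])
qed simp

lemma Ck_on_add: "open U \<Longrightarrow> Ck_on k U f \<Longrightarrow> Ck_on k U g \<Longrightarrow> Ck_on k U (\<lambda>x. f x + g x)"
proof (induction k arbitrary: f g)
  case 0
  then show ?case by (simp add: continuous_on_add)
next
  case (Suc k)
  show ?case
    by (rule Ck_on_SucI[OF \<open>open U\<close> has_derivative_add[OF Ck_on_SucD Ck_on_SucD]])
       (rule Suc.IH Ck_on_deriv Suc.prems | assumption)+
qed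

text \<open>The product rule brings back the undifferentiated factors, which are needed to order k
  only; \<open>Ck_on_lower\<close> supplies them.\<close>

lemma Ck_on_mult: "open U \<Longrightarrow> Ck_on k U f \<Longrightarrow> Ck_on k U g \<Longrightarrow> Ck_on k U (\<lambda>x. f x * g x)"
proof (induction k arbitrary: f g)
  case 0
  then show ?case by (simp add: continuous_on_mult)
next
  case (Suc k)
  show ?case
    by (rule Ck_on_SucI[OF \<open>open U\<close> has_derivative_mult[OF Ck_on_SucD Ck_on_SucD]])
       (rule Ck_on_add Suc.IH Ck_on_deriv Suc.prems Ck_on_lower | assumption)+
qed

lemma Ck_on_sum:
  "open U \<Longrightarrow> (\<And>i. i \<in> I \<Longrightarrow> Ck_on k U (f i)) \<Longrightarrow> Ck_on k U (\<lambda>x. \<Sum>i\<in>I. f i x)"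
  by (induction I rule: infinite_finite_induct) (auto intro: Ck_on_const Ck_on_add)

lemma Ck_on_prod:
  "open U \<Longrightarrow> (\<And>i. i \<in> I \<Longrightarrow> Ck_on k U (f i)) \<Longrightarrow> Ck_on k U (\<lambda>x. \<Prod>i\<in>I. f i x)"
  by (induction I rule: infinite_finite_induct) (auto intro: Ck_on_const Ck_on_mult)

text \<open>The derivative contains \<open>inverse (f x)\<close> again, but only to order k, where
  the induction hypothesis applies to f itself. The square root below follows the same
  pattern.\<close>

lemma Ck_on_inverse:
  "open U \<Longrightarrow> Ck_on k U f \<Longrightarrow> (\<And>x. x \<in> U \<Longrightarrow> f x \<noteq> 0) \<Longrightarrow> Ck_on k U (\<lambda>x. inverse (f x))"
proof (induction k arbitrary: f)
  case 0
  then show ?case by (simp add: continuous_on_inverse)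
next
  case (Suc k)
  have inv: "Ck_on k U (\<lambda>x. inverse (f x))"
    using Suc.IH[OF Suc.prems(1) Ck_on_lower[OF Suc.prems(1,2)] Suc.prems(3)] by simp
  \<comment> \<open>The sign is written as a constant factor so that the product rule for
    \<open>Ck_on\<close> covers it.\<close>
  have "Ck_on k U (\<lambda>x. -1 * (inverse (f x) * frechet_derivative f (at x) b * inverse (f x)))"
    if "b \<in> Basis" for b
    by (intro Ck_on_mult Ck_on_const inv Ck_on_deriv[OF Suc.prems(2) that] Suc.prems(1))
  then have "Ck_on k U (\<lambda>x. - (inverse (f x) * frechet_derivative f (at x) b * inverse (f x)))"
    if "b \<in> Basis" for b
    using that by simp
  then show ?case
  proof (rule Ck_on_SucI[OF Suc.prems(1), rotated])
    fix x assume "x \<in> U"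
    then show "((\<lambda>x. inverse (f x)) has_derivative
        (\<lambda>b. - (inverse (f x) * frechet_derivative f (at x) b * inverse (f x)))) (at x)"
      using Deriv.has_derivative_inverse[OF _ Ck_on_SucD[OF Suc.prems(1,2)]] Suc.prems(3) by blast
  qed
qed

lemma Ck_on_divide:
  "open U \<Longrightarrow> Ck_on k U f \<Longrightarrow> Ck_on k U g \<Longrightarrow> (\<And>x. x \<in> U \<Longrightarrow> g x \<noteq> 0) \<Longrightarrow>
    Ck_on k U (\<lambda>x. f x / g x)"
  unfolding divide_inverse by (intro Ck_on_mult Ck_on_inverse)

lemma Ck_on_sqrt:
  "open U \<Longrightarrow> Ck_on k U f \<Longrightarrow> (\<And>x. x \<in> U \<Longrightarrow> f x > 0) \<Longrightarrow> Ck_on k U (\<lambda>x. sqrt (f x))"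
proof (induction k arbitrary: f)
  case 0
  then show ?case by (simp add: continuous_on_real_sqrt)
next
  case (Suc k)
  have sq: "Ck_on k U (\<lambda>x. sqrt (f x))"
    using Suc.IH[OF Suc.prems(1) Ck_on_lower[OF Suc.prems(1,2)] Suc.prems(3)] by simp
  have nz: "sqrt (f x) \<noteq> 0" if "x \<in> U" for x
    using Suc.prems(3)[OF that] by simp
  have "Ck_on k U (\<lambda>x. frechet_derivative f (at x) b * (inverse (sqrt (f x)) * (1/2)))"
    if "b \<in> Basis" for b
    by (intro Ck_on_mult Ck_on_inverse Ck_on_const sq Ck_on_deriv[OF Suc.prems(2) that] Suc.prems(1) nz)
  moreover have "((\<lambda>x. sqrt (f x)) has_derivative
      (\<lambda>b. frechet_derivative f (at x) b * (inverse (sqrt (f x)) * (1/2)))) (at x)"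
    if "x \<in> U" for x
    by (rule has_derivative_real_sqrt[OF _ Ck_on_SucD[OF Suc.prems(1,2) that], THEN has_derivative_eq_rhs])
       (use Suc.prems(3)[OF that] in \<open>auto simp: field_simps fun_eq_iff\<close>)
  ultimately show ?case
    by (rule Ck_on_SucI[OF Suc.prems(1), rotated])
qed

text \<open>The first projection will be the parameter s in the family X + s V.\<close>

lemma Ck_on_fst:
  "open U \<Longrightarrow> Ck_on k U fst"
proof (cases k)
  case (Suc n)
  show "open U \<Longrightarrow> Ck_on k U fst" unfolding Suc
    by (rule Ck_on_SucI[where f'="\<lambda>x. fst"])
       (auto intro: Ck_on_const has_derivative_fst[OF has_derivative_ident])
qed (auto intro: continuous_intros)

lemma Ck_on_comp_snd:
  fixes f :: "'e::euclidean_space \<Rightarrow> real" and I :: "'d::euclidean_space set"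
  assumes "open I" "open U" "Ck_on k U f"
  shows "Ck_on k (I \<times> U) (\<lambda>z. f (snd z))"
  using assms(3)
proof (induction k arbitrary: f)
  case 0
  then show ?case
    by (auto intro!: continuous_on_compose2[of U f "I \<times> U" snd] continuous_intros)
next
  case (Suc k)
  have d: "((\<lambda>z. f (snd z)) has_derivative (\<lambda>b. frechet_derivative f (at (snd z)) (snd b))) (at z)"
    if "z \<in> I \<times> U" for z :: "'d \<times> 'e"
  proof -
    have "(f has_derivative frechet_derivative f (at (snd z))) (at (snd z))"
      using Ck_on_SucD[OF assms(2) Suc.prems] that by auto
    from has_derivative_compose[OF has_derivative_snd[OF has_derivative_ident] this]
    show ?thesis by simp
  qed
  \<comment> \<open>A basis vector of the product lies in one factor: along the parameter the
    derivative is zero, along the other factor it is a partial derivative of f.\<close>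
  have "Ck_on k (I \<times> U) (\<lambda>z. frechet_derivative f (at (snd z)) (snd b))"
    if "b \<in> Basis" for b :: "'d \<times> 'e"
  proof (cases "snd b = 0")
    case True
    have "Ck_on k (I \<times> U) (\<lambda>z. 0)" by (simp add: Ck_on_const open_Times assms)
    moreover have "frechet_derivative f (at (snd z)) 0 = 0" if "z \<in> I \<times> U" for z :: "'d \<times> 'e"
      using has_derivative_linear[OF Ck_on_SucD[OF assms(2) Suc.prems]] that linear_0
      by (metis mem_Times_iff)
    ultimately show ?thesis
      using True by (subst Ck_on_cong[where g="\<lambda>z. 0"]) (auto simp: open_Times assms)
  next
    case False
    then have "snd b \<in> Basis" using that by (auto simp: Basis_prod_def)
    then show ?thesis using Suc.IH[OF Ck_on_deriv[OF Suc.prems]] by blast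
  qed
  then show ?case
    by (rule Ck_on_SucI[OF open_Times[OF assms(1,2)] d, rotated])
qed

lemma smooth_on_real: "smooth_on U f \<longleftrightarrow> (\<forall>k. Ck_on k U f)" for f :: "'e::euclidean_space \<Rightarrow> real"
  by (simp add: smooth_on_def)

section \<open>Contractions with a metric\<close>

lemma multilinear_length: "multilinear k \<alpha> \<Longrightarrow> length vs \<noteq> k \<Longrightarrow> \<alpha> vs = 0"
  by (simp add: multilinear_def)

lemma multilinear_linear:
  "multilinear k \<alpha> \<Longrightarrow> length vs = k \<Longrightarrow> i < k \<Longrightarrow> linear (\<lambda>v. \<alpha> (vs[i := v]))"
  by (simp add: multilinear_def)

lemma multilinear_Cons:
  assumes "multilinear (Suc k) \<alpha>"
  shows "multilinear k (\<lambda>ws. \<alpha> (v # ws))"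
  unfolding multilinear_def
proof (intro conjI allI impI)
  fix vs :: "(real ^ 'a) list" and i assume *: "length vs = k" "i < k"
  show "linear (\<lambda>w. \<alpha> (v # vs[i := w]))"
    using multilinear_linear[OF assms, of "v # vs" "Suc i"] * by simp
qed (use assms in \<open>auto simp: multilinear_def\<close>)

lemma multilinear_linear_hd:
  assumes "multilinear (Suc k) \<alpha>"
  shows "linear (\<lambda>v. \<alpha> (v # ws))"
proof (cases "length ws = k")
  case True
  then show ?thesis using multilinear_linear[OF assms, of "0 # ws" 0] by simp
next
  case False
  then show ?thesis using multilinear_length[OF assms] by (simp add: linear_zero)
qed

lemma multilinear_scale: "multilinear k \<alpha> \<Longrightarrow> multilinear k (\<lambda>vs. c * \<alpha> vs)"
  unfolding multilinear_def linear_iff by (simp add: algebra_simps)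

lemma multilinear_add: "multilinear k \<alpha> \<Longrightarrow> multilinear k \<beta> \<Longrightarrow> multilinear k (\<lambda>vs. \<alpha> vs + \<beta> vs)"
  unfolding multilinear_def linear_iff by (simp add: algebra_simps)

lemma multilinear_pull:
  assumes "multilinear k \<alpha>" "linear L"
  shows "multilinear k (\<lambda>vs. \<alpha> (map L vs))"
  unfolding multilinear_def
proof (intro conjI allI impI)
  fix vs :: "(real ^ 'b) list" and i assume *: "length vs = k" "i < k"
  have "linear (\<lambda>v. \<alpha> ((map L vs)[i := v]))"
    using multilinear_linear[OF assms(1)] * by simp
  from linear_compose[OF assms(2) this]
  show "linear (\<lambda>v. \<alpha> (map L (vs[i := v])))"
    by (simp add: map_update o_def)
qed (use assms in \<open>auto simp: multilinear_def\<close>)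

lemma basis_expand: "(v :: real ^ 'n::finite) = (\<Sum>i\<in>UNIV. v $ i *\<^sub>R e_vec i)"
  using basis_expansion[of v] by (simp add: e_vec_def scalar_mult_eq_scaleR)

lemma linear_basis:
  assumes "linear f"
  shows "f (v :: real ^ 'n::finite) = (\<Sum>i\<in>UNIV. v $ i * (f (e_vec i) :: real))"
  by (subst basis_expand) (simp add: linear_sum[OF assms] linear_scale[OF assms])

text \<open>Contractions see a tensor only on lists of basis vectors, and this recovers it on all
  lists. Currying the head lowers the degree, and linearity in the head does the rest.\<close>

lemma multilinear_zeroI:
  assumes "multilinear k \<alpha>" "\<And>is. length is = k \<Longrightarrow> \<alpha> (map e_vec is) = 0"
  shows "\<alpha> vs = 0"
  using assms
proof (induction k arbitrary: \<alpha> vs)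
  case 0
  then show ?case using multilinear_length[OF 0(1)] by (cases "vs = []") auto
next
  case (Suc k)
  show ?case
  proof (cases vs)
    case Nil
    then show ?thesis using multilinear_length[OF Suc.prems(1)] by simp
  next
    case (Cons v ws)
    have "\<alpha> (e_vec i # ws) = 0" for i
      by (rule Suc.IH[OF multilinear_Cons[OF Suc.prems(1)]])
         (use Suc.prems(2)[of "i # _"] in auto)
    then show ?thesis unfolding Cons
      using linear_basis[OF multilinear_linear_hd[OF Suc.prems(1)], of v ws] by simp
  qed
qed

lemma lists_Suc: "{is :: 'n list. length is = Suc k} = (\<lambda>(i, is). i # is) ` (UNIV \<times> {is. length is = k})"
  by (force simp: length_Suc_conv)

lemma sum_lists_Suc:
  "(\<Sum>is\<in>{is :: 'n::finite list. length is = Suc k}. f is) =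
    (\<Sum>i\<in>UNIV. \<Sum>is\<in>{is. length is = k}. f (i # is))"
  unfolding lists_Suc
  by (subst sum.reindex) (auto simp: inj_on_def sum.cartesian_product case_prod_beta)

lemma contract_0: "contract g 0 \<alpha> \<beta> = \<alpha> [] * \<beta> []"
  by (simp add: contract_def)

text \<open>This recursion, which splits off the first index of both tensors, carries the later
  inductions on the number of contracted indices.\<close>

lemma contract_Suc:
  "contract g (Suc k) \<alpha> \<beta> = (\<Sum>i\<in>UNIV. \<Sum>j\<in>UNIV. matrix_inv (gram g) $ i $ j *
     contract g k (\<lambda>ws. \<alpha> (e_vec i # ws)) (\<lambda>ws. \<beta> (e_vec j # ws)))"
proof -
  have "contract g (Suc k) \<alpha> \<beta> = (\<Sum>i\<in>UNIV. \<Sum>is\<in>{is. length is = k}. \<Sum>j\<in>UNIV. \<Sum>js\<in>{is. length is = k}.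
      matrix_inv (gram g) $ i $ j * (\<alpha> (e_vec i # map e_vec is) * \<beta> (e_vec j # map e_vec js) *
        (\<Prod>r<k. matrix_inv (gram g) $ (is ! r) $ (js ! r))))"
    \<comment> \<open>The product over the indices has to be split at r = 0, to match the heads of
      the lists, and not at its last factor.\<close>
    unfolding contract_def sum_lists_Suc by (simp add: prod.lessThan_Suc_shift mult_ac del: prod.lessThan_Suc)
  also have "\<dots> = (\<Sum>i\<in>UNIV. \<Sum>j\<in>UNIV. \<Sum>is\<in>{is. length is = k}. \<Sum>js\<in>{is. length is = k}.
      matrix_inv (gram g) $ i $ j * (\<alpha> (e_vec i # map e_vec is) * \<beta> (e_vec j # map e_vec js) *
        (\<Prod>r<k. matrix_inv (gram g) $ (is ! r) $ (js ! r))))"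
    by (rule sum.cong[OF refl], rule sum.swap)
  finally show ?thesis by (simp add: contract_def sum_distrib_left)
qed

lemma contract_add_left: "contract g k (\<lambda>vs. \<alpha> vs + \<alpha>' vs) \<beta> = contract g k \<alpha> \<beta> + contract g k \<alpha>' \<beta>"
  by (simp add: contract_def algebra_simps sum.distrib)

lemma contract_scale_left: "contract g k (\<lambda>vs. c * \<alpha> vs) \<beta> = c * contract g k \<alpha> \<beta>"
  by (simp add: contract_def algebra_simps sum_distrib_left)

lemma contract_scale_right: "contract g k \<alpha> (\<lambda>vs. c * \<beta> vs) = c * contract g k \<alpha> \<beta>"
  by (simp add: contract_def algebra_simps sum_distrib_left)

lemma contract_add_right: "contract g k \<alpha> (\<lambda>vs. \<beta> vs + \<beta>' vs) = contract g k \<alpha> \<beta> + contract g k \<alpha> \<beta>'"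
  by (simp add: contract_def algebra_simps sum.distrib)

lemma contract_sum_left:
  "finite I \<Longrightarrow> contract g k (\<lambda>vs. \<Sum>i\<in>I. c i * \<alpha> i vs) \<beta> = (\<Sum>i\<in>I. c i * contract g k (\<alpha> i) \<beta>)"
  by (induction I rule: finite_induct)
    (simp_all add: contract_add_left contract_scale_left, simp add: contract_def)

lemma contract_sum_right:
  "finite I \<Longrightarrow> contract g k \<alpha> (\<lambda>vs. \<Sum>i\<in>I. c i * \<beta> i vs) = (\<Sum>i\<in>I. c i * contract g k \<alpha> (\<beta> i))"
  by (induction I rule: finite_induct)
    (simp_all add: contract_add_right contract_scale_right, simp add: contract_def)

text \<open>Bilinearity in the two heads; it will express a contraction in a new frame through the
  contractions in the standard one.\<close>

lemma contract_basis:
  assumes "multilinear (Suc k) \<alpha>" "multilinear (Suc k) \<beta>"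
  shows "contract g k (\<lambda>ws. \<alpha> (v # ws)) (\<lambda>ws. \<beta> (w # ws)) =
    (\<Sum>i\<in>UNIV. \<Sum>j\<in>UNIV. v $ i * w $ j * contract g k (\<lambda>ws. \<alpha> (e_vec i # ws)) (\<lambda>ws. \<beta> (e_vec j # ws)))"
proof -
  have "(\<lambda>ws. \<alpha> (v # ws)) = (\<lambda>ws. \<Sum>i\<in>UNIV. v $ i * \<alpha> (e_vec i # ws))"
    using linear_basis[OF multilinear_linear_hd[OF assms(1)]] by blast
  moreover have "(\<lambda>ws. \<beta> (w # ws)) = (\<lambda>ws. \<Sum>i\<in>UNIV. w $ i * \<beta> (e_vec i # ws))"
    using linear_basis[OF multilinear_linear_hd[OF assms(2)]] by blast
  ultimately show ?thesis
    by (simp add: contract_sum_left contract_sum_right sum_distrib_left mult_ac)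
qed

section \<open>Inner products on one tangent space and their Gram matrices\<close>

definition inner_tensor :: "'n::finite tensor \<Rightarrow> bool" where
  "inner_tensor g \<longleftrightarrow> multilinear 2 g \<and> (\<forall>u v. g [u, v] = g [v, u]) \<and> (\<forall>v. v \<noteq> 0 \<longrightarrow> g [v, v] > 0)"

lemma bilinear_2:
  assumes "multilinear 2 g"
  shows "linear (\<lambda>u. g [u, v])" "linear (\<lambda>v. g [u, v])"
  using multilinear_linear[OF assms, of "[0, v]" 0] multilinear_linear[OF assms, of "[u, 0]" 1] by simp_all

lemma gram_eq:
  assumes "multilinear 2 g"
  shows "g [u, v] = u \<bullet> (gram g *v v)"
proof -
  have "g [u, v] = (\<Sum>i\<in>UNIV. u $ i * (\<Sum>j\<in>UNIV. v $ j * g [e_vec i, e_vec j]))"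
    by (subst linear_basis[OF bilinear_2(1)[OF assms]]; subst linear_basis[OF bilinear_2(2)[OF assms]]) simp
  also have "\<dots> = u \<bullet> (gram g *v v)"
    by (simp add: inner_vec_def matrix_vector_mult_def gram_def mult_ac)
  finally show ?thesis .
qed

lemma gram_invertible:
  assumes "inner_tensor g"
  shows "invertible (gram g)"
proof -
  have "v = 0" if "gram g *v v = 0" for v
    using assms gram_eq[of g v v] that by (force simp: inner_tensor_def)
  then show ?thesis
    by (metis invertible_left_inverse matrix_left_invertible_ker)
qed

lemma gram_symmetric:
  assumes "inner_tensor g"
  shows "gram g $ i $ j = gram g $ j $ i" "transpose (gram g) = gram g"
  using assms by (simp_all add: gram_def inner_tensor_def transpose_def)

lemma matrix_inv_mult:
  assumes "invertible A"
  shows "A ** matrix_inv A = mat 1" "matrix_inv A ** A = mat 1"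
  unfolding matrix_inv_def using someI_ex[OF assms[unfolded invertible_def]] by simp_all

lemma gram_inverse:
  assumes "inner_tensor g"
  shows "gram g ** matrix_inv (gram g) = mat 1" "matrix_inv (gram g) ** gram g = mat 1"
  using matrix_inv_mult[OF gram_invertible[OF assms]] by simp_all

text \<open>The transpose of the inverse is a left inverse of the symmetric Gram matrix, and
  inverses are unique.\<close>

lemma gram_inverse_symmetric:
  assumes "inner_tensor g"
  shows "transpose (matrix_inv (gram g)) = matrix_inv (gram g)"
    "matrix_inv (gram g) $ i $ j = matrix_inv (gram g) $ j $ i"
proof -
  have "transpose (matrix_inv (gram g)) ** gram g = mat 1"
    by (metis gram_inverse(1)[OF assms] gram_symmetric(2)[OF assms] matrix_transpose_mul transpose_mat)
  then show "transpose (matrix_inv (gram g)) = matrix_inv (gram g)"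
    using gram_inverse(1)[OF assms] by (metis matrix_mul_assoc matrix_mul_lid matrix_mul_rid)
  then have "transpose (matrix_inv (gram g)) $ j $ i = matrix_inv (gram g) $ j $ i" by simp
  then show "matrix_inv (gram g) $ i $ j = matrix_inv (gram g) $ j $ i"
    by (simp add: transpose_def)
qed

section \<open>Change of frame\<close>

abbreviation pull :: "(real ^ 'n \<Rightarrow> real ^ 'm) \<Rightarrow> 'm::finite tensor \<Rightarrow> 'n::finite tensor" where
  "pull L \<alpha> \<equiv> (\<lambda>vs. \<alpha> (map L vs))"

lemma gram_pull:
  assumes "multilinear 2 g" "linear L"
  shows "gram (pull L g) = transpose (matrix L) ** gram g ** matrix L"
proof -
  have "gram (pull L g) $ i $ j = (transpose (matrix L) ** gram g ** matrix L) $ i $ j" for i j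
  proof -
    have L: "L v = matrix L *v v" for v
      using matrix_vector_mul(2)[OF assms(2)] by metis
    have "gram (pull L g) $ i $ j = g [L (e_vec i), L (e_vec j)]"
      by (simp add: gram_def)
    also have "\<dots> = L (e_vec i) \<bullet> (gram g *v L (e_vec j))"
      by (rule gram_eq[OF assms(1)])
    also have "\<dots> = (matrix L *v e_vec i) \<bullet> (gram g *v (matrix L *v e_vec j))"
      by (simp only: L)
    also have "\<dots> = e_vec i \<bullet> (transpose (matrix L) *v (gram g *v (matrix L *v e_vec j)))"
      by (metis dot_lmul_matrix vector_transpose_matrix)
    also have "\<dots> = e_vec i \<bullet> ((transpose (matrix L) ** gram g ** matrix L) *v e_vec j)"
      by (simp only: matrix_vector_mul_assoc matrix_mul_assoc)
    finally have "gram (pull L g) $ i $ j = \<dots>" .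
    then show ?thesis
      by (simp add: e_vec_def inner_axis' matrix_vector_mult_basis column_def)
  qed
  then show ?thesis by (simp add: vec_eq_iff)
qed

text \<open>The inverse Gram matrix transforms contragrediently: with M the matrix of L and Q' the
  inverse in the new frame, M Q' M^T is the old inverse Q. Each contracted index absorbs one such
  product, by induction on their number.\<close>

lemma contract_pull:
  fixes L :: "real ^ 'n \<Rightarrow> real ^ 'n"
  assumes "inner_tensor g" "linear L" "bij L" "multilinear k \<alpha>" "multilinear k \<beta>"
  shows "contract (pull L g) k (pull L \<alpha>) (pull L \<beta>) = contract g k \<alpha> \<beta>"
  using assms(4,5)
proof (induction k arbitrary: \<alpha> \<beta>)
  case 0
  then show ?case by (simp add: contract_0)
next
  case (Suc k)
  define M where "M = matrix L"
  define Q where "Q = matrix_inv (gram g)"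
  define Q' where "Q' = matrix_inv (gram (pull L g))"
  define C where "C = (\<lambda>a b. contract g k (\<lambda>ws. \<alpha> (e_vec a # ws)) (\<lambda>ws. \<beta> (e_vec b # ws)))"
  have inv: "invertible M"
    unfolding M_def using assms(2,3) by (simp add: invertible_eq_bij)
  have P': "gram (pull L g) = transpose M ** gram g ** M"
    unfolding M_def using gram_pull assms(1,2) by (auto simp: inner_tensor_def)
  then have "invertible (gram (pull L g))"
    using inv gram_invertible[OF assms(1)] by (simp add: invertible_mult transpose_invertible)
  then have Q': "gram (pull L g) ** Q' = mat 1"
    unfolding Q'_def by (rule matrix_inv_mult)
  have tM: "transpose (matrix_inv M) ** transpose M = mat 1"
    by (metis inv matrix_inv_mult(1) matrix_transpose_mul transpose_mat)
  \<comment> \<open>Cancels M^T on the left of M^T G M Q' = 1, where G is the old Gram matrix;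
    multiplying by M^T on the right then exhibits M Q' M^T as the inverse of G.\<close>
  have "gram g ** M ** Q' = transpose (matrix_inv M)"
    using Q' tM unfolding P' by (metis matrix_mul_assoc matrix_mul_lid matrix_mul_rid)
  then have "gram g ** M ** Q' ** transpose M = mat 1" using tM by simp
  then have Q: "M ** Q' ** transpose M = Q"
    unfolding Q_def by (metis gram_inverse(2)[OF assms(1)] matrix_mul_assoc matrix_mul_lid matrix_mul_rid)
  have "contract (pull L g) (Suc k) (pull L \<alpha>) (pull L \<beta>) =
      (\<Sum>i\<in>UNIV. \<Sum>j\<in>UNIV. Q' $ i $ j * contract g k (\<lambda>ws. \<alpha> (L (e_vec i) # ws)) (\<lambda>ws. \<beta> (L (e_vec j) # ws)))"
    unfolding contract_Suc Q'_def
    using Suc.IH[OF multilinear_Cons[OF Suc.prems(1)] multilinear_Cons[OF Suc.prems(2)]] by simp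
  also have "\<dots> = (\<Sum>i\<in>UNIV. \<Sum>j\<in>UNIV. Q' $ i $ j * (\<Sum>a\<in>UNIV. \<Sum>b\<in>UNIV. M $ a $ i * M $ b $ j * C a b))"
    by (subst contract_basis[OF Suc.prems]) (simp add: C_def M_def matrix_def e_vec_def)
  also have "\<dots> = (\<Sum>i\<in>UNIV. \<Sum>j\<in>UNIV. \<Sum>a\<in>UNIV. \<Sum>b\<in>UNIV. M $ a $ i * Q' $ i $ j * M $ b $ j * C a b)"
    by (simp add: sum_distrib_left mult_ac)
  also have "\<dots> = (\<Sum>a\<in>UNIV. \<Sum>b\<in>UNIV. \<Sum>j\<in>UNIV. \<Sum>i\<in>UNIV. M $ a $ i * Q' $ i $ j * M $ b $ j * C a b)"
  proof -
    have "(\<Sum>i\<in>UNIV. \<Sum>j\<in>UNIV. \<Sum>a\<in>UNIV. \<Sum>b\<in>UNIV. f i j a b) = (\<Sum>a\<in>UNIV. \<Sum>b\<in>UNIV. \<Sum>j\<in>UNIV. \<Sum>i\<in>UNIV. f i j a b)" for f :: "'n \<Rightarrow> 'n \<Rightarrow> 'n \<Rightarrow> 'n \<Rightarrow> real"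
    proof -
      have "(\<Sum>i\<in>UNIV. \<Sum>j\<in>UNIV. \<Sum>a\<in>UNIV. \<Sum>b\<in>UNIV. f i j a b) = (\<Sum>i\<in>UNIV. \<Sum>a\<in>UNIV. \<Sum>j\<in>UNIV. \<Sum>b\<in>UNIV. f i j a b)"
        by (rule sum.cong[OF refl], rule sum.swap)
      also have "\<dots> = (\<Sum>a\<in>UNIV. \<Sum>i\<in>UNIV. \<Sum>j\<in>UNIV. \<Sum>b\<in>UNIV. f i j a b)"
        by (rule sum.swap)
      also have "\<dots> = (\<Sum>a\<in>UNIV. \<Sum>i\<in>UNIV. \<Sum>b\<in>UNIV. \<Sum>j\<in>UNIV. f i j a b)"
        by (rule sum.cong[OF refl], rule sum.cong[OF refl], rule sum.swap)
      also have "\<dots> = (\<Sum>a\<in>UNIV. \<Sum>b\<in>UNIV. \<Sum>i\<in>UNIV. \<Sum>j\<in>UNIV. f i j a b)"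
        by (rule sum.cong[OF refl], rule sum.swap)
      also have "\<dots> = (\<Sum>a\<in>UNIV. \<Sum>b\<in>UNIV. \<Sum>j\<in>UNIV. \<Sum>i\<in>UNIV. f i j a b)"
        by (rule sum.cong[OF refl], rule sum.cong[OF refl], rule sum.swap)
      finally show ?thesis .
    qed
    then show ?thesis .
  qed
  also have "\<dots> = (\<Sum>a\<in>UNIV. \<Sum>b\<in>UNIV. (M ** Q' ** transpose M) $ a $ b * C a b)"
    by (simp add: matrix_matrix_mult_def transpose_def sum_distrib_right)
  also have "\<dots> = contract g (Suc k) \<alpha> \<beta>"
    unfolding Q by (simp add: contract_Suc Q_def C_def)
  finally show ?case .
qed


section \<open>Orthonormal frames and definiteness of contractions\<close>

lemma inner_tensor_pull:
  fixes L :: "real ^ 'n \<Rightarrow> real ^ 'n"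
  assumes "inner_tensor g" "linear L" "bij L"
  shows "inner_tensor (pull L g)"
  using assms multilinear_pull[of 2 g L] linear_injective_0[OF assms(2)]
  by (auto simp: inner_tensor_def bij_is_inj)

text \<open>Gram-Schmidt, one vector at a time: while k is below the dimension, a dimension count
  leaves a vector outside the span of those already found.\<close>

lemma ex_orthonormal:
  fixes g :: "'n::finite tensor"
  assumes "inner_tensor g" "k \<le> CARD('n)"
  shows "\<exists>B. finite B \<and> card B = k \<and> (\<forall>u\<in>B. \<forall>v\<in>B. g [u, v] = (if u = v then 1 else 0))"
  using assms(2)
proof (induction k)
  case 0
  then show ?case by (intro exI[of _ "{}"]) auto
next
  case (Suc k)
  then obtain B where B: "finite B" "card B = k"
    "\<And>u v. u \<in> B \<Longrightarrow> v \<in> B \<Longrightarrow> g [u, v] = (if u = v then 1 else 0)" by auto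
  have ml: "multilinear 2 g" using assms(1) by (simp add: inner_tensor_def)
  note l1 = bilinear_2(1)[OF ml] and l2 = bilinear_2(2)[OF ml]
  have "dim (span B) \<le> k" using B dim_le_card[of "span B" B] by simp
  moreover have "dim (UNIV :: (real ^ 'n) set) = CARD('n)" by simp
  ultimately have "span B \<noteq> UNIV" using Suc.prems by force
  then obtain x where x: "x \<notin> span B" by auto
  \<comment> \<open>x minus its g-orthogonal projection to the span of B; normalizing it gives the
    next vector.\<close>
  define y where "y = x - (\<Sum>b\<in>B. g [x, b] *\<^sub>R b)"
  have y0: "y \<noteq> 0"
    using x span_sum[of B "\<lambda>b. g [x, b] *\<^sub>R b" B] by (auto simp: y_def span_scale span_base)
  then have gy: "g [y, y] > 0" using assms(1) by (simp add: inner_tensor_def)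
  have yB: "g [y, b] = 0" if "b \<in> B" for b
  proof -
    have "g [y, b] = g [x, b] - (\<Sum>c\<in>B. g [x, c] * g [c, b])"
      by (simp add: y_def linear_diff[OF l1] linear_sum[OF l1] linear_scale[OF l1])
    also have "(\<Sum>c\<in>B. g [x, c] * g [c, b]) = (\<Sum>c\<in>B. if c = b then g [x, c] else 0)"
      using B(3) that by (intro sum.cong) auto
    finally show ?thesis using that B(1) by simp
  qed
  define z where "z = (1 / sqrt (g [y, y])) *\<^sub>R y"
  have zB: "g [z, b] = 0" "g [b, z] = 0" if "b \<in> B" for b
    using yB[OF that] assms(1) by (simp_all add: z_def linear_scale[OF l1] linear_scale[OF l2] inner_tensor_def)
  have zz: "g [z, z] = 1"
    using gy by (simp add: z_def linear_scale[OF l1] linear_scale[OF l2])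
  then have "z \<notin> B" using zB by force
  then show ?case
    using B zB zz by (intro exI[of _ "insert z B"]) auto
qed

lemma ex_orthonormal_frame:
  fixes g :: "'n::finite tensor"
  assumes "inner_tensor g"
  shows "\<exists>L :: real ^ 'n \<Rightarrow> real ^ 'n. linear L \<and> bij L \<and> gram (pull L g) = mat 1"
proof -
  have ml: "multilinear 2 g" using assms by (simp add: inner_tensor_def)
  obtain B where B: "finite B" "card B = CARD('n)"
    "\<And>u v. u \<in> B \<Longrightarrow> v \<in> B \<Longrightarrow> g [u, v] = (if u = v then 1 else 0)"
    using ex_orthonormal[OF assms order_refl] by blast
  obtain b where b: "bij_betw b (UNIV :: 'n set) B"
    using B(1,2) finite_same_card_bij[of "UNIV :: 'n set" B] by auto
  define L where "L = (\<lambda>v :: real ^ 'n. \<Sum>i\<in>UNIV. v $ i *\<^sub>R b i)"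
  have lin: "linear L"
    by (rule linearI) (simp_all add: L_def sum.distrib scaleR_add_left scaleR_sum_right)
  have Le: "L (e_vec i) = b i" for i
    by (simp add: L_def e_vec_def axis_def if_distrib[where f = "\<lambda>c. c *\<^sub>R _"] cong: if_cong)
  have gr: "gram (pull L g) = mat 1"
  proof -
    have "g [b i, b j] = (if i = j then 1 else 0)" for i j
      using B(3)[of "b i" "b j"] b by (auto simp: bij_betw_def inj_eq)
    then show ?thesis by (simp add: vec_eq_iff gram_def mat_def Le)
  qed
  \<comment> \<open>In the frame L the inner product is the Euclidean one, so a vector in the kernel
    of L has Euclidean norm zero.\<close>
  have "v = 0" if "L v = 0" for v
  proof -
    have "0 = v \<bullet> (gram (pull L g) *v v)"
      using gram_eq[OF multilinear_pull[OF ml lin], of v v] that linear_0[OF bilinear_2(1)[OF ml]] by simp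
    then show ?thesis by (simp add: gr)
  qed
  then have "inj L" using linear_injective_0[OF lin] by blast
  then have "bij L" using linear_injective_imp_surjective[OF lin] by (simp add: bij_def)
  with lin gr show ?thesis by blast
qed

lemma matrix_inv_mat_1: "matrix_inv (mat 1 :: real ^ 'n ^ 'n) = mat 1"
proof -
  have "invertible (mat 1 :: real ^ 'n ^ 'n)" by (auto simp: invertible_def intro: exI[of _ "mat 1"])
  from matrix_inv_mult(1)[OF this] show ?thesis by simp
qed

lemma contract_orthonormal:
  assumes "gram g = mat 1"
  shows "contract g k \<alpha> \<alpha> = (\<Sum>is\<in>{is. length is = k}. (\<alpha> (map e_vec is))\<^sup>2)"
proof (induction k arbitrary: \<alpha>)
  case 0
  then show ?case by (simp add: contract_0 power2_eq_square)
next
  case (Suc k)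
  have "contract g (Suc k) \<alpha> \<alpha> = (\<Sum>i\<in>UNIV. \<Sum>j\<in>UNIV. if i = j then contract g k (\<lambda>ws. \<alpha> (e_vec i # ws)) (\<lambda>ws. \<alpha> (e_vec j # ws)) else 0)"
    unfolding contract_Suc assms matrix_inv_mat_1 by (intro sum.cong) (auto simp: mat_def)
  also have "\<dots> = (\<Sum>i\<in>UNIV. contract g k (\<lambda>ws. \<alpha> (e_vec i # ws)) (\<lambda>ws. \<alpha> (e_vec i # ws)))"
    by simp
  also have "\<dots> = (\<Sum>is\<in>{is. length is = Suc k}. (\<alpha> (map e_vec is))\<^sup>2)"
    by (simp add: Suc.IH sum_lists_Suc)
  finally show ?case .
qed

text \<open>By frame independence the contraction may be computed in an orthonormal frame, where it
  is the sum of the squares of all components.\<close>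

lemma
  fixes \<alpha> :: "'n::finite tensor"
  assumes g: "inner_tensor g" and \<alpha>: "multilinear k \<alpha>"
  shows contract_nonneg: "contract g k \<alpha> \<alpha> \<ge> 0"
    and contract_eq_0: "contract g k \<alpha> \<alpha> = 0 \<Longrightarrow> \<alpha> = (\<lambda>_. 0)"
proof -
  obtain L :: "real ^ 'n \<Rightarrow> real ^ 'n" where L: "linear L" "bij L" "gram (pull L g) = mat 1"
    using ex_orthonormal_frame[OF g] by blast
  have eq: "contract g k \<alpha> \<alpha> = (\<Sum>is\<in>{is. length is = k}. (\<alpha> (map L (map e_vec is)))\<^sup>2)"
    by (rule trans[OF contract_pull[OF g L(1,2) \<alpha> \<alpha>, symmetric] contract_orthonormal[OF L(3)]])
  show "contract g k \<alpha> \<alpha> \<ge> 0" unfolding eq by (simp add: sum_nonneg)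
  show "\<alpha> = (\<lambda>_. 0)" if "contract g k \<alpha> \<alpha> = 0"
  proof
    fix vs
    have fin: "finite {is :: 'n list. length is = k}"
      using finite_lists_length_eq[of "UNIV :: 'n set" k] by simp
    have z: "\<alpha> (map L (map e_vec is)) = 0" if "length is = k" for "is"
      using \<open>contract g k \<alpha> \<alpha> = 0\<close> that sum_nonneg_eq_0_iff[OF fin, of "\<lambda>is. (\<alpha> (map L (map e_vec is)))\<^sup>2"]
      unfolding eq by simp
    have "\<alpha> (map L ws) = 0" for ws
      by (rule multilinear_zeroI[OF multilinear_pull[OF \<alpha> L(1)]]) (rule z)
    \<comment> \<open>L is surjective, so every list of vectors is the image of a list under
      L.\<close>
    from this[of "map (inv L) vs"] show "\<alpha> vs = 0"
      by (simp add: surj_iff[THEN iffD1, OF bij_is_surj[OF L(2)]])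
  qed
qed

section \<open>Derivatives along curves of metrics\<close>

lemma Ck_on_det:
  assumes "open U" "\<And>i j. Ck_on k U (\<lambda>x. M x $ i $ j)"
  shows "Ck_on k U (\<lambda>x. det (M x :: real ^ 'n ^ 'n))"
  unfolding det_def
  by (rule Ck_on_sum[OF assms(1)], rule Ck_on_mult[OF assms(1)], rule Ck_on_const[OF assms(1)],
      rule Ck_on_prod[OF assms(1)], rule assms(2))

text \<open>Column j of the inverse solves M x = e_j. The quotient of determinants makes smoothness
  and differentiability of the inverse metric a matter of polynomials in the entries.\<close>

lemma matrix_inv_cramer:
  assumes "det (M :: real ^ 'n ^ 'n) \<noteq> 0"
  shows "matrix_inv M $ i $ j = det (\<chi> a b. if b = i then axis j 1 $ a else M $ a $ b) / det M"
proof -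
  have "M ** matrix_inv M = mat 1"
    using assms by (intro matrix_inv_mult) (simp add: invertible_det_nz)
  then have "M *v column j (matrix_inv M) = axis j 1"
    by (metis matrix_vector_mul_assoc matrix_vector_mul_lid matrix_vector_mult_basis)
  then have "column j (matrix_inv M) $ i = det (\<chi> a b. if b = i then axis j 1 $ a else M $ a $ b) / det M"
    unfolding cramer[OF assms] by simp
  then show ?thesis by (simp add: column_def)
qed

lemma Ck_on_matrix_inv:
  assumes "open U" "\<And>i j. Ck_on k U (\<lambda>x. M x $ i $ j)" "\<And>x. x \<in> U \<Longrightarrow> det (M x) \<noteq> 0"
  shows "Ck_on k U (\<lambda>x. matrix_inv (M x :: real ^ 'n ^ 'n) $ i $ j)"
proof -
  have "Ck_on k U (\<lambda>x. det (\<chi> a b. if b = i then axis j 1 $ a else M x $ a $ b) / det (M x))"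
  proof (intro Ck_on_divide Ck_on_det assms)
    show "Ck_on k U (\<lambda>x. (\<chi> a b. if b = i then axis j 1 $ a else M x $ a $ b) $ a $ b)" for a b
      using assms by (cases "b = i") (simp_all add: Ck_on_const)
  qed
  then show ?thesis
    by (rule Ck_on_cong[OF assms(1), THEN iffD1, rotated]) (simp add: matrix_inv_cramer[OF assms(3)])
qed

lemma Ck_on_contract:
  fixes g :: "'e::euclidean_space \<Rightarrow> 'n::finite tensor"
  assumes "open U" "\<And>i j. Ck_on k U (\<lambda>x. gram (g x) $ i $ j)" "\<And>x. x \<in> U \<Longrightarrow> det (gram (g x)) \<noteq> 0"
    and "\<And>vs. Ck_on k U (\<lambda>x. \<alpha> x vs)" "\<And>vs. Ck_on k U (\<lambda>x. \<beta> x vs)"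
  shows "Ck_on k U (\<lambda>x. contract (g x) m (\<alpha> x) (\<beta> x))"
  unfolding contract_def by (intro Ck_on_sum Ck_on_mult Ck_on_prod Ck_on_matrix_inv assms)

text \<open>The product rule in the Leibniz expansion: every term differentiates one row at a time,
  and regrouping by that row gives determinants again.\<close>

lemma has_derivative_det_rows:
  fixes M :: "real \<Rightarrow> real ^ 'n ^ 'n"
  assumes "\<And>i j. ((\<lambda>s. M s $ i $ j) has_real_derivative M' $ i $ j) (at t)"
  shows "((\<lambda>s. det (M s)) has_real_derivative
    (\<Sum>k\<in>UNIV. det (\<chi> i. if i = k then M' $ i else M t $ i))) (at t)"
proof -
  have "((\<lambda>s. \<Prod>i\<in>UNIV. M s $ i $ p i) has_real_derivative
      (\<Sum>k\<in>UNIV. M' $ k $ p k * (\<Prod>i\<in>UNIV - {k}. M t $ i $ p i))) (at t)" for p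
    using assms by (intro has_field_derivative_prod) auto
  then have "((\<lambda>s. det (M s)) has_real_derivative
      (\<Sum>p\<in>{p. p permutes UNIV}. of_int (sign p) *
        (\<Sum>k\<in>UNIV. M' $ k $ p k * (\<Prod>i\<in>UNIV - {k}. M t $ i $ p i)))) (at t)"
    unfolding det_def by (intro DERIV_sum DERIV_cmult)
  also have "(\<Sum>p\<in>{p. p permutes UNIV}. of_int (sign p) *
        (\<Sum>k\<in>UNIV. M' $ k $ p k * (\<Prod>i\<in>UNIV - {k}. M t $ i $ p i))) =
      (\<Sum>k\<in>UNIV. \<Sum>p\<in>{p. p permutes UNIV}. of_int (sign p) *
        (M' $ k $ p k * (\<Prod>i\<in>UNIV - {k}. M t $ i $ p i)))"
    unfolding sum_distrib_left by (rule sum.swap)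
  also have "\<dots> = (\<Sum>k\<in>UNIV. det (\<chi> i. if i = k then M' $ i else M t $ i))"
  proof (rule sum.cong[OF refl])
    fix k :: 'n
    have "(\<Prod>i\<in>UNIV. (\<chi> i. if i = k then M' $ i else M t $ i) $ i $ p i) =
        M' $ k $ p k * (\<Prod>i\<in>UNIV - {k}. M t $ i $ p i)" for p
      by (subst prod.remove[of _ k]) auto
    then show "(\<Sum>p\<in>{p. p permutes UNIV}. of_int (sign p) *
        (M' $ k $ p k * (\<Prod>i\<in>UNIV - {k}. M t $ i $ p i))) = det (\<chi> i. if i = k then M' $ i else M t $ i)"
      unfolding det_def by simp
  qed
  finally show ?thesis .
qed

text \<open>Jacobi's formula. Writing M' = C M with C = M' M^(-1) makes row k of M' a combination of
  the rows of M; in the determinant with row k replaced only the coefficient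
  \<open>C $ k $ k\<close> survives, and these coefficients sum to the trace.\<close>

lemma has_derivative_det:
  fixes M :: "real \<Rightarrow> real ^ 'n ^ 'n"
  assumes "\<And>i j. ((\<lambda>s. M s $ i $ j) has_real_derivative M' $ i $ j) (at t)" "invertible (M t)"
  shows "((\<lambda>s. det (M s)) has_real_derivative
    det (M t) * (\<Sum>i\<in>UNIV. \<Sum>j\<in>UNIV. matrix_inv (M t) $ i $ j * M' $ j $ i)) (at t)"
proof -
  define C where "C = M' ** matrix_inv (M t)"
  have M': "M' = C ** M t"
    unfolding C_def using matrix_inv_mult(2)[OF assms(2)] by (metis matrix_mul_assoc matrix_mul_rid)
  have "M' $ k = (\<Sum>i\<in>UNIV. (C $ k) $ i *s row i (M t))" for k
    by (simp add: M' vec_eq_iff matrix_matrix_mult_def row_def)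
  then have "det (\<chi> i. if i = k then M' $ i else M t $ i) = C $ k $ k * det (M t)" for k
    using cramer_lemma_transpose[of k "C $ k" "M t"]
    by (simp add: row_def vec_lambda_eta cong: if_cong)
  moreover have "(\<Sum>k\<in>UNIV. C $ k $ k) = (\<Sum>k\<in>UNIV. \<Sum>j\<in>UNIV. matrix_inv (M t) $ j $ k * M' $ k $ j)"
    by (simp add: C_def matrix_matrix_mult_def mult.commute)
  moreover have "\<dots> = (\<Sum>i\<in>UNIV. \<Sum>j\<in>UNIV. matrix_inv (M t) $ i $ j * M' $ j $ i)"
    by (rule sum.swap)
  ultimately show ?thesis
    using has_derivative_det_rows[OF assms(1)] by (simp add: mult.commute flip: sum_distrib_left)
qed

text \<open>Cramer's rule first shows that some derivative exists. Its value then follows by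
  differentiating M M^(-1) = 1, an identity that is available only near t, where the determinant
  stays nonzero.\<close>

lemma has_derivative_matrix_inv:
  fixes M :: "real \<Rightarrow> real ^ 'n ^ 'n"
  assumes M': "\<And>i j. ((\<lambda>s. M s $ i $ j) has_real_derivative M' $ i $ j) (at t)" and inv: "invertible (M t)"
  shows "((\<lambda>s. matrix_inv (M s) $ i $ j) has_real_derivative
    - (matrix_inv (M t) ** M' ** matrix_inv (M t)) $ i $ j) (at t)"
proof -
  have "isCont (\<lambda>s. det (M s)) t"
    using has_derivative_det_rows[OF M'] DERIV_isCont by blast
  moreover have d0: "det (M t) \<noteq> 0" using inv by (simp add: invertible_det_nz)
  ultimately have "eventually (\<lambda>s. det (M s) \<noteq> 0) (at t)"
    unfolding isCont_def by (rule tendsto_imp_eventually_ne)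
  with d0 have ev: "eventually (\<lambda>s. det (M s) \<noteq> 0) (nhds t)"
    by (simp add: eventually_nhds_conv_at)
  have "\<exists>D. ((\<lambda>s. matrix_inv (M s) $ i $ j) has_real_derivative D) (at t)" for i j
  proof -
    \<comment> \<open>The numerator in Cramer's rule; its replaced column is constant, hence the
      zero column in N'.\<close>
    define N where "N = (\<lambda>s. \<chi> a b. if b = i then axis j 1 $ a else M s $ a $ b)"
    define N' where "N' = (\<chi> a b. if b = i then 0 else M' $ a $ b)"
    have "((\<lambda>s. N s $ a $ b) has_real_derivative N' $ a $ b) (at t)" for a b
      by (cases "b = i") (auto simp: N_def N'_def M')
    from DERIV_divide[OF has_derivative_det_rows[OF this] has_derivative_det_rows[OF M'] d0]
    obtain D where "((\<lambda>s. det (N s) / det (M s)) has_real_derivative D) (at t)" by blast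
    then show ?thesis
      by (subst DERIV_cong_ev[OF refl _ refl, where g = "\<lambda>s. det (N s) / det (M s)"])
         (auto intro!: eventually_mono[OF ev] simp: matrix_inv_cramer N_def)
  qed
  then obtain D where D: "\<And>i j. ((\<lambda>s. matrix_inv (M s) $ i $ j) has_real_derivative D i j) (at t)"
    by metis
  define E where "E = (\<chi> i j. D i j)"
  have "(M' ** matrix_inv (M t) + M t ** E) $ i $ j = 0" for i j
  proof -
    have "((\<lambda>s. \<Sum>k\<in>UNIV. M s $ i $ k * matrix_inv (M s) $ k $ j) has_real_derivative
        (\<Sum>k\<in>UNIV. M' $ i $ k * matrix_inv (M t) $ k $ j + D k j * M t $ i $ k)) (at t)"
      by (intro DERIV_sum DERIV_mult M' D)
    then have "((\<lambda>s. mat 1 $ i $ j) has_real_derivative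
        (\<Sum>k\<in>UNIV. M' $ i $ k * matrix_inv (M t) $ k $ j + D k j * M t $ i $ k)) (at t)"
    proof (subst DERIV_cong_ev[OF refl _ refl])
      show "eventually (\<lambda>s. mat 1 $ i $ j = (\<Sum>k\<in>UNIV. M s $ i $ k * matrix_inv (M s) $ k $ j)) (nhds t)"
      proof (rule eventually_mono[OF ev])
        fix s assume "det (M s) \<noteq> 0"
        then have "M s ** matrix_inv (M s) = mat 1"
          by (intro matrix_inv_mult) (simp add: invertible_det_nz)
        then show "mat 1 $ i $ j = (\<Sum>k\<in>UNIV. M s $ i $ k * matrix_inv (M s) $ k $ j)"
          by (simp add: matrix_matrix_mult_def vec_eq_iff)
      qed
    qed
    then have "(\<Sum>k\<in>UNIV. M' $ i $ k * matrix_inv (M t) $ k $ j + D k j * M t $ i $ k) = 0"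
      using DERIV_unique DERIV_const by blast
    then show ?thesis
      by (simp add: matrix_matrix_mult_def E_def sum.distrib mult.commute)
  qed
  then have "M' ** matrix_inv (M t) + M t ** E = 0" by (simp add: vec_eq_iff)
  then have "M t ** E = - (M' ** matrix_inv (M t))" by (simp add: eq_neg_iff_add_eq_0 add.commute)
  then have "matrix_inv (M t) ** (M t ** E) = matrix_inv (M t) ** - (M' ** matrix_inv (M t))" by simp
  then have "E = matrix_inv (M t) ** - (M' ** matrix_inv (M t))"
    by (simp add: matrix_mul_assoc matrix_inv_mult(2)[OF inv])
  also have "\<dots> = - (matrix_inv (M t) ** (M' ** matrix_inv (M t)))"
    by (simp add: matrix_matrix_mult_def vec_eq_iff sum_negf)
  finally have "E = - (matrix_inv (M t) ** M' ** matrix_inv (M t))"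
    by (simp add: matrix_mul_assoc)
  then have "D i j = - (matrix_inv (M t) ** M' ** matrix_inv (M t)) $ i $ j"
    by (simp add: E_def vec_eq_iff)
  then show ?thesis using D[of i j] by simp
qed


text \<open>The part of the derivative of \<open>contract g k \<alpha> \<beta>\<close> that comes from the variation \<open>D\<close> of the
  inverse metric.\<close>

primrec contract_variation ::
    "'n::finite tensor \<Rightarrow> real ^ 'n ^ 'n \<Rightarrow> nat \<Rightarrow> 'n tensor \<Rightarrow> 'n tensor \<Rightarrow> real" where
  "contract_variation g D 0 \<alpha> \<beta> = 0"
| "contract_variation g D (Suc k) \<alpha> \<beta> = (\<Sum>i\<in>UNIV. \<Sum>j\<in>UNIV.
     D $ i $ j * contract g k (\<lambda>ws. \<alpha> (e_vec i # ws)) (\<lambda>ws. \<beta> (e_vec j # ws)) +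
     matrix_inv (gram g) $ i $ j *
       contract_variation g D k (\<lambda>ws. \<alpha> (e_vec i # ws)) (\<lambda>ws. \<beta> (e_vec j # ws)))"

text \<open>The Leibniz rule along the recursion \<open>contract_Suc\<close>, with the variation of
  the inverse metric collected in a separate term.\<close>

lemma has_derivative_contract:
  fixes g :: "real \<Rightarrow> 'n::finite tensor"
  assumes D: "\<And>i j. ((\<lambda>s. matrix_inv (gram (g s)) $ i $ j) has_real_derivative D $ i $ j) (at t)"
    and "\<And>is. length is = k \<Longrightarrow> ((\<lambda>s. \<alpha> s (map e_vec is)) has_real_derivative \<alpha>' (map e_vec is)) (at t)"
    and "\<And>is. length is = k \<Longrightarrow> ((\<lambda>s. \<beta> s (map e_vec is)) has_real_derivative \<beta>' (map e_vec is)) (at t)"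
  shows "((\<lambda>s. contract (g s) k (\<alpha> s) (\<beta> s)) has_real_derivative
    contract (g t) k \<alpha>' (\<beta> t) + contract (g t) k (\<alpha> t) \<beta>' + contract_variation (g t) D k (\<alpha> t) (\<beta> t)) (at t)"
  using assms(2,3)
proof (induction k arbitrary: \<alpha> \<alpha>' \<beta> \<beta>')
  case 0
  from DERIV_mult[OF 0(1)[of "[]"] 0(2)[of "[]"]] show ?case
    by (simp add: contract_0 mult.commute)
next
  case (Suc k)
  have IH: "((\<lambda>s. contract (g s) k (\<lambda>ws. \<alpha> s (e_vec i # ws)) (\<lambda>ws. \<beta> s (e_vec j # ws))) has_real_derivative
      contract (g t) k (\<lambda>ws. \<alpha>' (e_vec i # ws)) (\<lambda>ws. \<beta> t (e_vec j # ws)) +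
      contract (g t) k (\<lambda>ws. \<alpha> t (e_vec i # ws)) (\<lambda>ws. \<beta>' (e_vec j # ws)) +
      contract_variation (g t) D k (\<lambda>ws. \<alpha> t (e_vec i # ws)) (\<lambda>ws. \<beta> t (e_vec j # ws))) (at t)" for i j
    using Suc.IH[of "\<lambda>s ws. \<alpha> s (e_vec i # ws)" "\<lambda>ws. \<alpha>' (e_vec i # ws)"
        "\<lambda>s ws. \<beta> s (e_vec j # ws)" "\<lambda>ws. \<beta>' (e_vec j # ws)"]
      Suc.prems(1)[of "i # _"] Suc.prems(2)[of "j # _"] by simp
  show ?case
    unfolding contract_Suc contract_variation.simps
    by (rule DERIV_cong[OF DERIV_sum[OF DERIV_sum[OF DERIV_mult[OF D IH]]]])
       (simp add: algebra_simps sum.distrib)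
qed

lemma alternating_Cons: "alternating \<alpha> \<Longrightarrow> alternating (\<lambda>ws. \<alpha> (v # ws))"
  unfolding alternating_def
proof (intro allI impI)
  fix ws :: "(real ^ 'a) list" and i j
  assume "\<forall>vs i j. i < j \<longrightarrow> j < length vs \<longrightarrow> vs ! i = vs ! j \<longrightarrow> \<alpha> vs = 0"
    and "i < j" "j < length ws" "ws ! i = ws ! j"
  then show "\<alpha> (v # ws) = 0"
    by (elim allE[of _ "v # ws"] allE[of _ "Suc i"] allE[of _ "Suc j"]) auto
qed

text \<open>Polarization: expand the vanishing value at u + v repeated in the first two
  slots.\<close>

lemma alternating_swap:
  assumes "multilinear (Suc (Suc k)) \<alpha>" "alternating \<alpha>"
  shows "\<alpha> (u # v # ws) = - \<alpha> (v # u # ws)"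
proof -
  have z: "\<alpha> (x # x # ws) = 0" for x
    using assms(2) unfolding alternating_def
    by (elim allE[of _ "x # x # ws"] allE[of _ 0] allE[of _ 1]) auto
  note l1 = multilinear_linear_hd[OF assms(1)] and l2 = multilinear_linear_hd[OF multilinear_Cons[OF assms(1)]]
  have "0 = \<alpha> ((u + v) # (u + v) # ws)" by (simp add: z)
  also have "\<dots> = \<alpha> (u # v # ws) + \<alpha> (v # u # ws)"
    using linear_add[OF l1, of u v "(u + v) # ws"] linear_add[OF l2, of u u v ws] linear_add[OF l2, of v u v ws]
    by (simp add: z)
  finally show ?thesis by simp
qed

lemma sum_swap_pairs:
  "(\<Sum>i\<in>UNIV. \<Sum>j\<in>UNIV. \<Sum>a\<in>UNIV. \<Sum>b\<in>UNIV. f i j a b) = (\<Sum>a\<in>UNIV. \<Sum>b\<in>UNIV. \<Sum>i\<in>UNIV. \<Sum>j\<in>UNIV. f i j a b)"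
  for f :: "'n::finite \<Rightarrow> 'n \<Rightarrow> 'n \<Rightarrow> 'n \<Rightarrow> real"
proof -
  have "(\<Sum>i\<in>UNIV. \<Sum>j\<in>UNIV. \<Sum>a\<in>UNIV. \<Sum>b\<in>UNIV. f i j a b) = (\<Sum>i\<in>UNIV. \<Sum>a\<in>UNIV. \<Sum>j\<in>UNIV. \<Sum>b\<in>UNIV. f i j a b)"
    by (rule sum.cong[OF refl], rule sum.swap)
  also have "\<dots> = (\<Sum>a\<in>UNIV. \<Sum>i\<in>UNIV. \<Sum>j\<in>UNIV. \<Sum>b\<in>UNIV. f i j a b)"
    by (rule sum.swap)
  also have "\<dots> = (\<Sum>a\<in>UNIV. \<Sum>i\<in>UNIV. \<Sum>b\<in>UNIV. \<Sum>j\<in>UNIV. f i j a b)"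
    by (rule sum.cong[OF refl], rule sum.cong[OF refl], rule sum.swap)
  also have "\<dots> = (\<Sum>a\<in>UNIV. \<Sum>b\<in>UNIV. \<Sum>i\<in>UNIV. \<Sum>j\<in>UNIV. f i j a b)"
    by (rule sum.cong[OF refl], rule sum.swap)
  finally show ?thesis .
qed

text \<open>By antisymmetry every index of a form contributes equally.\<close>

lemma contract_variation_form:
  assumes "multilinear (Suc k) \<alpha>" "alternating \<alpha>" "multilinear (Suc k) \<beta>" "alternating \<beta>"
  shows "contract_variation g D (Suc k) \<alpha> \<beta> = real (Suc k) * (\<Sum>i\<in>UNIV. \<Sum>j\<in>UNIV.
     D $ i $ j * contract g k (\<lambda>ws. \<alpha> (e_vec i # ws)) (\<lambda>ws. \<beta> (e_vec j # ws)))"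
  using assms
proof (induction k arbitrary: \<alpha> \<beta>)
  case 0
  then show ?case by simp
next
  case (Suc k)
  define Q where "Q = matrix_inv (gram g)"
  define C where "C = (\<lambda>i a j b. contract g k (\<lambda>ws. \<alpha> (e_vec i # e_vec a # ws)) (\<lambda>ws. \<beta> (e_vec j # e_vec b # ws)))"
  \<comment> \<open>Exchanging the first two arguments changes the sign of both forms, so the signs
    cancel.\<close>
  have C: "C i a j b = C a i b j" for i a j b
  proof -
    have "\<alpha> (e_vec i # e_vec a # ws) = - \<alpha> (e_vec a # e_vec i # ws)" for ws
      by (rule alternating_swap[OF Suc.prems(1,2)])
    moreover have "\<beta> (e_vec j # e_vec b # ws) = - \<beta> (e_vec b # e_vec j # ws)" for ws
      by (rule alternating_swap[OF Suc.prems(3,4)])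
    ultimately show ?thesis unfolding C_def contract_def by simp
  qed
  have IH: "contract_variation g D (Suc k) (\<lambda>ws. \<alpha> (e_vec i # ws)) (\<lambda>ws. \<beta> (e_vec j # ws)) =
      real (Suc k) * (\<Sum>a\<in>UNIV. \<Sum>b\<in>UNIV. D $ a $ b * C i a j b)" for i j
    unfolding C_def
    by (rule Suc.IH[OF multilinear_Cons[OF Suc.prems(1)] alternating_Cons[OF Suc.prems(2)]
          multilinear_Cons[OF Suc.prems(3)] alternating_Cons[OF Suc.prems(4)]])
  have "(\<Sum>i\<in>UNIV. \<Sum>j\<in>UNIV. Q $ i $ j * (\<Sum>a\<in>UNIV. \<Sum>b\<in>UNIV. D $ a $ b * C i a j b)) =
      (\<Sum>i\<in>UNIV. \<Sum>j\<in>UNIV. \<Sum>a\<in>UNIV. \<Sum>b\<in>UNIV. D $ a $ b * (Q $ i $ j * C a i b j))"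
    unfolding sum_distrib_left by (intro sum.cong refl) (subst C, simp only: mult_ac)
  also have "\<dots> = (\<Sum>a\<in>UNIV. \<Sum>b\<in>UNIV. \<Sum>i\<in>UNIV. \<Sum>j\<in>UNIV. D $ a $ b * (Q $ i $ j * C a i b j))"
    by (rule sum_swap_pairs)
  also have "\<dots> = (\<Sum>a\<in>UNIV. \<Sum>b\<in>UNIV. D $ a $ b * contract g (Suc k) (\<lambda>ws. \<alpha> (e_vec a # ws)) (\<lambda>ws. \<beta> (e_vec b # ws)))"
    unfolding contract_Suc by (simp add: sum_distrib_left Q_def C_def)
  finally have *: "(\<Sum>i\<in>UNIV. \<Sum>j\<in>UNIV. Q $ i $ j * (\<Sum>a\<in>UNIV. \<Sum>b\<in>UNIV. D $ a $ b * C i a j b)) = \<dots>" .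
  have **: "(\<Sum>i\<in>UNIV. \<Sum>j\<in>UNIV. Q $ i $ j * (real (Suc k) * (\<Sum>a\<in>UNIV. \<Sum>b\<in>UNIV. D $ a $ b * C i a j b))) =
      real (Suc k) * (\<Sum>i\<in>UNIV. \<Sum>j\<in>UNIV. Q $ i $ j * (\<Sum>a\<in>UNIV. \<Sum>b\<in>UNIV. D $ a $ b * C i a j b))"
  proof -
    have "(\<Sum>i\<in>UNIV. \<Sum>j\<in>UNIV. Q $ i $ j * (c * X i j)) = c * (\<Sum>i\<in>UNIV. \<Sum>j\<in>UNIV. Q $ i $ j * X i j)"
      for c and X :: "'a \<Rightarrow> 'a \<Rightarrow> real"
      by (simp add: sum_distrib_left mult.left_commute)
    then show ?thesis .
  qed
  \<comment> \<open>The variation of the first index counts once and, after the relabelling above,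
    that of the remaining indices \<open>Suc k\<close> times.\<close>
  show ?case
    unfolding contract_variation.simps(2)[of g D "Suc k"] IH sum.distrib Q_def[symmetric] ** *
    by (simp add: algebra_simps)
qed

section \<open>First variation of squared norms and of the volume density\<close>

lemma contract_commute:
  assumes "inner_tensor g"
  shows "contract g k \<alpha> \<beta> = contract g k \<beta> \<alpha>"
proof -
  have "contract g k \<alpha> \<beta> = (\<Sum>js\<in>{js. length js = k}. \<Sum>is\<in>{is. length is = k}.
     \<alpha> (map e_vec is) * \<beta> (map e_vec js) * (\<Prod>r<k. matrix_inv (gram g) $ (is ! r) $ (js ! r)))"
    unfolding contract_def by (rule sum.swap)
  also have "\<dots> = contract g k \<beta> \<alpha>"
    unfolding contract_def by (subst gram_inverse_symmetric(2)[OF assms]) (simp only: mult.commute)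
  finally show ?thesis .
qed

text \<open>In an orthonormal frame the determinant is 1, and a change of frame multiplies it by a
  square.\<close>

lemma det_gram_pos:
  fixes g :: "'n::finite tensor"
  assumes g: "inner_tensor g"
  shows "det (gram g) > 0"
proof -
  obtain L :: "real ^ 'n \<Rightarrow> real ^ 'n" where L: "linear L" "bij L" "gram (pull L g) = mat 1"
    using ex_orthonormal_frame[OF g] by blast
  have "1 = det (transpose (matrix L) ** gram g ** matrix L)"
    using gram_pull[of g L] L g by (metis det_I inner_tensor_def)
  also have "\<dots> = (det (matrix L))\<^sup>2 * det (gram g)"
    by (simp add: det_mul det_transpose power2_eq_square)
  finally show ?thesis
    by (metis zero_less_one zero_less_mult_pos zero_le_power2 less_le mult_zero_left)
qed

text \<open>The matrix here is k with both indices raised, which up to sign is the derivative of the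
  inverse metric. Thus varying the inverse metric turns into a pairing with k.\<close>

lemma contract_2_form:
  assumes g: "inner_tensor g"
  shows "contract g 2 T k = (\<Sum>i\<in>UNIV. \<Sum>j\<in>UNIV.
    (matrix_inv (gram g) ** gram k ** matrix_inv (gram g)) $ i $ j * T [e_vec i, e_vec j])"
proof -
  define Q where "Q = matrix_inv (gram g)"
  have Q: "Q $ i $ j = Q $ j $ i" for i j
    unfolding Q_def by (rule gram_inverse_symmetric[OF g])
  have "contract g 2 T k = (\<Sum>i\<in>UNIV. \<Sum>j\<in>UNIV. Q $ i $ j * (\<Sum>a\<in>UNIV. \<Sum>b\<in>UNIV. Q $ a $ b * (T [e_vec i, e_vec a] * k [e_vec j, e_vec b])))"
    by (simp add: contract_Suc numeral_2_eq_2 contract_0 Q_def)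
  also have "\<dots> = (\<Sum>i\<in>UNIV. \<Sum>j\<in>UNIV. \<Sum>a\<in>UNIV. \<Sum>b\<in>UNIV. Q $ i $ j * k [e_vec j, e_vec b] * Q $ b $ a * T [e_vec i, e_vec a])"
    by (subst (2) Q) (simp add: sum_distrib_left mult_ac)
  also have "\<dots> = (\<Sum>i\<in>UNIV. \<Sum>a\<in>UNIV. \<Sum>b\<in>UNIV. \<Sum>j\<in>UNIV. Q $ i $ j * k [e_vec j, e_vec b] * Q $ b $ a * T [e_vec i, e_vec a])"
    by (rule sum.cong[OF refl], subst sum.swap, rule sum.cong[OF refl], rule sum.swap)
  also have "\<dots> = (\<Sum>i\<in>UNIV. \<Sum>a\<in>UNIV. (Q ** gram k ** Q) $ i $ a * T [e_vec i, e_vec a])"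
    by (simp add: matrix_matrix_mult_def gram_def sum_distrib_right)
  finally show ?thesis by (simp add: Q_def)
qed

text \<open>Pairing k with the metric is the trace of k, the quantity in Jacobi's formula.\<close>

lemma contract_metric:
  assumes g: "inner_tensor g"
  shows "contract g 2 g k = (\<Sum>i\<in>UNIV. \<Sum>j\<in>UNIV. matrix_inv (gram g) $ i $ j * gram k $ j $ i)"
proof -
  define Q where "Q = matrix_inv (gram g)"
  have "contract g 2 g k = (\<Sum>i\<in>UNIV. \<Sum>j\<in>UNIV. (Q ** gram k ** Q) $ i $ j * gram g $ j $ i)"
  proof -
    have "g [e_vec i, e_vec j] = gram g $ j $ i" for i j
      using gram_symmetric(1)[OF g, of j i] by (simp add: gram_def)
    then show ?thesis unfolding contract_2_form[OF g] Q_def by simp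
  qed
  also have "\<dots> = (\<Sum>i\<in>UNIV. (Q ** gram k ** Q ** gram g) $ i $ i)"
    by (simp add: matrix_matrix_mult_def)
  also have "Q ** gram k ** Q ** gram g = Q ** gram k"
    using gram_inverse(2)[OF g] by (metis Q_def matrix_mul_assoc matrix_mul_rid)
  finally show ?thesis by (simp add: matrix_matrix_mult_def Q_def)
qed

text \<open>All \<open>Suc m\<close> indices contribute equally to the variation of the inverse
  metric, and this factor reduces \<open>1 / fact (Suc m)\<close> to the \<open>1 / fact m\<close>
  in T. The minus sign is that of the derivative of the inverse.\<close>

lemma has_derivative_form_sq:
  fixes g :: "real \<Rightarrow> 'n::finite tensor"
  assumes g: "inner_tensor (g t)"
    and g': "\<And>vs. ((\<lambda>s. g s vs) has_real_derivative k vs) (at t)"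
    and \<alpha>: "multilinear (Suc m) (\<alpha> t)" "alternating (\<alpha> t)"
    and \<alpha>': "\<And>vs. ((\<lambda>s. \<alpha> s vs) has_real_derivative \<beta> vs) (at t)"
    and T: "\<And>u v. T [u, v] = contract (g t) m (\<lambda>ws. \<alpha> t (u # ws)) (\<lambda>ws. \<alpha> t (v # ws)) / fact m"
  shows "((\<lambda>s. form_sq (g s) (Suc m) (\<alpha> s)) has_real_derivative
    2 * form_inner (g t) (Suc m) (\<alpha> t) \<beta> - contract (g t) 2 T k) (at t)"
proof -
  define Q where "Q = matrix_inv (gram (g t))"
  define D where "D = - (Q ** gram k ** Q)"
  have "((\<lambda>s. matrix_inv (gram (g s)) $ i $ j) has_real_derivative D $ i $ j) (at t)" for i j
    using has_derivative_matrix_inv[of "\<lambda>s. gram (g s)" "gram k" t] g' gram_invertible[OF g]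
    by (simp add: gram_def[of "g _"] gram_def[of k] Q_def D_def)
  from has_derivative_contract[where g=g and \<alpha>=\<alpha> and \<beta>=\<alpha> and k="Suc m", OF this \<alpha>' \<alpha>']
  have "((\<lambda>s. contract (g s) (Suc m) (\<alpha> s) (\<alpha> s)) has_real_derivative
      contract (g t) (Suc m) \<beta> (\<alpha> t) + contract (g t) (Suc m) (\<alpha> t) \<beta> +
      contract_variation (g t) D (Suc m) (\<alpha> t) (\<alpha> t)) (at t)" .
  moreover have "contract_variation (g t) D (Suc m) (\<alpha> t) (\<alpha> t) = - (fact (Suc m) * contract (g t) 2 T k)"
  proof -
    have "fact (Suc m) * (M * (c / fact m)) = real (Suc m) * (M * c)" for M c :: real
      by (simp add: field_simps)
    then show ?thesis
      unfolding contract_variation_form[OF \<alpha> \<alpha>] contract_2_form[OF g] T sum_distrib_left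
      by (simp add: D_def Q_def sum_negf del: fact_Suc of_nat_Suc)
  qed
  ultimately have "((\<lambda>s. contract (g s) (Suc m) (\<alpha> s) (\<alpha> s)) has_real_derivative
      2 * contract (g t) (Suc m) (\<alpha> t) \<beta> - (fact (Suc m) * contract (g t) 2 T k)) (at t)"
    by (simp add: contract_commute[OF g, of "Suc m" \<beta> "\<alpha> t"] del: fact_Suc)
  from DERIV_cdivide[OF this, of "fact (Suc m)"] show ?thesis
    unfolding form_sq_def form_inner_def by (simp add: diff_divide_distrib del: fact_Suc)
qed

lemma has_derivative_volume:
  fixes g :: "real \<Rightarrow> 'n::finite tensor"
  assumes g: "inner_tensor (g t)"
    and g': "\<And>vs. ((\<lambda>s. g s vs) has_real_derivative k vs) (at t)"
  shows "((\<lambda>s. sqrt (det (gram (g s)))) has_real_derivative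
    sqrt (det (gram (g t))) * (contract (g t) 2 (g t) k / 2)) (at t)"
proof -
  note pos = det_gram_pos[OF g]
  have "((\<lambda>s. det (gram (g s))) has_real_derivative det (gram (g t)) * contract (g t) 2 (g t) k) (at t)"
    unfolding contract_metric[OF g]
    using has_derivative_det[of "\<lambda>s. gram (g s)" "gram k" t] gram_invertible[OF g] g'
    by (simp add: gram_def[of "g _"] gram_def[of k])
  from DERIV_chain2[where f=sqrt and g="\<lambda>s. det (gram (g s))", OF DERIV_real_sqrt[OF pos] this] show ?thesis
    by (rule DERIV_cong) (use pos in \<open>simp add: field_simps\<close>)
qed

section \<open>Charts and the Riemannian integral\<close>

lemma is_chart_D:
  assumes "is_chart c"
  shows "open (fst c)" "open (snd c ` fst c)"
    and "p \<in> fst c \<Longrightarrow> chart_inv c (snd c p) = p"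
    and "x \<in> snd c ` fst c \<Longrightarrow> chart_inv c x \<in> fst c"
    and "x \<in> snd c ` fst c \<Longrightarrow> snd c (chart_inv c x) = x"
    and "continuous_on (fst c) (snd c)" "continuous_on (snd c ` fst c) (chart_inv c)"
    and "open W \<Longrightarrow> W \<subseteq> fst c \<Longrightarrow> open (snd c ` W)"
    and "inj_on (snd c) (fst c)"
proof -
  note hom = assms[unfolded is_chart_def]
  show o: "open (fst c)" "open (snd c ` fst c)" using hom by auto
  show "continuous_on (fst c) (snd c)" "continuous_on (snd c ` fst c) (chart_inv c)"
    using hom by (auto simp: homeomorphism_def)
  have inv: "chart_inv c (snd c p) = p" if "p \<in> fst c" for p
    using hom that unfolding homeomorphism_def by blast
  show "p \<in> fst c \<Longrightarrow> chart_inv c (snd c p) = p" by (rule inv)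
  show "x \<in> snd c ` fst c \<Longrightarrow> chart_inv c x \<in> fst c"
    "x \<in> snd c ` fst c \<Longrightarrow> snd c (chart_inv c x) = x" using inv by auto
  show "inj_on (snd c) (fst c)" using inv by (rule inj_on_inverseI)
  show "open (snd c ` W)" if "open W" "W \<subseteq> fst c"
  proof -
    have "openin (top_of_set (fst c)) W" using that o by (simp add: openin_open_eq)
    then have "openin (top_of_set (snd c ` fst c)) (snd c ` W)"
      using hom homeomorphism_imp_open_map by blast
    then show ?thesis using o(2) openin_open_eq by blast
  qed
qed

lemma smooth_atlas_D:
  assumes "smooth_atlas A"
  shows "c \<in> A \<Longrightarrow> is_chart c" "\<exists>c\<in>A. p \<in> fst c"
    and "chart_at A p \<in> A" "p \<in> fst (chart_at A p)"
proof -
  show "c \<in> A \<Longrightarrow> is_chart c" using assms by (auto simp: smooth_atlas_def)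
  show ex: "\<exists>c\<in>A. p \<in> fst c" using assms unfolding smooth_atlas_def by blast
  then have "\<exists>c. c \<in> A \<and> p \<in> fst c" by blast
  from someI_ex[OF this] show "chart_at A p \<in> A" "p \<in> fst (chart_at A p)"
    unfolding chart_at_def by auto
qed

lemma smooth_on_imp_differentiable:
  assumes "open U" "smooth_on U f" "x \<in> U"
  shows "f differentiable (at x)"
proof -
  have "(\<lambda>x. f x \<bullet> b) differentiable (at x)" if "b \<in> Basis" for b
  proof -
    have "Ck_on (Suc 0) U (\<lambda>x. f x \<bullet> b)" using assms(2) that unfolding smooth_on_def by blast
    from Ck_on_SucD[OF assms(1) this assms(3)] show ?thesis by (auto simp: differentiable_def)
  qed
  then show ?thesis by (subst differentiable_componentwise_within) blast
qed

lemma transition_has_derivative: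
  assumes "smooth_atlas A" "c \<in> A" "d \<in> A" "p \<in> fst c" "p \<in> fst d"
  shows "((snd d \<circ> chart_inv c) has_derivative
    frechet_derivative (snd d \<circ> chart_inv c) (at (snd c p))) (at (snd c p))"
proof -
  note C = is_chart_D[OF smooth_atlas_D(1)[OF assms(1,2)]] and D = is_chart_D[OF smooth_atlas_D(1)[OF assms(1,3)]]
  have "smooth_on (snd c ` (fst c \<inter> fst d)) (snd d \<circ> chart_inv c)"
    using assms unfolding smooth_atlas_def by blast
  moreover have "open (snd c ` (fst c \<inter> fst d))"
    by (rule C(8)) (auto intro: C D)
  ultimately have "(snd d \<circ> chart_inv c) differentiable (at (snd c p))"
    using assms(4,5) by (intro smooth_on_imp_differentiable) auto
  then show ?thesis by (simp only: frechet_derivative_works)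
qed

text \<open>The frame is the derivative of a transition map. By the chain rule the derivative of the
  reverse transition is a left inverse, and an injective linear endomorphism in finite dimension is
  bijective.\<close>

lemma linear_bij_frame:
  fixes A :: "('a::{t2_space,second_countable_topology}, 'n::finite) chart set"
  assumes A: "smooth_atlas A" and c: "c \<in> A" and p: "p \<in> fst c"
  shows "linear (frame A c p)" "bij (frame A c p)"
proof -
  define d where "d = chart_at A p"
  have d: "d \<in> A" "p \<in> fst d" unfolding d_def by (rule smooth_atlas_D[OF A])+
  note C = is_chart_D[OF smooth_atlas_D(1)[OF A c]] and D = is_chart_D[OF smooth_atlas_D(1)[OF A d(1)]]
  define T where "T = snd d \<circ> chart_inv c"
  define T' where "T' = snd c \<circ> chart_inv d"
  have dT: "(T has_derivative frame A c p) (at (snd c p))"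
    unfolding T_def frame_def d_def[symmetric] by (rule transition_has_derivative[OF A c d(1) p d(2)])
  have Tp: "T (snd c p) = snd d p" by (simp add: T_def C(3)[OF p])
  obtain G where dT': "(T' has_derivative G) (at (T (snd c p)))"
    unfolding Tp T'_def using transition_has_derivative[OF A d(1) c d(2) p] by blast
  have "((\<lambda>x. T' (T x)) has_derivative (\<lambda>v. G (frame A c p v))) (at (snd c p))"
    by (rule has_derivative_compose[OF dT dT'])
  moreover have "((\<lambda>x. T' (T x)) has_derivative (\<lambda>v. v)) (at (snd c p))"
  proof (rule has_derivative_transform_within_open[OF has_derivative_ident])
    show "open (snd c ` (fst c \<inter> fst d))" by (rule C(8)) (auto intro: C D)
    show "snd c p \<in> snd c ` (fst c \<inter> fst d)" using p d by blast
    show "x = T' (T x)" if "x \<in> snd c ` (fst c \<inter> fst d)" for x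
      using that by (auto simp: T_def T'_def C(3) D(3))
  qed
  ultimately have "(\<lambda>v. G (frame A c p v)) = (\<lambda>v. v)" by (rule has_derivative_unique)
  then have "inj (frame A c p)" by (metis injI)
  moreover show lin: "linear (frame A c p)" by (rule has_derivative_linear[OF dT])
  ultimately show "bij (frame A c p)"
    using linear_injective_imp_surjective by (auto simp: bij_def)
qed

lemma in_chart_eq_pull: "in_chart A c T x = pull (frame A c (chart_inv c x)) (T (chart_inv c x))"
  by (simp add: in_chart_def fun_eq_iff)

lemma linear_bij_frame':
  fixes A :: "('a::{t2_space,second_countable_topology}, 'n::finite) chart set"
  assumes "smooth_atlas A" "c \<in> A" "x \<in> snd c ` fst c"
  shows "linear (frame A c (chart_inv c x))" "bij (frame A c (chart_inv c x))"
  using linear_bij_frame[OF assms(1,2)] is_chart_D(4)[OF smooth_atlas_D(1)[OF assms(1,2)] assms(3)] by blast+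

lemma multilinear_in_chart:
  fixes A :: "('a::{t2_space,second_countable_topology}, 'n::finite) chart set"
  assumes "smooth_atlas A" "c \<in> A" "x \<in> snd c ` fst c" "multilinear k (T (chart_inv c x))"
  shows "multilinear k (in_chart A c T x)"
  unfolding in_chart_eq_pull by (rule multilinear_pull[OF assms(4) linear_bij_frame'(1)[OF assms(1-3)]])

lemma inner_tensor_in_chart:
  fixes A :: "('a::{t2_space,second_countable_topology}, 'n::finite) chart set"
  assumes "smooth_atlas A" "c \<in> A" "x \<in> snd c ` fst c" "inner_tensor (g (chart_inv c x))"
  shows "inner_tensor (in_chart A c g x)"
  unfolding in_chart_eq_pull by (rule inner_tensor_pull[OF assms(4) linear_bij_frame'[OF assms(1-3)]])

text \<open>The bridge between the components in a fixed chart, where smoothness is known, and those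
  in the model tangent space, in which the data and the functional are written.\<close>

lemma contract_in_chart:
  fixes A :: "('a::{t2_space,second_countable_topology}, 'n::finite) chart set"
  assumes "smooth_atlas A" "c \<in> A" "x \<in> snd c ` fst c" "inner_tensor (g (chart_inv c x))"
    "multilinear k (\<alpha> (chart_inv c x))" "multilinear k (\<beta> (chart_inv c x))"
  shows "contract (in_chart A c g x) k (in_chart A c \<alpha> x) (in_chart A c \<beta> x) =
    contract (g (chart_inv c x)) k (\<alpha> (chart_inv c x)) (\<beta> (chart_inv c x))"
  unfolding in_chart_eq_pull by (rule contract_pull[OF assms(4) linear_bij_frame'[OF assms(1-3)] assms(5,6)])

lemma riemannian_metric_inner:
  "riemannian_metric A g \<Longrightarrow> inner_tensor (g p)"
  by (auto simp: riemannian_metric_def smooth_tensor_def inner_tensor_def)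

lemma smooth_tensor_Ck:
  "smooth_tensor A k T \<Longrightarrow> c \<in> A \<Longrightarrow> Ck_on m (snd c ` fst c) (\<lambda>x. in_chart A c T x vs)"
  unfolding smooth_tensor_def smooth_on_real by blast

lemma smooth_tensor_multilinear: "smooth_tensor A k T \<Longrightarrow> multilinear k (T p)"
  unfolding smooth_tensor_def by blast

lemma smooth_function_Ck:
  "smooth_function A f \<Longrightarrow> c \<in> A \<Longrightarrow> Ck_on m (snd c ` fst c) (\<lambda>x. f (chart_inv c x))"
  unfolding smooth_function_def smooth_on_real o_def by blast

lemma Ck_on_contract_in_chart:
  fixes A :: "('a::{t2_space,second_countable_topology}, 'n::finite) chart set"
  assumes A: "smooth_atlas A" "c \<in> A" and g: "riemannian_metric A g"
    and "\<And>vs. Ck_on m (snd c ` fst c) (\<lambda>x. \<alpha> x vs)" "\<And>vs. Ck_on m (snd c ` fst c) (\<lambda>x. \<beta> x vs)"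
  shows "Ck_on m (snd c ` fst c) (\<lambda>x. contract (in_chart A c g x) k (\<alpha> x) (\<beta> x))"
proof (rule Ck_on_contract)
  show "open (snd c ` fst c)" by (rule is_chart_D(2)[OF smooth_atlas_D(1)[OF A]])
  show "Ck_on m (snd c ` fst c) (\<lambda>x. gram (in_chart A c g x) $ i $ j)" for i j
    using smooth_tensor_Ck[of A 2 g c] g A(2) by (simp add: gram_def riemannian_metric_def)
  show "det (gram (in_chart A c g x)) \<noteq> 0" if "x \<in> snd c ` fst c" for x
    using det_gram_pos[OF inner_tensor_in_chart[where g=g, OF A that riemannian_metric_inner[OF g]]] by simp
qed (use assms in blast)+

lemma smooth_function_contract:
  fixes A :: "('a::{t2_space,second_countable_topology}, 'n::finite) chart set"
  assumes A: "smooth_atlas A" and g: "riemannian_metric A g"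
    and \<alpha>: "smooth_tensor A k \<alpha>" and \<beta>: "smooth_tensor A k \<beta>"
  shows "smooth_function A (\<lambda>p. contract (g p) k (\<alpha> p) (\<beta> p))"
  unfolding smooth_function_def smooth_on_real
proof (intro ballI allI)
  fix c m assume c: "c \<in> A"
  show "Ck_on m (snd c ` fst c) ((\<lambda>p. contract (g p) k (\<alpha> p) (\<beta> p)) \<circ> chart_inv c)"
  proof (rule Ck_on_cong[THEN iffD1])
    show "Ck_on m (snd c ` fst c) (\<lambda>x. contract (in_chart A c g x) k (in_chart A c \<alpha> x) (in_chart A c \<beta> x))"
      by (intro Ck_on_contract_in_chart[OF A c g] smooth_tensor_Ck[OF \<alpha> c] smooth_tensor_Ck[OF \<beta> c])
    show "open (snd c ` fst c)" by (rule is_chart_D(2)[OF smooth_atlas_D(1)[OF A c]])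
    show "contract (in_chart A c g x) k (in_chart A c \<alpha> x) (in_chart A c \<beta> x) =
        ((\<lambda>p. contract (g p) k (\<alpha> p) (\<beta> p)) \<circ> chart_inv c) x" if "x \<in> snd c ` fst c" for x
      using contract_in_chart[where g=g and \<alpha>=\<alpha> and \<beta>=\<beta>, OF A c that riemannian_metric_inner[OF g]
          smooth_tensor_multilinear[OF \<alpha>] smooth_tensor_multilinear[OF \<beta>]] by simp
  qed
qed

lemma smooth_function_const: "smooth_atlas A \<Longrightarrow> smooth_function A (\<lambda>p. r)"
  unfolding smooth_function_def smooth_on_real o_def
  by (blast intro: Ck_on_const is_chart_D(2) smooth_atlas_D(1))

lemma smooth_function_add:
  "smooth_atlas A \<Longrightarrow> smooth_function A f \<Longrightarrow> smooth_function A h \<Longrightarrow> smooth_function A (\<lambda>p. f p + h p)"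
  unfolding smooth_function_def smooth_on_real o_def
  by (intro ballI allI Ck_on_add is_chart_D(2) smooth_atlas_D(1)) auto

lemma smooth_function_mult:
  "smooth_atlas A \<Longrightarrow> smooth_function A f \<Longrightarrow> smooth_function A h \<Longrightarrow> smooth_function A (\<lambda>p. f p * h p)"
  unfolding smooth_function_def smooth_on_real o_def
  by (intro ballI allI Ck_on_mult is_chart_D(2) smooth_atlas_D(1)) auto

text \<open>Justifies the choice in \<open>compact_cover\<close>. Around each point a closed
  coordinate ball is the compact set, and the open ball inside it takes part in the selection of a
  finite subcover.\<close>

lemma ex_compact_cover:
  fixes A :: "('a::{t2_space,second_countable_topology}, 'n::finite) chart set"
  assumes A: "smooth_atlas A" and comp: "compact (UNIV :: 'a set)"
  shows "\<exists>cs. (\<forall>(c, K)\<in>set cs. c \<in> A \<and> compact K \<and> K \<subseteq> fst c) \<and> (\<Union>(c, K)\<in>set cs. K) = (UNIV :: 'a set)"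
proof -
  let ?P = "\<lambda>p (c, K, W). c \<in> A \<and> compact K \<and> K \<subseteq> fst c \<and> open W \<and> W \<subseteq> K \<and> p \<in> W"
  have "\<forall>p. \<exists>z. ?P p z"
  proof (rule allI)
    fix p :: 'a
    show "\<exists>z. ?P p z"
  proof -
    obtain c where c: "c \<in> A" "p \<in> fst c" using smooth_atlas_D(2)[OF A] by blast
    note C = is_chart_D[OF smooth_atlas_D(1)[OF A c(1)]]
    have hom: "homeomorphism (snd c ` fst c) (fst c) (chart_inv c) (snd c)"
      using smooth_atlas_D(1)[OF A c(1)] unfolding is_chart_def by (blast intro: homeomorphism_symD)
    obtain e where e: "e > 0" "cball (snd c p) e \<subseteq> snd c ` fst c"
      using open_contains_cball_eq[OF C(2)] c(2) by blast
    have be: "ball (snd c p) e \<subseteq> snd c ` fst c" using e(2) ball_subset_cball by blast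
    have "compact (chart_inv c ` cball (snd c p) e)"
      by (rule compact_continuous_image[OF continuous_on_subset[OF C(7) e(2)]]) simp
    moreover have "chart_inv c ` cball (snd c p) e \<subseteq> fst c" using e(2) C(4) by blast
    moreover have "open (chart_inv c ` ball (snd c p) e)"
    proof -
      have "openin (top_of_set (snd c ` fst c)) (ball (snd c p) e)" using be C(2) by (simp add: openin_open_eq)
      then have "openin (top_of_set (fst c)) (chart_inv c ` ball (snd c p) e)"
        by (rule homeomorphism_imp_open_map[OF hom])
      then show ?thesis using C(1) openin_open_eq by blast
    qed
    moreover have "chart_inv c ` ball (snd c p) e \<subseteq> chart_inv c ` cball (snd c p) e"
      by (rule image_mono) (rule ball_subset_cball)
    moreover have "p \<in> chart_inv c ` ball (snd c p) e"
      using C(3)[OF c(2)] e(1) by (intro image_eqI[of _ _ "snd c p"]) auto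
    ultimately show ?thesis
      using c(1) by (intro exI[of _ "(c, chart_inv c ` cball (snd c p) e, chart_inv c ` ball (snd c p) e)"]) simp
    qed
  qed
  then obtain z where z: "\<forall>p. ?P p (z p)" by (rule choice[THEN exE])
  define c where "c = (\<lambda>p. fst (z p))"
  define K where "K = (\<lambda>p. fst (snd (z p)))"
  define W where "W = (\<lambda>p. snd (snd (z p)))"
  have *: "c p \<in> A \<and> compact (K p) \<and> K p \<subseteq> fst (c p) \<and> open (W p) \<and> W p \<subseteq> K p \<and> p \<in> W p" for p
    using z[rule_format, of p] by (simp add: c_def K_def W_def case_prod_beta)
  have oW: "open (W p)" and inW: "p \<in> W p" and WK: "W p \<subseteq> K p" for p using *[of p] by simp_all
  have cov: "UNIV \<subseteq> (\<Union>p\<in>UNIV. W p)" using inW by blast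
  obtain P where P: "finite P" "UNIV \<subseteq> (\<Union>p\<in>P. W p)"
    by (rule compactE_image[OF comp oW cov])
  obtain ps where ps: "set ps = P" using finite_list[OF P(1)] by blast
  have "(\<Union>p\<in>P. K p) = UNIV" using P(2) WK by blast
  then have "(\<Union>(c, K)\<in>set (map (\<lambda>p. (c p, K p)) ps). K) = UNIV" by (simp add: ps)
  moreover have "\<forall>(c, K)\<in>set (map (\<lambda>p. (c p, K p)) ps). c \<in> A \<and> compact K \<and> K \<subseteq> fst c"
    using * by simp
  ultimately show ?thesis by (intro exI conjI)
qed

text \<open>The cover depends on the atlas alone, so one decomposition serves all metrics and
  integrands at once. This allows differentiation term by term while the metric varies.\<close>

lemma riem_integral_pieces:
  fixes A :: "('a::{t2_space,second_countable_topology}, 'n::finite) chart set"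
  assumes "smooth_atlas A" "compact (UNIV :: 'a set)"
  obtains n :: nat and c :: "nat \<Rightarrow> ('a, 'n) chart" and K
  where "\<forall>i<n. c i \<in> A \<and> compact (K i) \<and> K i \<subseteq> fst (c i)" "(\<Union>i<n. K i) = UNIV"
    and "\<forall>g f. riem_integral A g f = (\<Sum>i<n. set_lebesgue_integral lborel (snd (c i) ` (K i - (\<Union>j<i. K j)))
      (\<lambda>x. f (chart_inv (c i) x) * sqrt (det (gram (in_chart A (c i) g x)))))"
proof -
  define cs where "cs = compact_cover A"
  have cs: "\<forall>(c, K)\<in>set cs. c \<in> A \<and> compact K \<and> K \<subseteq> fst c" "(\<Union>(c, K)\<in>set cs. K) = UNIV"
    using someI_ex[OF ex_compact_cover[OF assms]] unfolding cs_def compact_cover_def by auto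
  show thesis
  proof (rule that[of "length cs" "\<lambda>i. fst (cs ! i)" "\<lambda>i. snd (cs ! i)"])
    show "\<forall>i<length cs. fst (cs ! i) \<in> A \<and> compact (snd (cs ! i)) \<and> snd (cs ! i) \<subseteq> fst (fst (cs ! i))"
      using cs(1) nth_mem by (auto simp: case_prod_beta)
    show "(\<Union>i<length cs. snd (cs ! i)) = UNIV"
      using cs(2) by (auto simp: case_prod_beta set_conv_nth)
  qed (simp add: riem_integral_def cs_def Let_def)
qed


section \<open>Integrals over Borel subsets of compact sets\<close>

lemma set_integrable_in_compact:
  fixes \<phi> :: "'e::euclidean_space \<Rightarrow> real"
  assumes "continuous_on U \<phi>" "compact C" "C \<subseteq> U" "B \<subseteq> C" "B \<in> sets borel"
  shows "set_integrable lborel B \<phi>"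
proof (rule set_integrable_subset[of _ C])
  show "set_integrable lborel C \<phi>"
    unfolding set_integrable_def
    by (rule borel_integrable_compact[OF assms(2) continuous_on_subset[OF assms(1,3)]])
qed (use assms in auto)

text \<open>A zero integral gives vanishing almost everywhere only; on an open subset of B
  continuity upgrades this to every point.\<close>

lemma set_integral_eq_0_imp:
  fixes \<phi> :: "'e::euclidean_space \<Rightarrow> real"
  assumes "continuous_on U \<phi>" "set_integrable lborel B \<phi>" "B \<subseteq> U"
    and nn: "\<And>x. x \<in> B \<Longrightarrow> 0 \<le> \<phi> x" and 0: "set_lebesgue_integral lborel B \<phi> = 0"
    and W: "open W" "W \<subseteq> B" "x \<in> W"
  shows "\<phi> x = 0"
proof (rule ccontr)
  assume nz: "\<phi> x \<noteq> 0"
  have "AE y in lborel. indicator B y *\<^sub>R \<phi> y = 0"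
    using assms(2) 0 nn integral_nonneg_eq_0_iff_AE[of lborel "\<lambda>y. indicator B y *\<^sub>R \<phi> y"]
    unfolding set_integrable_def set_lebesgue_integral_def by (simp add: indicator_def)
  then have "AE y in lebesgue. indicator B y *\<^sub>R \<phi> y = 0"
    by (rule AE_completion)
  then have ae: "AE y in lebesgue. y \<in> {y\<in>W. \<phi> y \<noteq> 0} \<longrightarrow> y \<in> {}"
    by (rule AE_mp) (use W(2) in \<open>auto simp: indicator_def\<close>)
  have "open (W \<inter> \<phi> -` (- {0}))"
    by (rule continuous_open_preimage)
      (use assms(1,3) W in \<open>auto intro: continuous_on_subset\<close>)
  moreover have "W \<inter> \<phi> -` (- {0}) = {y\<in>W. \<phi> y \<noteq> 0}" by auto
  ultimately have "open {y\<in>W. \<phi> y \<noteq> 0}" by simp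
  \<comment> \<open>An open set that is almost everywhere contained in a closed set is contained in
    it; with the empty closed set, the open set where \<phi> is nonzero inside W must be
    empty.\<close>
  from mem_closed_if_AE_lebesgue_open[OF this closed_empty ae, of x] nz W(3) show False by blast
qed

text \<open>Dominated convergence for the difference quotients. The mean value inequality bounds
  them by the maximum of the parameter derivative over a compact set, for which one continuous
  derivative is enough.\<close>

lemma has_derivative_set_integral:
  fixes \<phi> :: "real \<Rightarrow> 'e::euclidean_space \<Rightarrow> real"
  assumes \<epsilon>: "\<epsilon> > 0" and U: "open U" and C: "compact C" "C \<subseteq> U" and B: "B \<subseteq> C" "B \<in> sets borel"
    and \<phi>: "Ck_on 1 ({-\<epsilon><..<\<epsilon>} \<times> U) (\<lambda>z. \<phi> (fst z) (snd z))"
    and \<psi>: "\<And>x. x \<in> U \<Longrightarrow> ((\<lambda>s. \<phi> s x) has_real_derivative \<psi> x) (at 0)"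
  shows "((\<lambda>s. set_lebesgue_integral lborel B (\<phi> s)) has_real_derivative
    set_lebesgue_integral lborel B \<psi>) (at 0)"
proof -
  define D where "D = {-\<epsilon><..<\<epsilon>} \<times> U"
  define F where "F = (\<lambda>z. \<phi> (fst z) (snd z))"
  define F' where "F' = (\<lambda>z. frechet_derivative F (at z) (1, 0))"
  have oD: "open D" unfolding D_def by (intro open_Times U) simp
  have CkF: "Ck_on (Suc 0) D F" using \<phi> by (simp add: D_def F_def)
  have dF: "(F has_derivative frechet_derivative F (at z)) (at z)" if "z \<in> D" for z
    by (rule Ck_on_SucD[OF oD CkF that])
  have cF: "continuous_on D F" by (rule Ck_on_imp_continuous_on[OF oD CkF])
  have "Ck_on 0 D (\<lambda>z. frechet_derivative F (at z) (1, 0))"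
    by (rule Ck_on_deriv[OF CkF]) (simp add: Basis_prod_def)
  then have cF': "continuous_on D F'" by (simp add: F'_def)
  have ds: "((\<lambda>s. \<phi> s x) has_real_derivative F' (s, x)) (at s)" if "(s, x) \<in> D" for s x
  proof -
    have "((\<lambda>s. (s, x)) has_derivative (\<lambda>h. (h, 0))) (at s)"
      by (intro has_derivative_Pair has_derivative_ident has_derivative_const)
    from has_derivative_compose[OF this dF[OF that]]
    have "((\<lambda>s. \<phi> s x) has_derivative (\<lambda>h. frechet_derivative F (at (s, x)) (h, 0))) (at s)"
      by (simp add: F_def)
    moreover have "frechet_derivative F (at (s, x)) (h, 0) = F' (s, x) * h" for h
      using linear_scale[OF has_derivative_linear[OF dF[OF that]], of h "(1, 0)"] by (simp add: F'_def)
    ultimately show ?thesis by (simp add: has_field_derivative_def)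
  qed
  have D0: "(0, x) \<in> D" if "x \<in> U" for x using that \<epsilon> by (simp add: D_def)
  have c\<phi>: "continuous_on U (\<phi> s)" if "\<bar>s\<bar> < \<epsilon>" for s
  proof -
    have "continuous_on U (\<lambda>x. F (s, x))"
      by (rule continuous_on_compose2[OF cF]) (use that in \<open>auto simp: D_def intro!: continuous_intros\<close>)
    then show ?thesis by (simp add: F_def)
  qed
  have int\<phi>: "set_integrable lborel B (\<phi> s)" if "\<bar>s\<bar> < \<epsilon>" for s
    by (rule set_integrable_in_compact[OF c\<phi>[OF that] C B])
  \<comment> \<open>Halving the parameter interval gives a compact set inside the open domain D, on
    which the derivative is bounded.\<close>
  have "compact ({-\<epsilon>/2..\<epsilon>/2} \<times> C)" by (intro compact_Times C) simp
  moreover have subD: "{-\<epsilon>/2..\<epsilon>/2} \<times> C \<subseteq> D" using C(2) \<epsilon> by (auto simp: D_def)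
  ultimately have "compact (F' ` ({-\<epsilon>/2..\<epsilon>/2} \<times> C))"
    using compact_continuous_image continuous_on_subset[OF cF'] by blast
  then have "bounded (F' ` ({-\<epsilon>/2..\<epsilon>/2} \<times> C))" by (rule compact_imp_bounded)
  then obtain M where M: "\<And>s x. s \<in> {-\<epsilon>/2..\<epsilon>/2} \<Longrightarrow> x \<in> C \<Longrightarrow> \<bar>F' (s, x)\<bar> \<le> M"
    unfolding bounded_iff real_norm_def by blast
  have quot: "\<bar>(\<phi> h x - \<phi> 0 x) / h\<bar> \<le> M" if h: "\<bar>h\<bar> < \<epsilon>/2" "h \<noteq> 0" and x: "x \<in> C" for h x
  proof -
    have "\<bar>\<phi> h x - \<phi> 0 x\<bar> \<le> M * \<bar>h - 0\<bar>"
    proof (rule field_differentiable_bound[of "{-\<epsilon>/2..\<epsilon>/2}" "\<lambda>s. \<phi> s x" "\<lambda>s. F' (s, x)" M h 0, unfolded real_norm_def])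
      show "((\<lambda>s. \<phi> s x) has_field_derivative F' (s, x)) (at s within {-\<epsilon>/2..\<epsilon>/2})" if "s \<in> {-\<epsilon>/2..\<epsilon>/2}" for s
        using ds subD that x by (blast intro: has_field_derivative_at_within)
    qed (use M x h \<epsilon> in auto)
    then show ?thesis using h(2) by (simp add: abs_divide divide_le_eq)
  qed
  have "((\<lambda>h. (set_lebesgue_integral lborel B (\<phi> (0 + h)) - set_lebesgue_integral lborel B (\<phi> 0)) / h)
      \<longlongrightarrow> set_lebesgue_integral lborel B \<psi>) (at 0)"
    unfolding tendsto_at_iff_sequentially o_def
  proof (intro allI impI)
    fix X :: "nat \<Rightarrow> real" assume X: "\<forall>i. X i \<in> UNIV - {0}" "X \<longlonglongrightarrow> 0"
    have "eventually (\<lambda>n. \<bar>X n\<bar> < \<epsilon>/2) sequentially"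
      using tendstoD[OF X(2), of "\<epsilon>/2"] \<epsilon> by simp
    then obtain N where N: "\<And>n. n \<ge> N \<Longrightarrow> \<bar>X n\<bar> < \<epsilon>/2" unfolding eventually_sequentially by blast
    \<comment> \<open>The shift makes every term small enough for the bound;
      \<open>LIMSEQ_offset\<close> undoes it at the end.\<close>
    define Y where "Y = (\<lambda>n. X (n + N))"
    have Y: "\<bar>Y n\<bar> < \<epsilon>/2" "Y n \<noteq> 0" for n using X N[of "n + N"] by (auto simp: Y_def)
    have Yl: "Y \<longlonglongrightarrow> 0" unfolding Y_def by (rule LIMSEQ_ignore_initial_segment[OF X(2)])
    define q where "q = (\<lambda>n x. indicator B x *\<^sub>R ((\<phi> (Y n) x - \<phi> 0 x) / Y n))"
    have Y\<epsilon>: "\<bar>Y n\<bar> < \<epsilon>" for n using Y(1)[of n] \<epsilon> by simp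
    have si: "set_integrable lborel B (\<lambda>x. (\<phi> (Y n) x - \<phi> 0 x) / Y n)" for n
      using set_integral_diff(1)[OF int\<phi>[OF Y\<epsilon>] int\<phi>[of 0]] \<epsilon> by simp
    have eq: "integral\<^sup>L lborel (q n) = (set_lebesgue_integral lborel B (\<phi> (0 + Y n)) - set_lebesgue_integral lborel B (\<phi> 0)) / Y n" for n
    proof -
      have "integral\<^sup>L lborel (q n) = set_lebesgue_integral lborel B (\<lambda>x. (\<phi> (Y n) x - \<phi> 0 x) / Y n)"
        by (simp add: q_def set_lebesgue_integral_def)
      also have "\<dots> = set_lebesgue_integral lborel B (\<lambda>x. \<phi> (Y n) x - \<phi> 0 x) / Y n" by simp
      finally show ?thesis using set_integral_diff(2)[OF int\<phi>[OF Y\<epsilon>] int\<phi>[of 0]] \<epsilon> by simp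
    qed
    have \<psi>F: "\<psi> x = F' (0, x)" if "x \<in> U" for x
      using DERIV_unique[OF \<psi>[OF that] ds[OF D0[OF that]]] .
    have lim: "(\<lambda>n. q n x) \<longlonglongrightarrow> indicator B x *\<^sub>R \<psi> x" for x
    proof (cases "x \<in> B")
      case True
      then have "x \<in> U" using B C by blast
      then have "((\<lambda>h. (\<phi> (0 + h) x - \<phi> 0 x) / h) \<longlongrightarrow> \<psi> x) (at 0)" using \<psi> by (simp add: DERIV_def)
      then have "(\<lambda>n. (\<phi> (0 + Y n) x - \<phi> 0 x) / Y n) \<longlonglongrightarrow> \<psi> x"
        unfolding tendsto_at_iff_sequentially o_def using Y(2) Yl by simp
      then show ?thesis using True by (simp add: q_def)
    qed (simp add: q_def)
    have "(\<lambda>n. integral\<^sup>L lborel (q n)) \<longlonglongrightarrow> (\<integral>x. indicator B x *\<^sub>R \<psi> x \<partial>lborel)"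
    proof (rule integral_dominated_convergence[where w = "\<lambda>x. indicator B x *\<^sub>R M"])
      show qm: "q n \<in> borel_measurable lborel" for n
        using si[of n] unfolding q_def set_integrable_def by (rule borel_measurable_integrable)
      \<comment> \<open>Measurability of the limit is inherited from the quotients converging to
        it.\<close>
      show "(\<lambda>x. indicator B x *\<^sub>R \<psi> x) \<in> borel_measurable lborel"
        by (rule borel_measurable_LIMSEQ_metric[OF qm lim])
      show "integrable lborel (\<lambda>x. indicator B x *\<^sub>R M)"
        using set_integrable_in_compact[OF continuous_on_const C B] by (simp add: set_integrable_def)
      show "AE x in lborel. (\<lambda>n. q n x) \<longlonglongrightarrow> indicator B x *\<^sub>R \<psi> x" using lim by simp
      show "AE x in lborel. norm (q n x) \<le> indicator B x *\<^sub>R M" for n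
        using quot[OF Y] B(1) by (auto simp: q_def indicator_def)
    qed
    then have "(\<lambda>n. (set_lebesgue_integral lborel B (\<phi> (0 + Y n)) - set_lebesgue_integral lborel B (\<phi> 0)) / Y n)
        \<longlonglongrightarrow> set_lebesgue_integral lborel B \<psi>"
      unfolding eq set_lebesgue_integral_def[of lborel B \<psi>] .
    then show "(\<lambda>n. (set_lebesgue_integral lborel B (\<phi> (0 + X n)) - set_lebesgue_integral lborel B (\<phi> 0)) / X n)
        \<longlonglongrightarrow> set_lebesgue_integral lborel B \<psi>"
      unfolding Y_def by (rule LIMSEQ_offset)
  qed
  then show ?thesis by (simp add: DERIV_def)
qed


section \<open>The Riemannian integral as a finite sum of coordinate integrals\<close>

lemma compact_UN_lessThan:
  fixes K :: "nat \<Rightarrow> 'a::topological_space set"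
  assumes "\<forall>i<n. compact (K i)" "i \<le> n"
  shows "compact (\<Union>j<i. K j)"
proof (rule compact_UN)
  show "compact (K j)" if "j \<in> {..<i}" for j
    using assms(1)[rule_format, of j] assms(2) that by simp
qed simp

lemma borel_piece:
  fixes A :: "('a::{t2_space,second_countable_topology}, 'n::finite) chart set"
  assumes "smooth_atlas A" "c \<in> A" "compact K" "K \<subseteq> fst c" "compact L"
  shows "snd c ` (K - L) \<in> sets borel" "snd c ` (K - L) \<subseteq> snd c ` K"
    "compact (snd c ` K)" "snd c ` K \<subseteq> snd c ` fst c"
proof -
  note C = is_chart_D[OF smooth_atlas_D(1)[OF assms(1,2)]]
  have comp: "compact (snd c ` K')" if "compact K'" "K' \<subseteq> fst c" for K'
    by (rule compact_continuous_image[OF continuous_on_subset[OF C(6) that(2)] that(1)])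
  have KL: "compact (K \<inter> L)" using assms(3,5) by (intro compact_Int)
  \<comment> \<open>L may leave the chart domain, where the coordinate map is meaningless, so it is
    first cut down to K; injectivity then makes the image a difference of compact sets.\<close>
  have "snd c ` (K - L) = snd c ` K - snd c ` (K \<inter> L)"
    using inj_on_image_set_diff[OF C(9), of K "K \<inter> L"] assms(4)
    by (simp add: Diff_Int subset_iff)
  moreover have "compact (snd c ` (K \<inter> L))" using comp[OF KL] assms(4) by blast
  ultimately show "snd c ` (K - L) \<in> sets borel"
    using comp[OF assms(3,4)] by (simp add: borel_closed compact_imp_closed sets.Diff)
  show "compact (snd c ` K)" by (rule comp[OF assms(3,4)])
qed (use assms(4) in blast)+

lemma Ck_on_volume:
  fixes A :: "('a::{t2_space,second_countable_topology}, 'n::finite) chart set"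
  assumes A: "smooth_atlas A" "c \<in> A" and g: "riemannian_metric A g"
  shows "Ck_on m (snd c ` fst c) (\<lambda>x. sqrt (det (gram (in_chart A c g x))))"
proof (intro Ck_on_sqrt Ck_on_det)
  show op: "open (snd c ` fst c)" by (rule is_chart_D(2)[OF smooth_atlas_D(1)[OF A]])
  then show "open (snd c ` fst c)" .
  show "Ck_on m (snd c ` fst c) (\<lambda>x. gram (in_chart A c g x) $ i $ j)" for i j
    using smooth_tensor_Ck[of A 2 g c] g A(2) by (simp add: gram_def riemannian_metric_def)
  show "0 < det (gram (in_chart A c g x))" if "x \<in> snd c ` fst c" for x
    by (rule det_gram_pos[OF inner_tensor_in_chart[where g=g, OF A that riemannian_metric_inner[OF g]]])
qed

lemma continuous_on_density:
  fixes A :: "('a::{t2_space,second_countable_topology}, 'n::finite) chart set"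
  assumes A: "smooth_atlas A" "c \<in> A" and g: "riemannian_metric A g" and f: "smooth_function A f"
  shows "continuous_on (snd c ` fst c) (\<lambda>x. f (chart_inv c x) * sqrt (det (gram (in_chart A c g x))))"
  using smooth_function_Ck[OF f A(2), of 0] Ck_on_volume[OF A g, of 0] by (simp add: continuous_on_mult)

text \<open>Linearity of the Bochner integral needs integrability on each piece, which continuity on
  a surrounding compact set provides.\<close>

lemma riem_integral_diff:
  fixes A :: "('a::{t2_space,second_countable_topology}, 'n::finite) chart set"
  assumes A: "smooth_atlas A" and comp: "compact (UNIV :: 'a set)"
    and g: "riemannian_metric A g" and f: "smooth_function A f" and h: "smooth_function A h"
  shows "riem_integral A g (\<lambda>p. f p - h p) = riem_integral A g f - riem_integral A g h"
proof -
  obtain n :: nat and c :: "nat \<Rightarrow> ('a, 'n) chart" and K where nc': "\<forall>i<n. c i \<in> A \<and> compact (K i) \<and> K i \<subseteq> fst (c i)"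
    and cover: "(\<Union>i<n. K i) = UNIV"
    and ri': "\<forall>g f. riem_integral A g f = (\<Sum>i<n. set_lebesgue_integral lborel (snd (c i) ` (K i - (\<Union>j<i. K j)))
      (\<lambda>x. f (chart_inv (c i) x) * sqrt (det (gram (in_chart A (c i) g x)))))"
    by (rule riem_integral_pieces[OF A comp])
  note nc = nc'[rule_format] and ri = ri'[rule_format]
  have int: "set_integrable lborel (snd (c i) ` (K i - (\<Union>j<i. K j)))
      (\<lambda>x. f (chart_inv (c i) x) * sqrt (det (gram (in_chart A (c i) g x))))" if "i < n" "smooth_function A f" for i f
  proof -
    have i: "c i \<in> A" "compact (K i)" "K i \<subseteq> fst (c i)" using nc[OF that(1)] by auto
    have "compact (\<Union>j<i. K j)" by (rule compact_UN_lessThan[OF _ less_imp_le[OF that(1)]]) (simp add: nc)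
    note P = borel_piece[OF A i this]
    show ?thesis
      by (rule set_integrable_in_compact[OF continuous_on_density[OF A i(1) g that(2)] P(3,4,2,1)])
  qed
  show ?thesis
    unfolding ri sum_subtractf[symmetric] left_diff_distrib
    by (intro sum.cong refl set_integral_diff(2) int f h) auto
qed

text \<open>The definiteness of \<open>L2_pairing\<close> rests on this. The volume density is
  positive, so f and the coordinate integrand share their sign and their zeros.\<close>

lemma riem_integral_eq_0:
  fixes A :: "('a::{t2_space,second_countable_topology}, 'n::finite) chart set"
  assumes A: "smooth_atlas A" and comp: "compact (UNIV :: 'a set)"
    and g: "riemannian_metric A g" and f: "smooth_function A f" and nn: "\<And>p. 0 \<le> f p"
    and 0: "riem_integral A g f = 0"
  shows "f p = 0"
proof -
  obtain n :: nat and c :: "nat \<Rightarrow> ('a, 'n) chart" and K where nc': "\<forall>i<n. c i \<in> A \<and> compact (K i) \<and> K i \<subseteq> fst (c i)"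
    and cover: "(\<Union>i<n. K i) = UNIV"
    and ri': "\<forall>g f. riem_integral A g f = (\<Sum>i<n. set_lebesgue_integral lborel (snd (c i) ` (K i - (\<Union>j<i. K j)))
      (\<lambda>x. f (chart_inv (c i) x) * sqrt (det (gram (in_chart A (c i) g x)))))"
    by (rule riem_integral_pieces[OF A comp])
  note nc = nc'[rule_format] and ri = ri'[rule_format]
  define B where "B = (\<lambda>i. snd (c i) ` (K i - (\<Union>j<i. K j)))"
  define \<phi> where "\<phi> = (\<lambda>i x. f (chart_inv (c i) x) * sqrt (det (gram (in_chart A (c i) g x))))"
  have compL: "compact (\<Union>j<i. K j)" if "i \<le> n" for i
    by (rule compact_UN_lessThan[OF _ that]) (simp add: nc)
  have i: "c i \<in> A" "compact (K i)" "K i \<subseteq> fst (c i)" if "i < n" for i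
    using nc[OF that] by blast+
  have P: "B i \<in> sets borel" "B i \<subseteq> snd (c i) ` K i" "compact (snd (c i) ` K i)" "snd (c i) ` K i \<subseteq> snd (c i) ` fst (c i)" if "i < n" for i
  proof -
    note bp = borel_piece[OF A i(1)[OF that] i(2)[OF that] i(3)[OF that] compL[OF less_imp_le[OF that]]]
    show "B i \<in> sets borel" "B i \<subseteq> snd (c i) ` K i" unfolding B_def by (fact bp(1), fact bp(2))
    show "compact (snd (c i) ` K i)" "snd (c i) ` K i \<subseteq> snd (c i) ` fst (c i)" by (fact bp(3), fact bp(4))
  qed
  have cont: "continuous_on (snd (c i) ` fst (c i)) (\<phi> i)" if "i < n" for i
    unfolding \<phi>_def by (rule continuous_on_density[OF A i(1)[OF that] g f])
  have int: "set_integrable lborel (B i) (\<phi> i)" if "i < n" for i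
    by (rule set_integrable_in_compact[OF cont[OF that] P(3,4,2,1)[OF that]])
  have dens: "sqrt (det (gram (in_chart A (c i) g x))) > 0" if "i < n" "x \<in> snd (c i) ` fst (c i)" for i x
    using det_gram_pos[OF inner_tensor_in_chart[where g=g, OF A i(1)[OF that(1)] that(2) riemannian_metric_inner[OF g]]]
    by simp
  have \<phi>nn: "0 \<le> \<phi> i x" if "i < n" "x \<in> B i" for i x
  proof -
    have "x \<in> snd (c i) ` fst (c i)" using P(2,4)[OF that(1)] that(2) by blast
    from dens[OF that(1) this] show ?thesis unfolding \<phi>_def by (intro mult_nonneg_nonneg nn) simp
  qed
  have zero: "set_lebesgue_integral lborel (B i) (\<phi> i) = 0" if "i < n" for i
  proof -
    have "set_lebesgue_integral lborel (B i) (\<phi> i) \<ge> 0" if "i < n" for i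
      unfolding set_lebesgue_integral_def
      by (rule integral_nonneg_AE) (use \<phi>nn[OF that] in \<open>auto simp: indicator_def\<close>)
    moreover have "(\<Sum>i<n. set_lebesgue_integral lborel (B i) (\<phi> i)) = 0"
      using 0 unfolding ri B_def \<phi>_def .
    ultimately show ?thesis using that sum_nonneg_eq_0_iff[of "{..<n}" "\<lambda>i. set_lebesgue_integral lborel (B i) (\<phi> i)"] by simp
  qed
  have vanish: "f q = 0" if "i < n" "open W" "q \<in> W" "W \<subseteq> K i - (\<Union>j<i. K j)" for i W q
  proof -
    note C = is_chart_D[OF smooth_atlas_D(1)[OF A i(1)[OF that(1)]]]
    have Wf: "W \<subseteq> fst (c i)" using that(4) i(3)[OF that(1)] by blast
    have q: "q \<in> fst (c i)" using Wf that(3) by blast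
    have "\<phi> i (snd (c i) q) = 0"
    proof (rule set_integral_eq_0_imp[OF cont[OF that(1)] int[OF that(1)] _ \<phi>nn[OF that(1)] zero[OF that(1)]])
      show "open (snd (c i) ` W)" by (rule C(8)[OF that(2) Wf])
      show "snd (c i) ` W \<subseteq> B i" unfolding B_def using that(4) by blast
      show "snd (c i) q \<in> snd (c i) ` W" using that(3) by blast
      show "B i \<subseteq> snd (c i) ` fst (c i)" using P(2,4)[OF that(1)] by blast
    qed auto
    moreover have "sqrt (det (gram (in_chart A (c i) g (snd (c i) q)))) > 0"
      by (rule dens[OF that(1)]) (use q in blast)
    ultimately show ?thesis by (simp add: \<phi>_def C(3)[OF q])
  qed
  \<comment> \<open>A piece may have no interior near a given point, so zeros of \<open>f\<close> are first found in every
    nonempty open set: if there were none, no piece could exhaust what its predecessors leave.\<close>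
  have meet: "\<exists>q\<in>W. f q = 0" if "open W" "W \<noteq> {}" for W
  proof (rule ccontr)
    assume neg: "\<not> (\<exists>q\<in>W. f q = 0)"
    have "W - (\<Union>j<i. K j) \<noteq> {}" if "i \<le> n" for i
      using that
    proof (induction i)
      case (Suc i)
      define V where "V = W - (\<Union>j<i. K j)"
      have "open V" unfolding V_def
        using \<open>open W\<close> compL[of i] Suc.prems by (intro open_Diff compact_imp_closed) auto
      moreover obtain q where "q \<in> V" using Suc by (auto simp: V_def)
      \<comment> \<open>Otherwise V would be a nonempty open part of piece i, where f
        vanishes.\<close>
      ultimately have "\<not> V \<subseteq> K i"
        using vanish[of i V q] Suc.prems neg by (auto simp: V_def)
      then show ?case by (auto simp: V_def lessThan_Suc)
    qed (use \<open>W \<noteq> {}\<close> in simp)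
    from this[of n] show False using cover by simp
  qed
  obtain d where d: "d \<in> A" "p \<in> fst d" using smooth_atlas_D(2)[OF A] by blast
  note D = is_chart_D[OF smooth_atlas_D(1)[OF A d(1)]]
  have "Ck_on 0 (snd d ` fst d) (\<lambda>x. f (chart_inv d x))" by (rule smooth_function_Ck[OF f d(1)])
  then have "continuous_on (fst d) (\<lambda>p. f (chart_inv d (snd d p)))"
    by (intro continuous_on_compose2[OF _ D(6)]) auto
  then have cf: "continuous_on (fst d) f" by (rule continuous_on_eq) (simp add: D(3))
  show ?thesis
  proof (rule ccontr)
    assume "f p \<noteq> 0"
    \<comment> \<open>By continuity f would be nonzero on a whole neighbourhood of p, contradicting
      that its zeros meet every nonempty open set.\<close>
    have "open (fst d \<inter> f -` (- {0}))" by (rule continuous_open_preimage[OF cf D(1)]) auto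
    moreover have "fst d \<inter> f -` (- {0}) \<noteq> {}" using \<open>f p \<noteq> 0\<close> d(2) by blast
    ultimately show False using meet by blast
  qed
qed

text \<open>Expressing the derivative as r times the volume density of \<open>g 0\<close> makes the
  sum of the coordinate derivatives a Riemannian integral again.\<close>

lemma has_derivative_riem_integral:
  fixes A :: "('a::{t2_space,second_countable_topology}, 'n::finite) chart set"
  assumes A: "smooth_atlas A" and comp: "compact (UNIV :: 'a set)"
    and \<epsilon>: "\<epsilon> > 0"
    and Ck: "\<And>c. c \<in> A \<Longrightarrow> Ck_on 1 ({-\<epsilon><..<\<epsilon>} \<times> snd c ` fst c)
      (\<lambda>z. f (fst z) (chart_inv c (snd z)) * sqrt (det (gram (in_chart A c (g (fst z)) (snd z)))))"
    and deriv: "\<And>c x. c \<in> A \<Longrightarrow> x \<in> snd c ` fst c \<Longrightarrow>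
      ((\<lambda>s. f s (chart_inv c x) * sqrt (det (gram (in_chart A c (g s) x)))) has_real_derivative
       r (chart_inv c x) * sqrt (det (gram (in_chart A c (g 0) x)))) (at 0)"
  shows "((\<lambda>s. riem_integral A (g s) (f s)) has_real_derivative riem_integral A (g 0) r) (at 0)"
proof -
  obtain n :: nat and c :: "nat \<Rightarrow> ('a, 'n) chart" and K where nc': "\<forall>i<n. c i \<in> A \<and> compact (K i) \<and> K i \<subseteq> fst (c i)"
    and cover: "(\<Union>i<n. K i) = UNIV"
    and ri': "\<forall>g f. riem_integral A g f = (\<Sum>i<n. set_lebesgue_integral lborel (snd (c i) ` (K i - (\<Union>j<i. K j)))
      (\<lambda>x. f (chart_inv (c i) x) * sqrt (det (gram (in_chart A (c i) g x)))))"
    by (rule riem_integral_pieces[OF A comp])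
  note nc = nc'[rule_format] and ri = ri'[rule_format]
  show ?thesis
    unfolding ri
  proof (rule DERIV_sum)
    fix i assume "i \<in> {..<n}"
    then have "i < n" by simp
    then have i: "c i \<in> A" "compact (K i)" "K i \<subseteq> fst (c i)" using nc by auto
    have "compact (\<Union>j<i. K j)" by (rule compact_UN_lessThan[OF _ less_imp_le[OF \<open>i < n\<close>]]) (simp add: nc)
    note P = borel_piece[OF A i this]
    show "((\<lambda>s. set_lebesgue_integral lborel (snd (c i) ` (K i - (\<Union>j<i. K j)))
        (\<lambda>x. f s (chart_inv (c i) x) * sqrt (det (gram (in_chart A (c i) (g s) x))))) has_real_derivative
      set_lebesgue_integral lborel (snd (c i) ` (K i - (\<Union>j<i. K j)))
        (\<lambda>x. r (chart_inv (c i) x) * sqrt (det (gram (in_chart A (c i) (g 0) x))))) (at 0)"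
      by (rule has_derivative_set_integral[OF \<epsilon> is_chart_D(2)[OF smooth_atlas_D(1)[OF A i(1)]] P(3,4,2,1)
            Ck[OF i(1)] deriv[OF i(1)]])
  qed
qed

section \<open>First variation of the functional\<close>

lemma smooth_tensor_add:
  fixes A :: "('a::{t2_space,second_countable_topology}, 'n::finite) chart set"
  assumes A: "smooth_atlas A" and S: "smooth_tensor A k S" and T: "smooth_tensor A k T"
  shows "smooth_tensor A k (\<lambda>p vs. S p vs + T p vs)"
  unfolding smooth_tensor_def smooth_on_real
proof (intro conjI allI ballI)
  show "multilinear k (\<lambda>vs. S p vs + T p vs)" for p
    by (intro multilinear_add smooth_tensor_multilinear[OF S] smooth_tensor_multilinear[OF T])
  fix c vs m assume c: "c \<in> A"
  have "Ck_on m (snd c ` fst c) (\<lambda>x. in_chart A c S x vs + in_chart A c T x vs)"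
    by (rule Ck_on_add[OF is_chart_D(2)[OF smooth_atlas_D(1)[OF A c]] smooth_tensor_Ck[OF S c] smooth_tensor_Ck[OF T c]])
  then show "Ck_on m (snd c ` fst c) (\<lambda>x. in_chart A c (\<lambda>p vs. S p vs + T p vs) x vs)"
    by (simp add: in_chart_def)
qed

lemma smooth_tensor_scale:
  fixes A :: "('a::{t2_space,second_countable_topology}, 'n::finite) chart set"
  assumes A: "smooth_atlas A" and f: "smooth_function A f" and T: "smooth_tensor A k T"
  shows "smooth_tensor A k (\<lambda>p vs. f p * T p vs)"
  unfolding smooth_tensor_def smooth_on_real
proof (intro conjI allI ballI)
  show "multilinear k (\<lambda>vs. f p * T p vs)" for p
    by (intro multilinear_scale smooth_tensor_multilinear[OF T])
  fix c vs m assume c: "c \<in> A"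
  have "Ck_on m (snd c ` fst c) (\<lambda>x. f (chart_inv c x) * in_chart A c T x vs)"
    by (rule Ck_on_mult[OF is_chart_D(2)[OF smooth_atlas_D(1)[OF A c]] smooth_function_Ck[OF f c] smooth_tensor_Ck[OF T c]])
  then show "Ck_on m (snd c ` fst c) (\<lambda>x. in_chart A c (\<lambda>p vs. f p * T p vs) x vs)"
    by (simp add: in_chart_def)
qed

lemma smooth_tensor_cmult:
  fixes A :: "('a::{t2_space,second_countable_topology}, 'n::finite) chart set"
  assumes A: "smooth_atlas A" and T: "smooth_tensor A k T"
  shows "smooth_tensor A k (\<lambda>p vs. r * T p vs)"
  by (rule smooth_tensor_scale[OF A smooth_function_const[OF A] T])

lemma smooth_form_add_cmult:
  fixes A :: "('a::{t2_space,second_countable_topology}, 'n::finite) chart set"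
  assumes A: "smooth_atlas A" and S: "smooth_form A k S" and T: "smooth_form A k T"
  shows "smooth_form A k (\<lambda>p vs. S p vs + r * T p vs)"
proof -
  have "smooth_tensor A k (\<lambda>p vs. S p vs + r * T p vs)"
    using S T by (intro smooth_tensor_add smooth_tensor_cmult A) (auto simp: smooth_form_def)
  moreover have "alternating (\<lambda>vs. S p vs + r * T p vs)" for p
    using S T by (simp add: smooth_form_def alternating_def)
  ultimately show ?thesis by (simp add: smooth_form_def)
qed

lemma smooth_form_cmult:
  fixes A :: "('a::{t2_space,second_countable_topology}, 'n::finite) chart set"
  assumes A: "smooth_atlas A" and T: "smooth_form A k T"
  shows "smooth_form A k (\<lambda>p vs. r * T p vs)"
proof -
  have "smooth_tensor A k (\<lambda>p vs. r * T p vs)"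
    using T by (intro smooth_tensor_cmult A) (auto simp: smooth_form_def)
  moreover have "alternating (\<lambda>vs. r * T p vs)" for p
    using T by (simp add: smooth_form_def alternating_def)
  ultimately show ?thesis by (simp add: smooth_form_def)
qed

text \<open>A common form for the three quadratic terms: m = 0, 1, 2 gives the tensor square,
  \<open>circ2\<close> and \<open>circ3\<close>, with factors 1, 1, 1/2. One variation formula then
  serves all three forms.\<close>

definition circ :: "'n::finite tensor \<Rightarrow> nat \<Rightarrow> 'n tensor \<Rightarrow> 'n tensor" where
  "circ g m \<alpha> = (\<lambda>vs. if length vs = 2
     then contract g m (\<lambda>ws. \<alpha> (vs ! 0 # ws)) (\<lambda>ws. \<alpha> (vs ! 1 # ws)) / fact m else 0)"

lemma circ_eqs:
  "tensor_square \<alpha> = circ g 0 \<alpha>" "circ2 g \<alpha> = circ g 1 \<alpha>" "circ3 g \<alpha> = circ g 2 \<alpha>"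
  by (simp_all add: circ_def tensor_square_def circ2_def circ3_def contract_0 fun_eq_iff)

lemma circ_pair: "circ g m \<alpha> [u, v] = contract g m (\<lambda>ws. \<alpha> (u # ws)) (\<lambda>ws. \<alpha> (v # ws)) / fact m"
  by (simp add: circ_def)

lemma circ_commute: "inner_tensor g \<Longrightarrow> circ g m \<alpha> [u, v] = circ g m \<alpha> [v, u]"
  by (simp add: circ_pair contract_commute[where \<alpha> = "\<lambda>ws. \<alpha> (u # ws)"])

lemma linear_contract_hd:
  assumes "multilinear (Suc m) \<alpha>"
  shows "linear (\<lambda>u. contract g m (\<lambda>ws. \<alpha> (u # ws)) \<beta>)" "linear (\<lambda>u. contract g m \<beta> (\<lambda>ws. \<alpha> (u # ws)))"
proof -
  note l = multilinear_linear_hd[OF assms]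
  have add: "(\<lambda>ws. \<alpha> ((u + v) # ws)) = (\<lambda>ws. \<alpha> (u # ws) + \<alpha> (v # ws))" for u v
    using linear_add[OF l] by blast
  have scale: "(\<lambda>ws. \<alpha> ((r *\<^sub>R u) # ws)) = (\<lambda>ws. r * \<alpha> (u # ws))" for r u
    using linear_scale[OF l] by auto
  show "linear (\<lambda>u. contract g m (\<lambda>ws. \<alpha> (u # ws)) \<beta>)"
    by (rule linearI) (simp_all add: add scale contract_add_left contract_scale_left)
  show "linear (\<lambda>u. contract g m \<beta> (\<lambda>ws. \<alpha> (u # ws)))"
    by (rule linearI) (simp_all add: add scale contract_add_right contract_scale_right)
qed

lemma multilinear_circ:
  assumes "multilinear (Suc m) \<alpha>"
  shows "multilinear 2 (circ g m \<alpha>)"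
  unfolding multilinear_def
proof (intro conjI allI impI)
  fix vs :: "(real ^ 'a) list" and i :: nat assume *: "length vs = 2" "i < 2"
  then obtain a b where vs: "vs = [a, b]" by (auto simp: length_Suc_conv numeral_2_eq_2)
  have div: "linear (\<lambda>v. f v / r)" if "linear f" for f :: "real ^ 'a \<Rightarrow> real" and r
    using that by (simp add: linear_iff add_divide_distrib)
  consider "i = 0" | "i = 1" using *(2) by linarith
  then show "linear (\<lambda>v. circ g m \<alpha> (vs[i := v]))"
    by cases (simp_all add: vs circ_pair div linear_contract_hd[OF assms])
qed (simp add: circ_def)

lemma circ_in_chart:
  fixes A :: "('a::{t2_space,second_countable_topology}, 'n::finite) chart set"
  assumes A: "smooth_atlas A" "c \<in> A" "x \<in> snd c ` fst c" and g: "inner_tensor (g (chart_inv c x))"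
    and \<alpha>: "multilinear (Suc m) (\<alpha> (chart_inv c x))"
  shows "in_chart A c (\<lambda>p. circ (g p) m (\<alpha> p)) x vs = circ (in_chart A c g x) m (in_chart A c \<alpha> x) vs"
proof (cases "length vs = 2")
  case True
  define L where "L = frame A c (chart_inv c x)"
  define p where "p = chart_inv c x"
  have L: "linear L" "bij L" unfolding L_def by (rule linear_bij_frame'[OF A])+
  have "contract (pull L (g p)) m (pull L (\<lambda>ws. \<alpha> p (u # ws))) (pull L (\<lambda>ws. \<alpha> p (v # ws))) =
      contract (g p) m (\<lambda>ws. \<alpha> p (u # ws)) (\<lambda>ws. \<alpha> p (v # ws))" for u v
    unfolding p_def by (rule contract_pull[OF g L multilinear_Cons[OF \<alpha>] multilinear_Cons[OF \<alpha>]])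
  then show ?thesis
    using True by (simp add: in_chart_eq_pull circ_def L_def p_def)
qed (simp add: in_chart_def circ_def)

lemma smooth_tensor_circ:
  fixes A :: "('a::{t2_space,second_countable_topology}, 'n::finite) chart set"
  assumes A: "smooth_atlas A" and g: "riemannian_metric A g" and \<alpha>: "smooth_tensor A (Suc m) \<alpha>"
  shows "smooth_tensor A 2 (\<lambda>p. circ (g p) m (\<alpha> p))"
  unfolding smooth_tensor_def smooth_on_real
proof (intro conjI allI ballI)
  show "multilinear 2 (circ (g p) m (\<alpha> p))" for p
    by (rule multilinear_circ[OF smooth_tensor_multilinear[OF \<alpha>]])
  fix c vs n assume c: "c \<in> A"
  have op: "open (snd c ` fst c)" by (rule is_chart_D(2)[OF smooth_atlas_D(1)[OF A c]])
  have "Ck_on n (snd c ` fst c) (\<lambda>x. circ (in_chart A c g x) m (in_chart A c \<alpha> x) vs)"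
  proof (cases "length vs = 2")
    case True
    have "Ck_on n (snd c ` fst c) (\<lambda>x. contract (in_chart A c g x) m
        (\<lambda>ws. in_chart A c \<alpha> x (vs ! 0 # ws)) (\<lambda>ws. in_chart A c \<alpha> x (vs ! 1 # ws)) / fact m)"
      by (rule Ck_on_divide[OF op Ck_on_contract_in_chart[OF A c g smooth_tensor_Ck[OF \<alpha> c] smooth_tensor_Ck[OF \<alpha> c]]
            Ck_on_const[OF op]]) simp
    then show ?thesis using True by (simp add: circ_def)
  next
    case False
    then show ?thesis using Ck_on_const[OF op, of n 0] by (simp add: circ_def)
  qed
  then show "Ck_on n (snd c ` fst c) (\<lambda>x. in_chart A c (\<lambda>p. circ (g p) m (\<alpha> p)) x vs)"
    by (rule Ck_on_cong[OF op, THEN iffD1, rotated])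
       (rule circ_in_chart[OF A c _ riemannian_metric_inner[OF g] smooth_tensor_multilinear[OF \<alpha>], symmetric])
qed

lemma smooth_function_form_inner:
  fixes A :: "('a::{t2_space,second_countable_topology}, 'n::finite) chart set"
  assumes A: "smooth_atlas A" and g: "riemannian_metric A g"
    and \<alpha>: "smooth_form A k \<alpha>" and \<beta>: "smooth_form A k \<beta>"
  shows "smooth_function A (\<lambda>p. form_inner (g p) k (\<alpha> p) (\<beta> p))"
proof -
  have "smooth_function A (\<lambda>p. 1 / fact k * contract (g p) k (\<alpha> p) (\<beta> p))"
    using \<alpha> \<beta> by (intro smooth_function_mult smooth_function_const smooth_function_contract A g) (simp_all add: smooth_form_def)
  then show ?thesis by (simp add: form_inner_def)
qed

section \<open>Densities of the functional and of the pairing\<close>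

definition energy_density :: "'a reduced \<Rightarrow> 'a \<Rightarrow> real" where
  "energy_density X p = 15 / 8 * (lam X p)\<^sup>2 + 5 / 18 * form_sq (met X p) 1 (lee X p) +
     1 / 4 * form_sq (met X p) 3 (tor X p) + 1 / 4 * form_sq (met X p) 2 (curv X p)"

definition pairing_density :: "('a, 6) tensor_field \<Rightarrow> 'a reduced \<Rightarrow> 'a reduced \<Rightarrow> 'a \<Rightarrow> real" where
  "pairing_density g V W p = contract (g p) 2 (met V p) (met W p) + form_inner (g p) 1 (lee V p) (lee W p) +
     lam V p * lam W p + form_inner (g p) 3 (tor V p) (tor W p) +
     form_inner (g p) 2 (curv V p) (curv W p)"

lemma L2_pairing_density: "L2_pairing A g V W = riem_integral A g (pairing_density g V W)"
  unfolding L2_pairing_def pairing_density_def ..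

lemma riem_integral_cmult: "riem_integral A g (\<lambda>p. r * f p) = r * riem_integral A g f"
  by (simp add: riem_integral_def Let_def sum_distrib_left mult.assoc)

lemma reduced_functional_density:
  "reduced_functional A X = riem_integral A (met X) (\<lambda>p. - 2 * pi * energy_density X p)"
  unfolding riem_integral_cmult by (simp add: reduced_functional_def energy_density_def)

text \<open>The coefficients 15/16, 5/36, 1/8, 1/8 are half of those in the energy density, so the
  multiple of the metric is -pi times that density.\<close>

lemma met_flow_rhs:
  "met (flow_rhs X) = (\<lambda>p vs. (- pi * energy_density X p) * met X p vs +
     (5 * pi / 9 * circ (met X p) 0 (lee X p) vs +
     (pi / 2 * circ (met X p) 2 (tor X p) vs + pi / 2 * circ (met X p) 1 (curv X p) vs)))"
proof (intro ext)
  fix p and vs :: "(real ^ 6) list"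
  show "met (flow_rhs X) p vs = (- pi * energy_density X p) * met X p vs +
     (5 * pi / 9 * circ (met X p) 0 (lee X p) vs +
     (pi / 2 * circ (met X p) 2 (tor X p) vs + pi / 2 * circ (met X p) 1 (curv X p) vs))"
    unfolding flow_rhs_def energy_density_def circ_eqs(1)[where g = "met X p"] circ_eqs(2,3)
    by (simp add: algebra_simps)
qed

lemma flow_rhs_simps:
  "lee (flow_rhs X) = (\<lambda>p vs. (- (10 * pi / 9)) * lee X p vs)" "lam (flow_rhs X) = (\<lambda>p. - (15 * pi / 2) * lam X p)"
  "tor (flow_rhs X) = (\<lambda>p vs. - pi * tor X p vs)" "curv (flow_rhs X) = (\<lambda>p vs. - pi * curv X p vs)"
  by (simp_all add: flow_rhs_def)

lemma formal_variations_D: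
  assumes "V \<in> formal_variations A"
  shows "smooth_tensor A 2 (met V)" "met V p [u, v] = met V p [v, u]" "smooth_form A 1 (lee V)"
    "smooth_function A (lam V)" "smooth_form A 3 (tor V)" "smooth_form A 2 (curv V)"
  using assms by (auto simp: formal_variations_def)

lemma reduced_data_D:
  assumes "X \<in> reduced_data A"
  shows "X \<in> formal_variations A" "riemannian_metric A (met X)" "inner_tensor (met X p)"
  using assms riemannian_metric_inner by (auto simp: reduced_data_def)

lemma smooth_formD: "smooth_form A k T \<Longrightarrow> smooth_tensor A k T" "smooth_form A k T \<Longrightarrow> alternating (T p)"
  "smooth_form A k T \<Longrightarrow> multilinear k (T p)"
  by (auto simp: smooth_form_def smooth_tensor_def)

lemma smooth_energy_density:
  assumes A: "smooth_atlas A" and X: "X \<in> reduced_data A"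
  shows "smooth_function A (energy_density X)"
proof -
  note V = formal_variations_D[OF reduced_data_D(1)[OF X]] and g = reduced_data_D(2)[OF X]
  have "smooth_function A (\<lambda>p. 15 / 8 * (lam X p * lam X p) + 5 / 18 * form_inner (met X p) 1 (lee X p) (lee X p) +
     1 / 4 * form_inner (met X p) 3 (tor X p) (tor X p) + 1 / 4 * form_inner (met X p) 2 (curv X p) (curv X p))"
    by (intro smooth_function_add smooth_function_mult smooth_function_const smooth_function_form_inner A g V)
  then show ?thesis by (simp add: energy_density_def[abs_def] form_sq_def power2_eq_square)
qed

lemma flow_rhs_formal:
  assumes A: "smooth_atlas A" and X: "X \<in> reduced_data A"
  shows "flow_rhs X \<in> formal_variations A"
proof -
  note V = formal_variations_D[OF reduced_data_D(1)[OF X]] and g = reduced_data_D(2)[OF X]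
  have "smooth_tensor A 2 (met (flow_rhs X))"
    unfolding met_flow_rhs
    by (intro smooth_tensor_add smooth_tensor_cmult smooth_tensor_scale smooth_tensor_circ smooth_function_mult
        smooth_function_const smooth_energy_density A X V g)
      (use V smooth_formD(1) in \<open>auto simp: numeral_2_eq_2 numeral_3_eq_3\<close>)
  moreover have "met (flow_rhs X) p [u, v] = met (flow_rhs X) p [v, u]" for p u v
    unfolding met_flow_rhs circ_commute[OF reduced_data_D(3)[OF X], of _ _ _ u v] V(2)[of p u v] ..
  ultimately show ?thesis
    unfolding formal_variations_def mem_Collect_eq
    unfolding flow_rhs_simps
    by (intro conjI smooth_form_cmult smooth_function_mult smooth_function_const A V TrueI allI refl)
qed


lemma smooth_family_Ck:
  assumes "smooth_family A \<epsilon> Y" "c \<in> A"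
  defines "D \<equiv> {-\<epsilon><..<\<epsilon>} \<times> snd c ` fst c"
  shows "Ck_on m D (\<lambda>z. lam (Y (fst z)) (chart_inv c (snd z)))"
    "Ck_on m D (\<lambda>z. in_chart A c (met (Y (fst z))) (snd z) vs)"
    "Ck_on m D (\<lambda>z. in_chart A c (lee (Y (fst z))) (snd z) vs)"
    "Ck_on m D (\<lambda>z. in_chart A c (tor (Y (fst z))) (snd z) vs)"
    "Ck_on m D (\<lambda>z. in_chart A c (curv (Y (fst z))) (snd z) vs)"
  using assms unfolding smooth_family_def Let_def smooth_on_real case_prod_beta by simp_all

lemma form_sq_in_chart:
  fixes A :: "('a::{t2_space,second_countable_topology}, 'n::finite) chart set"
  assumes "smooth_atlas A" "c \<in> A" "x \<in> snd c ` fst c" "inner_tensor (g (chart_inv c x))" "smooth_form A k \<alpha>"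
  shows "form_sq (in_chart A c g x) k (in_chart A c \<alpha> x) = form_sq (g (chart_inv c x)) k (\<alpha> (chart_inv c x))"
  unfolding form_sq_def form_inner_def
  using contract_in_chart[OF assms(1-3), where g=g and \<alpha>=\<alpha> and \<beta>=\<alpha>] assms(4) smooth_formD(3)[OF assms(5)] by simp

text \<open>A smooth family is jointly smooth in parameter and position only through its chart
  components, so the density is first rewritten in these and transferred back pointwise.\<close>

lemma Ck_on_family_density:
  assumes A: "smooth_atlas A" and Y: "smooth_family A \<epsilon> Y" and c: "c \<in> A"
  shows "Ck_on m ({-\<epsilon><..<\<epsilon>} \<times> snd c ` fst c) (\<lambda>z. (- 2 * pi * energy_density (Y (fst z)) (chart_inv c (snd z))) *
      sqrt (det (gram (in_chart A c (met (Y (fst z))) (snd z)))))"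
proof -
  define D where "D = {-\<epsilon><..<\<epsilon>} \<times> snd c ` fst c"
  define g where "g = (\<lambda>z. in_chart A c (met (Y (fst z))) (snd z))"
  define \<theta> where "\<theta> = (\<lambda>z. in_chart A c (lee (Y (fst z))) (snd z))"
  define \<nu> where "\<nu> = (\<lambda>z. in_chart A c (tor (Y (fst z))) (snd z))"
  define F where "F = (\<lambda>z. in_chart A c (curv (Y (fst z))) (snd z))"
  define l where "l = (\<lambda>z. lam (Y (fst z)) (chart_inv c (snd z)))"
  have Ck: "Ck_on m D l" "Ck_on m D (\<lambda>z. g z vs)" "Ck_on m D (\<lambda>z. \<theta> z vs)" "Ck_on m D (\<lambda>z. \<nu> z vs)"
    "Ck_on m D (\<lambda>z. F z vs)" for vs
    unfolding D_def g_def \<theta>_def \<nu>_def F_def l_def by (rule smooth_family_Ck[OF Y c])+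
  have op: "open D" unfolding D_def by (intro open_Times is_chart_D(2)[OF smooth_atlas_D(1)[OF A c]]) simp
  have Yr: "Y (fst z) \<in> reduced_data A" "snd z \<in> snd c ` fst c" if "z \<in> D" for z
    using Y that by (auto simp: D_def smooth_family_def)
  have g: "inner_tensor (g z)" if "z \<in> D" for z
    unfolding g_def by (rule inner_tensor_in_chart[OF A c Yr(2)[OF that]]) (rule reduced_data_D(3)[OF Yr(1)[OF that]])
  have gr: "Ck_on m D (\<lambda>z. gram (g z) $ i $ j)" for i j
    using Ck(2) by (simp add: gram_def)
  have fs: "Ck_on m D (\<lambda>z. form_sq (g z) k (\<alpha> z))" if "\<And>vs. Ck_on m D (\<lambda>z. \<alpha> z vs)" for k \<alpha>
    unfolding form_sq_def form_inner_def
    by (rule Ck_on_divide[OF op Ck_on_contract[OF op gr _ that that] Ck_on_const[OF op]])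
       (use det_gram_pos[OF g] in \<open>auto simp: less_imp_neq[symmetric]\<close>)
  have "Ck_on m D (\<lambda>z. (- 2 * pi * (15 / 8 * (l z * l z) + 5 / 18 * form_sq (g z) 1 (\<theta> z) +
     1 / 4 * form_sq (g z) 3 (\<nu> z) + 1 / 4 * form_sq (g z) 2 (F z))) * sqrt (det (gram (g z))))"
    by (intro Ck_on_mult[OF op] Ck_on_add[OF op] Ck_on_const[OF op] Ck_on_sqrt[OF op] Ck_on_det[OF op] fs Ck gr det_gram_pos g)
  then show ?thesis unfolding D_def[symmetric]
  proof (rule Ck_on_cong[OF op, THEN iffD1, rotated])
    fix z assume z: "z \<in> D"
    note V = formal_variations_D[OF reduced_data_D(1)[OF Yr(1)[OF z]]]
    have "form_sq (g z) k (in_chart A c \<alpha> (snd z)) = form_sq (met (Y (fst z)) (chart_inv c (snd z))) k (\<alpha> (chart_inv c (snd z)))"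
      if "smooth_form A k \<alpha>" for k \<alpha>
      unfolding g_def by (rule form_sq_in_chart[OF A c Yr(2)[OF z] reduced_data_D(3)[OF Yr(1)[OF z]] that])
    then show "(- 2 * pi * (15 / 8 * (l z * l z) + 5 / 18 * form_sq (g z) 1 (\<theta> z) +
        1 / 4 * form_sq (g z) 3 (\<nu> z) + 1 / 4 * form_sq (g z) 2 (F z))) * sqrt (det (gram (g z))) =
      (- 2 * pi * energy_density (Y (fst z)) (chart_inv c (snd z))) * sqrt (det (gram (in_chart A c (met (Y (fst z))) (snd z))))"
      unfolding energy_density_def \<theta>_def \<nu>_def F_def l_def power2_eq_square
      using V by (simp add: g_def)
  qed
qed

text \<open>The origin of all constants. The right side is the variation of -2 pi times the density,
  with half the trace of the metric variation coming from the volume. Differentiating the squares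
  doubles 15/8, 5/18 and 1/4; times -2 pi this gives the rates -15 pi/2, -10 pi/9 and -pi.\<close>

lemma pairing_flow_rhs:
  assumes g: "inner_tensor (met X p)"
  shows "pairing_density (met X) (flow_rhs X) V p =
    - 2 * pi * (energy_density X p * (contract (met X p) 2 (met X p) (met V p) / 2) +
      (15 / 8 * (2 * lam X p * lam V p) +
       5 / 18 * (2 * form_inner (met X p) 1 (lee X p) (lee V p) - contract (met X p) 2 (circ (met X p) 0 (lee X p)) (met V p)) +
       1 / 4 * (2 * form_inner (met X p) 3 (tor X p) (tor V p) - contract (met X p) 2 (circ (met X p) 2 (tor X p)) (met V p)) +
       1 / 4 * (2 * form_inner (met X p) 2 (curv X p) (curv V p) - contract (met X p) 2 (circ (met X p) 1 (curv X p)) (met V p))))"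
  unfolding pairing_density_def met_flow_rhs flow_rhs_simps form_inner_def contract_add_left contract_scale_left
  by (simp add: field_simps)

text \<open>Velocities are pointwise and the model tangent space at p is fixed, so this computation
  stays in that space and needs no chart.\<close>

lemma has_derivative_energy:
  assumes X: "X \<in> reduced_data A" "Y 0 = X" and vel: "has_velocity Y V 0 UNIV"
  shows "((\<lambda>s. energy_density (Y s) p) has_real_derivative
      (15 / 8 * (2 * lam X p * lam V p) +
       5 / 18 * (2 * form_inner (met X p) 1 (lee X p) (lee V p) - contract (met X p) 2 (circ (met X p) 0 (lee X p)) (met V p)) +
       1 / 4 * (2 * form_inner (met X p) 3 (tor X p) (tor V p) - contract (met X p) 2 (circ (met X p) 2 (tor X p)) (met V p)) +
       1 / 4 * (2 * form_inner (met X p) 2 (curv X p) (curv V p) - contract (met X p) 2 (circ (met X p) 1 (curv X p)) (met V p)))) (at 0)"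
proof -
  note F = formal_variations_D[OF reduced_data_D(1)[OF X(1)]]
  note vel' = vel[unfolded has_velocity_def, rule_format, of p]
  have g: "inner_tensor (met (Y 0) p)" using reduced_data_D(3)[OF X(1)] X(2) by simp
  \<comment> \<open>Here \<alpha> stands for one of the selectors \<open>lee\<close>,
    \<open>tor\<close>, \<open>curv\<close>, and \<open>Suc m\<close> for the degree of that
    form.\<close>
  have form: "((\<lambda>s. form_sq (met (Y s) p) (Suc m) (\<alpha> (Y s) p)) has_real_derivative
     2 * form_inner (met X p) (Suc m) (\<alpha> X p) (\<alpha> V p) - contract (met X p) 2 (circ (met X p) m (\<alpha> X p)) (met V p)) (at 0)"
    if "smooth_form A (Suc m) (\<alpha> X)" "\<And>vs. ((\<lambda>s. \<alpha> (Y s) p vs) has_real_derivative \<alpha> V p vs) (at 0)" for m \<alpha>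
    using has_derivative_form_sq[where g="\<lambda>s. met (Y s) p" and t=0 and k="met V p" and \<alpha>="\<lambda>s. \<alpha> (Y s) p" and m=m
        and \<beta>="\<alpha> V p" and T="circ (met X p) m (\<alpha> X p)", OF g] vel' that smooth_formD(2,3)[OF that(1), of p]
    by (simp add: X(2) circ_pair)
  have "((\<lambda>s. lam (Y s) p) has_real_derivative lam V p) (at 0)" using vel' by simp
  from DERIV_power[OF this, of 2] have l: "((\<lambda>s. (lam (Y s) p)\<^sup>2) has_real_derivative 2 * lam X p * lam V p) (at 0)"
    by (simp add: X(2) mult_ac)
  have f1: "((\<lambda>s. form_sq (met (Y s) p) 1 (lee (Y s) p)) has_real_derivative
     2 * form_inner (met X p) 1 (lee X p) (lee V p) - contract (met X p) 2 (circ (met X p) 0 (lee X p)) (met V p)) (at 0)"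
    using form[of 0 lee] F(3) vel' by simp
  have f2: "((\<lambda>s. form_sq (met (Y s) p) 3 (tor (Y s) p)) has_real_derivative
     2 * form_inner (met X p) 3 (tor X p) (tor V p) - contract (met X p) 2 (circ (met X p) 2 (tor X p)) (met V p)) (at 0)"
    using form[of 2 tor] F(5) vel' by (simp add: eval_nat_numeral)
  have f3: "((\<lambda>s. form_sq (met (Y s) p) 2 (curv (Y s) p)) has_real_derivative
     2 * form_inner (met X p) 2 (curv X p) (curv V p) - contract (met X p) 2 (circ (met X p) 1 (curv X p)) (met V p)) (at 0)"
    using form[of 1 curv] F(6) vel' by (simp add: eval_nat_numeral)
  show ?thesis
    unfolding energy_density_def
    by (intro DERIV_add DERIV_cmult l f1 f2 f3)
qed


text \<open>The volume density is differentiated in the chart and the energy at the point; the trace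
  in the former is moved to the point, so that the two combine.\<close>

lemma has_derivative_energy_volume:
  assumes A: "smooth_atlas A" and c: "c \<in> A" "x \<in> snd c ` fst c"
    and X: "X \<in> reduced_data A" "Y 0 = X" and V: "V \<in> formal_variations A" and vel: "has_velocity Y V 0 UNIV"
  defines "p \<equiv> chart_inv c x"
  shows "((\<lambda>s. (- 2 * pi * energy_density (Y s) p) * sqrt (det (gram (in_chart A c (met (Y s)) x)))) has_real_derivative
      pairing_density (met X) (flow_rhs X) V p * sqrt (det (gram (in_chart A c (met X) x)))) (at 0)"
proof -
  note g = reduced_data_D(3)[OF X(1), of p]
  note F = formal_variations_D[OF reduced_data_D(1)[OF X(1)]]
  have g': "((\<lambda>s. in_chart A c (met (Y s)) x vs) has_real_derivative in_chart A c (met V) x vs) (at 0)" for vs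
    using vel by (simp add: has_velocity_def in_chart_def)
  have "inner_tensor (in_chart A c (met (Y 0)) x)"
    unfolding X(2) by (rule inner_tensor_in_chart[OF A c]) (rule g[unfolded p_def])
  from has_derivative_volume[where g="\<lambda>s. in_chart A c (met (Y s)) x" and k="in_chart A c (met V) x" and t=0, OF this g']
  have v: "((\<lambda>s. sqrt (det (gram (in_chart A c (met (Y s)) x)))) has_real_derivative
    sqrt (det (gram (in_chart A c (met X) x))) * (contract (met X p) 2 (met X p) (met V p) / 2)) (at 0)"
    using contract_in_chart[OF A c, where g="met X" and \<alpha>="met X" and \<beta>="met V" and k=2] g
      smooth_tensor_multilinear[OF F(1), of p] smooth_tensor_multilinear[OF formal_variations_D(1)[OF V], of p]
    by (simp add: X(2) p_def)
  show ?thesis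
    by (rule DERIV_cong[OF DERIV_mult[OF DERIV_cmult[OF has_derivative_energy[where p=p, OF X vel]] v]])
       (simp add: pairing_flow_rhs[OF g] X(2) algebra_simps)
qed

text \<open>Kept general in the test class, so that it serves both the admissible variations and all
  formal ones.\<close>

lemma formal_gradient_flow_rhs:
  fixes A :: "('a::{t2_space,second_countable_topology}, 6) chart set"
  assumes A: "smooth_atlas A" and comp: "compact (UNIV :: 'a set)"
    and X: "X \<in> reduced_data A" and \<V>: "\<V> \<subseteq> formal_variations A"
  shows "formal_gradient A \<V> X (flow_rhs X)"
  unfolding formal_gradient_def
proof (intro conjI ballI allI impI)
  show "flow_rhs X \<in> formal_variations A" by (rule flow_rhs_formal[OF A X])
  fix V \<epsilon> Y
  assume V: "V \<in> \<V>" and \<epsilon>: "\<epsilon> > 0" and Y: "smooth_family A \<epsilon> Y" and Y0: "Y 0 = X" and vel: "has_velocity Y V 0 UNIV"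
  have V': "V \<in> formal_variations A" using V \<V> by blast
  have "((\<lambda>s. riem_integral A (met (Y s)) (\<lambda>p. - 2 * pi * energy_density (Y s) p)) has_real_derivative
      riem_integral A (met (Y 0)) (pairing_density (met X) (flow_rhs X) V)) (at 0)"
  proof (rule has_derivative_riem_integral[OF A comp \<epsilon>, where f="\<lambda>s p. - 2 * pi * energy_density (Y s) p" and g="\<lambda>s. met (Y s)"])
    show "Ck_on 1 ({-\<epsilon><..<\<epsilon>} \<times> snd c ` fst c) (\<lambda>z. - 2 * pi * energy_density (Y (fst z)) (chart_inv c (snd z)) *
        sqrt (det (gram (in_chart A c (met (Y (fst z))) (snd z)))))" if "c \<in> A" for c
      by (rule Ck_on_family_density[OF A Y that])
    show "((\<lambda>s. - 2 * pi * energy_density (Y s) (chart_inv c x) * sqrt (det (gram (in_chart A c (met (Y s)) x)))) has_real_derivative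
        pairing_density (met X) (flow_rhs X) V (chart_inv c x) * sqrt (det (gram (in_chart A c (met (Y 0)) x)))) (at 0)"
      if "c \<in> A" "x \<in> snd c ` fst c" for c x
      unfolding Y0 by (rule has_derivative_energy_volume[where Y=Y, OF A that X Y0 V' vel])
  qed
  then show "((\<lambda>s. reduced_functional A (Y s)) has_real_derivative L2_pairing A (met X) (flow_rhs X) V) (at 0)"
    unfolding reduced_functional_density L2_pairing_density Y0 .
qed

section \<open>Straight lines of reduced data\<close>

definition perturb :: "'a reduced \<Rightarrow> real \<Rightarrow> 'a reduced \<Rightarrow> 'a reduced" where
  "perturb X s V = \<lparr>met = (\<lambda>p vs. met X p vs + s * met V p vs), lee = (\<lambda>p vs. lee X p vs + s * lee V p vs),
     lam = (\<lambda>p. lam X p + s * lam V p), tor = (\<lambda>p vs. tor X p vs + s * tor V p vs),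
     curv = (\<lambda>p vs. curv X p vs + s * curv V p vs)\<rparr>"

lemma perturb_sel [simp]:
  "met (perturb X s V) = (\<lambda>p vs. met X p vs + s * met V p vs)" "lee (perturb X s V) = (\<lambda>p vs. lee X p vs + s * lee V p vs)"
  "lam (perturb X s V) = (\<lambda>p. lam X p + s * lam V p)" "tor (perturb X s V) = (\<lambda>p vs. tor X p vs + s * tor V p vs)"
  "curv (perturb X s V) = (\<lambda>p vs. curv X p vs + s * curv V p vs)"
  by (simp_all add: perturb_def)

lemma perturb_formal:
  assumes A: "smooth_atlas A" and X: "X \<in> formal_variations A" and V: "V \<in> formal_variations A"
  shows "perturb X s V \<in> formal_variations A"
  unfolding formal_variations_def mem_Collect_eq perturb_sel
proof (intro conjI allI)
  note X = formal_variations_D[OF X] and V = formal_variations_D[OF V]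
  show "smooth_tensor A 2 (\<lambda>p vs. met X p vs + s * met V p vs)"
    by (intro smooth_tensor_add smooth_tensor_cmult A X V)
  show "met X p [u, v] + s * met V p [u, v] = met X p [v, u] + s * met V p [v, u]" for p u v
    using X(2)[of p u v] V(2)[of p u v] by simp
  show "smooth_function A (\<lambda>p. lam X p + s * lam V p)"
    by (intro smooth_function_add smooth_function_mult smooth_function_const A X V)
qed (intro smooth_form_add_cmult A formal_variations_D[OF X] formal_variations_D[OF V])+


text \<open>Over a compact set of base points the unit sphere bundle is compact, so the metric has a
  positive minimum m there and the perturbation is bounded by some M. Positivity then holds for |s|
  < m / M and extends to all nonzero vectors by homogeneity.\<close>

lemma positive_near_compact:
  fixes A :: "('a::{t2_space,second_countable_topology}, 'n::finite) chart set"
  assumes A: "smooth_atlas A" and g: "riemannian_metric A g" and k: "smooth_tensor A 2 k"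
    and c: "c \<in> A" and K: "compact K" "K \<subseteq> fst c"
  shows "eventually (\<lambda>s. \<forall>p\<in>K. \<forall>v. v \<noteq> 0 \<longrightarrow> g p [v, v] + s * k p [v, v] > 0) (nhds 0)"
proof -
  note C = is_chart_D[OF smooth_atlas_D(1)[OF A c]]
  define S where "S = snd c ` K \<times> sphere (0 :: real ^ 'n) 1"
  define G where "G = (\<lambda>z :: (real ^ 'n) \<times> (real ^ 'n). in_chart A c g (fst z) [snd z, snd z])"
  define H where "H = (\<lambda>z :: (real ^ 'n) \<times> (real ^ 'n). in_chart A c k (fst z) [snd z, snd z])"
  have comp: "compact S"
    unfolding S_def by (intro compact_Times compact_continuous_image[OF continuous_on_subset[OF C(6) K(2)] K(1)] compact_sphere)
  have cont: "continuous_on S (\<lambda>z. in_chart A c T (fst z) [snd z, snd z])" if T: "smooth_tensor A 2 T" for T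
  proof -
    \<comment> \<open>Smoothness of a tensor is known for fixed vectors only; expansion in the basis
      gives continuity jointly in point and vector.\<close>
    have eq: "(\<Sum>i\<in>UNIV. \<Sum>j\<in>UNIV. snd z $ i * (in_chart A c T (fst z) [e_vec i, e_vec j] * snd z $ j)) =
        in_chart A c T (fst z) [snd z, snd z]" if "z \<in> S" for z
    proof -
      have "fst z \<in> snd c ` fst c" using that K(2) by (auto simp: S_def)
      from gram_eq[OF multilinear_in_chart[OF A c this smooth_tensor_multilinear[OF T]], where u = "snd z" and v = "snd z"]
      show ?thesis by (simp add: inner_vec_def matrix_vector_mult_def gram_def sum_distrib_left)
    qed
    have "continuous_on (snd c ` fst c) (\<lambda>x. in_chart A c T x [e_vec i, e_vec j])" for i j
      using smooth_tensor_Ck[OF T c, of 0] by simp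
    then have "continuous_on S (\<lambda>z. in_chart A c T (fst z) [e_vec i, e_vec j])" for i j
      by (rule continuous_on_compose2) (use K(2) in \<open>auto simp: S_def intro!: continuous_intros\<close>)
    then have "continuous_on S (\<lambda>z. \<Sum>i\<in>UNIV. \<Sum>j\<in>UNIV. snd z $ i * (in_chart A c T (fst z) [e_vec i, e_vec j] * snd z $ j))"
      by (intro continuous_intros)
    then show ?thesis by (rule continuous_on_eq) (rule eq)
  qed
  have cG: "continuous_on S G" unfolding G_def using g by (intro cont) (simp add: riemannian_metric_def)
  have cH: "continuous_on S H" unfolding H_def by (rule cont[OF k])
  have Gpos: "G z > 0" if "z \<in> S" for z
  proof -
    have "fst z \<in> snd c ` fst c" "snd z \<noteq> 0" using that K(2) by (auto simp: S_def)
    with inner_tensor_in_chart[where g=g, OF A c this(1) riemannian_metric_inner[OF g]]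
    show ?thesis by (simp add: G_def inner_tensor_def)
  qed
  \<comment> \<open>An empty compact set has no minimum, and there any positive m will do.\<close>
  obtain m where m: "m > 0" "\<And>z. z \<in> S \<Longrightarrow> G z \<ge> m"
  proof (cases "S = {}")
    case True
    then show ?thesis using that[of 1] by simp
  next
    case False
    then obtain z where "z \<in> S" "\<forall>y\<in>S. G z \<le> G y"
      using continuous_attains_inf[OF comp _ cG] by blast
    then show ?thesis using that[of "G z"] Gpos by blast
  qed
  have "bounded (H ` S)" by (rule compact_imp_bounded[OF compact_continuous_image[OF cH comp]])
  then obtain M where M: "M > 0" "\<And>z. z \<in> S \<Longrightarrow> \<bar>H z\<bar> \<le> M"
    unfolding bounded_pos real_norm_def by blast
  have "g p [v, v] + s * k p [v, v] > 0" if s: "dist s 0 < m / M" and p: "p \<in> K" and v: "v \<noteq> 0" for s p v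
  proof -
    define x where "x = snd c p"
    have pf: "p \<in> fst c" using p K(2) by blast
    have xp: "chart_inv c x = p" "x \<in> snd c ` fst c" using C(3)[OF pf] pf by (auto simp: x_def)
    note L = linear_bij_frame[OF A c pf]
    obtain w where w: "v = frame A c p w" using L(2) by (meson bij_pointE)
    then have w0: "w \<noteq> 0" using v linear_0[OF L(1)] by auto
    \<comment> \<open>Every nonzero tangent vector is a positive multiple of the frame image of a
      unit coordinate vector, so the estimate on S suffices.\<close>
    define u where "u = (1 / norm w) *\<^sub>R w"
    have wu: "w = norm w *\<^sub>R u" using w0 by (simp add: u_def)
    have z: "(x, u) \<in> S" using p w0 by (simp add: S_def x_def u_def)
    have hom: "T p [v, v] = (norm w)\<^sup>2 * in_chart A c T x [u, u]" if T: "multilinear 2 (T p)" for T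
    proof -
      have v: "v = norm w *\<^sub>R frame A c p u" by (subst w, subst wu) (rule linear_scale[OF L(1)])
      show ?thesis
        unfolding in_chart_def xp(1) list.map
        by (subst v)+ (simp add: linear_scale[OF bilinear_2(1)[OF T]] linear_scale[OF bilinear_2(2)[OF T]] power2_eq_square)
    qed
    have "\<bar>s * H (x, u)\<bar> < m"
    proof -
      have "\<bar>s * H (x, u)\<bar> \<le> \<bar>s\<bar> * M" using M(2)[OF z] by (simp add: abs_mult mult_left_mono)
      also have "\<dots> < m" using s M(1) by (simp add: pos_less_divide_eq)
      finally show ?thesis .
    qed
    then have "G (x, u) + s * H (x, u) > 0" using m(2)[OF z] by linarith
    then have "(norm w)\<^sup>2 * (G (x, u) + s * H (x, u)) > 0" using w0 by simp
    moreover have "multilinear 2 (g p)" using riemannian_metric_inner[OF g] by (simp add: inner_tensor_def)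
    ultimately show ?thesis
      using hom[of g] hom[of k] smooth_tensor_multilinear[OF k, of p] by (simp add: G_def H_def algebra_simps)
  qed
  then show ?thesis
    unfolding eventually_nhds_metric using m(1) M(1) by (intro exI[of _ "m / M"]) simp
qed

lemma perturb_reduced_data:
  fixes A :: "('a::{t2_space,second_countable_topology}, 6) chart set"
  assumes A: "smooth_atlas A" and comp: "compact (UNIV :: 'a set)"
    and X: "X \<in> reduced_data A" and V: "V \<in> formal_variations A"
  shows "\<exists>\<epsilon>>0. \<forall>s\<in>{-\<epsilon><..<\<epsilon>}. perturb X s V \<in> reduced_data A"
proof -
  obtain cs where cs: "\<forall>(c, K)\<in>set cs. c \<in> A \<and> compact K \<and> K \<subseteq> fst c" "(\<Union>(c, K)\<in>set cs. K) = (UNIV :: 'a set)"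
    using ex_compact_cover[OF A comp] by (elim exE conjE)
  have "\<forall>z\<in>set cs. eventually (\<lambda>s. \<forall>p\<in>snd z. \<forall>v. v \<noteq> 0 \<longrightarrow> met X p [v, v] + s * met V p [v, v] > 0) (nhds 0)"
  proof
    fix z assume z: "z \<in> set cs"
    show "eventually (\<lambda>s. \<forall>p\<in>snd z. \<forall>v. v \<noteq> 0 \<longrightarrow> met X p [v, v] + s * met V p [v, v] > 0) (nhds 0)"
    proof (rule positive_near_compact[OF A reduced_data_D(2)[OF X] formal_variations_D(1)[OF V]])
      show "fst z \<in> A" "compact (snd z)" "snd z \<subseteq> fst (fst z)"
        using bspec[OF cs(1) z] by (simp_all add: case_prod_beta)
    qed
  qed
  then have "eventually (\<lambda>s. \<forall>z\<in>set cs. \<forall>p\<in>snd z. \<forall>v. v \<noteq> 0 \<longrightarrow> met X p [v, v] + s * met V p [v, v] > 0) (nhds 0)"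
    by (rule eventually_ball_finite[OF finite_set])
  then obtain \<epsilon> where \<epsilon>: "\<epsilon> > 0"
    "\<forall>s. dist s 0 < \<epsilon> \<longrightarrow> (\<forall>z\<in>set cs. \<forall>p\<in>snd z. \<forall>v. v \<noteq> 0 \<longrightarrow> met X p [v, v] + s * met V p [v, v] > 0)"
    unfolding eventually_nhds_metric by (elim exE conjE)
  have "perturb X s V \<in> reduced_data A" if s: "s \<in> {-\<epsilon><..<\<epsilon>}" for s
  proof -
    note P = perturb_formal[OF A reduced_data_D(1)[OF X] V, of s]
    have "met X p [v, v] + s * met V p [v, v] > 0" if "v \<noteq> 0" for p v
    proof -
      have "p \<in> (\<Union>(c, K)\<in>set cs. K)" unfolding cs(2) by (rule UNIV_I)
      then obtain z where "z \<in> set cs" "p \<in> (case z of (c, K) \<Rightarrow> K)" by (rule UN_E)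
      then have "z \<in> set cs" "p \<in> snd z" by (simp_all add: case_prod_beta)
      then show ?thesis using \<epsilon>(2)[rule_format, of s z p v] s that by (simp add: dist_real_def abs_less_iff)
    qed
    then show ?thesis
      using P formal_variations_D(1,2)[OF P] by (simp add: reduced_data_def riemannian_metric_def)
  qed
  then show ?thesis using \<epsilon>(1) by blast
qed

lemma smooth_family_perturb:
  fixes A :: "('a::{t2_space,second_countable_topology}, 6) chart set"
  assumes A: "smooth_atlas A" and comp: "compact (UNIV :: 'a set)"
    and X: "X \<in> reduced_data A" and V: "V \<in> formal_variations A"
  shows "\<exists>\<epsilon>>0. smooth_family A \<epsilon> (\<lambda>s. perturb X s V)"
proof -
  obtain \<epsilon> where \<epsilon>: "\<epsilon> > 0" "\<forall>s\<in>{-\<epsilon><..<\<epsilon>}. perturb X s V \<in> reduced_data A"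
    using perturb_reduced_data[OF assms] by blast
  have lin: "Ck_on m ({-\<epsilon><..<\<epsilon>} \<times> snd c ` fst c) (\<lambda>z. f (snd z) + fst z * h (snd z))"
    if c: "c \<in> A" and f: "Ck_on m (snd c ` fst c) f" "Ck_on m (snd c ` fst c) h" for m c f h
  proof -
    have op: "open (snd c ` fst c)" by (rule is_chart_D(2)[OF smooth_atlas_D(1)[OF A c]])
    have o1: "open {-\<epsilon><..<\<epsilon>}" by simp
    note o2 = open_Times[OF o1 op]
    show ?thesis
      by (rule Ck_on_add[OF o2 Ck_on_comp_snd[OF o1 op f(1)] Ck_on_mult[OF o2 Ck_on_fst[OF o2] Ck_on_comp_snd[OF o1 op f(2)]]])
  qed
  have tens: "Ck_on m ({-\<epsilon><..<\<epsilon>} \<times> snd c ` fst c) (\<lambda>z. in_chart A c (\<lambda>p vs. S p vs + fst z * T p vs) (snd z) vs)"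
    if c: "c \<in> A" and ST: "smooth_tensor A k S" "smooth_tensor A k T" for m c k S T vs
    using lin[OF c smooth_tensor_Ck[OF ST(1) c] smooth_tensor_Ck[OF ST(2) c]] by (simp add: in_chart_def)
  note X' = formal_variations_D[OF reduced_data_D(1)[OF X]] and V' = formal_variations_D[OF V]
  have "smooth_family A \<epsilon> (\<lambda>s. perturb X s V)"
    unfolding smooth_family_def Let_def smooth_on_real case_prod_beta perturb_sel
    using \<epsilon>(2) lin[OF _ smooth_function_Ck[OF X'(4)] smooth_function_Ck[OF V'(4)]] tens[OF _ X'(1) V'(1)]
      tens[OF _ smooth_formD(1)[OF X'(3)] smooth_formD(1)[OF V'(3)]] tens[OF _ smooth_formD(1)[OF X'(5)] smooth_formD(1)[OF V'(5)]]
      tens[OF _ smooth_formD(1)[OF X'(6)] smooth_formD(1)[OF V'(6)]]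
    by simp
  then show ?thesis using \<epsilon>(1) by blast
qed

lemma has_velocity_perturb: "has_velocity (\<lambda>s. perturb X s V) V 0 UNIV"
  unfolding has_velocity_def perturb_sel
  by (auto intro!: derivative_eq_intros)

lemma perturb_0: "perturb X 0 V = X"
  by (simp add: perturb_def)

lemma formal_gradient_pairing:
  fixes A :: "('a::{t2_space,second_countable_topology}, 6) chart set"
  assumes A: "smooth_atlas A" and comp: "compact (UNIV :: 'a set)"
    and X: "X \<in> reduced_data A" and \<V>: "\<V> \<subseteq> formal_variations A" and G: "formal_gradient A \<V> X G" and V: "V \<in> \<V>"
  shows "L2_pairing A (met X) G V = L2_pairing A (met X) (flow_rhs X) V"
proof -
  have "V \<in> formal_variations A" using V \<V> by blast
  then obtain \<epsilon> where \<epsilon>: "\<epsilon> > 0" "smooth_family A \<epsilon> (\<lambda>s. perturb X s V)"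
    using smooth_family_perturb[OF A comp X] by blast
  have D: "((\<lambda>s. reduced_functional A (perturb X s V)) has_real_derivative L2_pairing A (met X) G V) (at 0)"
    if "formal_gradient A \<V> X G" for G
    using that[unfolded formal_gradient_def, THEN conjunct2, rule_format, OF V \<epsilon> perturb_0 has_velocity_perturb] .
  show ?thesis
    by (rule DERIV_unique[OF D[OF G] D[OF formal_gradient_flow_rhs[OF A comp X \<V>]]])
qed

section \<open>Uniqueness of the gradient tested on all formal variations\<close>

lemma smooth_pairing_density:
  assumes A: "smooth_atlas A" and g: "riemannian_metric A g" and V: "V \<in> formal_variations A" and W: "W \<in> formal_variations A"
  shows "smooth_function A (pairing_density g V W)"
  unfolding pairing_density_def[abs_def]
  by (intro smooth_function_add smooth_function_mult smooth_function_form_inner smooth_function_contract A g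
      formal_variations_D[OF V] formal_variations_D[OF W])

lemma pairing_density_diff:
  "pairing_density g G W p - pairing_density g R W p = pairing_density g (perturb G (- 1) R) W p"
  unfolding pairing_density_def perturb_sel form_inner_def contract_add_left contract_scale_left
  by (simp add: field_simps)

lemma pairing_density_pos:
  assumes g: "inner_tensor (g p)" and V: "V \<in> formal_variations A"
  shows "pairing_density g V V p \<ge> 0"
    and "pairing_density g V V p = 0 \<Longrightarrow> met V p = (\<lambda>_. 0) \<and> lee V p = (\<lambda>_. 0) \<and> lam V p = 0 \<and>
      tor V p = (\<lambda>_. 0) \<and> curv V p = (\<lambda>_. 0)"
proof -
  note V = formal_variations_D[OF V]
  note ml = smooth_tensor_multilinear[OF V(1), of p] smooth_formD(3)[OF V(3), of p]
    smooth_formD(3)[OF V(5), of p] smooth_formD(3)[OF V(6), of p]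
  note nn = contract_nonneg[OF g ml(1)] contract_nonneg[OF g ml(2)] contract_nonneg[OF g ml(3)] contract_nonneg[OF g ml(4)]
  have fi: "0 \<le> form_inner (g p) 1 (lee V p) (lee V p)" "0 \<le> form_inner (g p) 3 (tor V p) (tor V p)"
    "0 \<le> form_inner (g p) 2 (curv V p) (curv V p)" and sq: "0 \<le> lam V p * lam V p"
    using nn by (simp_all add: form_inner_def)
  show "pairing_density g V V p \<ge> 0" using nn(1) fi sq by (simp add: pairing_density_def)
  assume 0: "pairing_density g V V p = 0"
  then have "contract (g p) 2 (met V p) (met V p) = 0" "form_inner (g p) 1 (lee V p) (lee V p) = 0"
    "lam V p * lam V p = 0" "form_inner (g p) 3 (tor V p) (tor V p) = 0" "form_inner (g p) 2 (curv V p) (curv V p) = 0"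
    using nn(1) fi sq unfolding pairing_density_def by linarith+
  then show "met V p = (\<lambda>_. 0) \<and> lee V p = (\<lambda>_. 0) \<and> lam V p = 0 \<and> tor V p = (\<lambda>_. 0) \<and> curv V p = (\<lambda>_. 0)"
    using contract_eq_0[OF g ml(1)] contract_eq_0[OF g ml(2)] contract_eq_0[OF g ml(3)] contract_eq_0[OF g ml(4)]
    by (simp add: form_inner_def)
qed

lemma formal_gradient_unique:
  fixes A :: "('a::{t2_space,second_countable_topology}, 6) chart set"
  assumes A: "smooth_atlas A" and comp: "compact (UNIV :: 'a set)" and X: "X \<in> reduced_data A"
  shows "formal_gradient A (formal_variations A) X G \<longleftrightarrow> G = flow_rhs X"
proof
  assume G: "formal_gradient A (formal_variations A) X G"
  define R where "R = flow_rhs X"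
  \<comment> \<open>The difference G - R, encoded as a point of a straight line so that
    \<open>perturb_formal\<close> shows it to be a formal variation.\<close>
  define W where "W = perturb G (- 1) R"
  note g = reduced_data_D(2)[OF X]
  have Gf: "G \<in> formal_variations A" using G by (simp add: formal_gradient_def)
  have Rf: "R \<in> formal_variations A" unfolding R_def by (rule flow_rhs_formal[OF A X])
  have Wf: "W \<in> formal_variations A" unfolding W_def by (rule perturb_formal[OF A Gf Rf])
  have "L2_pairing A (met X) G W = L2_pairing A (met X) R W"
    unfolding R_def by (rule formal_gradient_pairing[OF A comp X order_refl G Wf])
  then have "riem_integral A (met X) (\<lambda>p. pairing_density (met X) G W p - pairing_density (met X) R W p) = 0"
    using riem_integral_diff[OF A comp g smooth_pairing_density[OF A g Gf Wf] smooth_pairing_density[OF A g Rf Wf]]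
    by (simp add: L2_pairing_density)
  then have "riem_integral A (met X) (pairing_density (met X) W W) = 0"
    unfolding pairing_density_diff W_def[symmetric] .
  then have "pairing_density (met X) W W p = 0" for p
    by (rule riem_integral_eq_0[OF A comp g smooth_pairing_density[OF A g Wf Wf] pairing_density_pos(1)[OF reduced_data_D(3)[OF X] Wf]])
  then have z: "met W p = (\<lambda>_. 0) \<and> lee W p = (\<lambda>_. 0) \<and> lam W p = 0 \<and> tor W p = (\<lambda>_. 0) \<and> curv W p = (\<lambda>_. 0)" for p
    by (rule pairing_density_pos(2)[OF reduced_data_D(3)[OF X] Wf])
  have "met G = met R" "lee G = lee R" "lam G = lam R" "tor G = tor R" "curv G = curv R"
    using z by (auto simp: W_def fun_eq_iff)
  then show "G = flow_rhs X" unfolding R_def by simp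
next
  assume "G = flow_rhs X"
  then show "formal_gradient A (formal_variations A) X G"
    using formal_gradient_flow_rhs[OF A comp X order_refl] by simp
qed

section \<open>The gradient flow\<close>

text \<open>Multiplication by the integrating factor exp(-a t) makes the function constant on the
  interval, endpoints included because the derivatives are taken within I.\<close>

lemma linear_ode_unique:
  fixes f :: "real \<Rightarrow> real"
  assumes I: "is_interval I" "0 \<in> I" "t \<in> I"
    and f: "\<And>t. t \<in> I \<Longrightarrow> (f has_real_derivative a * f t) (at t within I)"
  shows "f t = exp (a * t) * f 0"
proof -
  have "((\<lambda>s. exp (- a * s) * f s) has_real_derivative 0) (at s within I)" if "s \<in> I" for s
    by (rule derivative_eq_intros f[OF that] refl | simp)+
  then obtain C where "\<forall>s\<in>I. exp (- a * s) * f s = C"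
    using has_field_derivative_zero_constant[OF is_interval_convex[OF I(1)]] by blast
  then have "exp (- a * t) * f t = exp (- a * 0) * f 0" using I by metis
  then have "exp (a * t) * (exp (- a * t) * f t) = exp (a * t) * f 0" by simp
  then show ?thesis by (simp add: mult.assoc[symmetric] flip: exp_add)
qed

lemma form_sq_scale: "form_sq g k (\<lambda>vs. r * \<alpha> vs) = r\<^sup>2 * form_sq g k \<alpha>"
  by (simp add: form_sq_def form_inner_def contract_scale_left contract_scale_right power2_eq_square)

lemma circ_scale: "circ g m (\<lambda>vs. r * \<alpha> vs) vs = r\<^sup>2 * circ g m \<alpha> vs"
  by (simp add: circ_def contract_scale_left contract_scale_right power2_eq_square)

lemma ansatz_reduced_data: "ansatz A B act \<pi> S X \<Longrightarrow> X \<in> reduced_data A"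
  unfolding ansatz_def su3_structure_def reduced_data_def formal_variations_def riemannian_metric_def by simp

lemma admissible_formal: "admissible_variations A B act \<pi> S X \<subseteq> formal_variations A"
  unfolding admissible_variations_def by blast

lemma coupled_system_exponential:
  assumes I: "is_interval I" "0 \<in> I" "t \<in> I" and X: "coupled_system I X"
  shows "lee (X t) p vs = exp (- (10 * pi / 9) * t) * lee (X 0) p vs"
    and "lam (X t) p = exp (- (15 * pi / 2) * t) * lam (X 0) p"
    and "tor (X t) p vs = exp (- pi * t) * tor (X 0) p vs"
    and "curv (X t) p vs = exp (- pi * t) * curv (X 0) p vs"
proof -
  note v = X[unfolded coupled_system_def has_velocity_def flow_rhs_simps, rule_format]
  show "lee (X t) p vs = exp (- (10 * pi / 9) * t) * lee (X 0) p vs"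
    by (rule linear_ode_unique[OF I]) (use v in blast)
  show "lam (X t) p = exp (- (15 * pi / 2) * t) * lam (X 0) p"
    by (rule linear_ode_unique[OF I]) (use v in blast)
  show "tor (X t) p vs = exp (- pi * t) * tor (X 0) p vs"
    by (rule linear_ode_unique[OF I]) (use v in blast)
  show "curv (X t) p vs = exp (- pi * t) * curv (X 0) p vs"
    by (rule linear_ode_unique[OF I]) (use v in blast)
qed

text \<open>The forms enter quadratically, so their exponential factors come out squared and the
  rates double. The metric used in the contractions remains \<open>met (X t)\<close>, so the
  equation for the metric is still nonlinear.\<close>

lemma coupled_system_metric:
  assumes I: "is_interval I" "0 \<in> I" "t \<in> I" and X: "coupled_system I X"
  shows "((\<lambda>s. met (X s) p vs) has_real_derivative
     - 2 * pi *
     ((15 / 16 * exp (- 15 * pi * t) * (lam (X 0) p)\<^sup>2 +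
       5 / 36 * exp (- (20 * pi / 9) * t) * form_sq (met (X t) p) 1 (lee (X 0) p) +
       1 / 8 * exp (- 2 * pi * t) * form_sq (met (X t) p) 3 (tor (X 0) p) +
       1 / 8 * exp (- 2 * pi * t) * form_sq (met (X t) p) 2 (curv (X 0) p)) *
         met (X t) p vs
      - 5 / 18 * exp (- (20 * pi / 9) * t) * tensor_square (lee (X 0) p) vs
      - 1 / 4 * exp (- 2 * pi * t) * circ3 (met (X t) p) (tor (X 0) p) vs
      - 1 / 4 * exp (- 2 * pi * t) * circ2 (met (X t) p) (curv (X 0) p) vs))
     (at t within I)"
proof -
  note e = coupled_system_exponential[OF I X]
  \<comment> \<open>The scaling rules act on whole tensors, hence equalities of functions are needed
    and not only of values.\<close>
  have forms: "lee (X t) p = (\<lambda>vs. exp (- (10 * pi / 9) * t) * lee (X 0) p vs)"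
    "tor (X t) p = (\<lambda>vs. exp (- pi * t) * tor (X 0) p vs)"
    "curv (X t) p = (\<lambda>vs. exp (- pi * t) * curv (X 0) p vs)"
    using e by auto
  have sq: "(exp (- (15 * pi / 2) * t))\<^sup>2 = exp (- 15 * pi * t)"
    "(exp (- (10 * pi / 9) * t))\<^sup>2 = exp (- (20 * pi / 9) * t)"
    "(exp (- pi * t))\<^sup>2 = exp (- 2 * pi * t)"
    by (simp_all add: power2_eq_square flip: exp_add)
  have "((\<lambda>s. met (X s) p vs) has_real_derivative met (flow_rhs (X t)) p vs) (at t within I)"
    using X I(3) unfolding coupled_system_def has_velocity_def by blast
  then show ?thesis
  proof (rule DERIV_cong)
    show "met (flow_rhs (X t)) p vs = - 2 * pi *
     ((15 / 16 * exp (- 15 * pi * t) * (lam (X 0) p)\<^sup>2 +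
       5 / 36 * exp (- (20 * pi / 9) * t) * form_sq (met (X t) p) 1 (lee (X 0) p) +
       1 / 8 * exp (- 2 * pi * t) * form_sq (met (X t) p) 3 (tor (X 0) p) +
       1 / 8 * exp (- 2 * pi * t) * form_sq (met (X t) p) 2 (curv (X 0) p)) *
         met (X t) p vs
      - 5 / 18 * exp (- (20 * pi / 9) * t) * tensor_square (lee (X 0) p) vs
      - 1 / 4 * exp (- 2 * pi * t) * circ3 (met (X t) p) (tor (X 0) p) vs
      - 1 / 4 * exp (- 2 * pi * t) * circ2 (met (X t) p) (curv (X 0) p) vs)"
      unfolding met_flow_rhs energy_density_def forms e(2) form_sq_scale circ_scale power_mult_distrib sq
        circ_eqs(1)[where g = "met (X t) p"] circ_eqs(2,3)
      by (simp add: algebra_simps)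
  qed
qed

text \<open>At each time the gradient is unique, so the existential in the flow collapses to
  \<open>flow_rhs (X t)\<close>.\<close>

lemma coupled_system_iff:
  fixes A :: "('a::{t2_space,second_countable_topology}, 6) chart set"
  assumes A: "smooth_atlas A" and comp: "compact (UNIV :: 'a set)" and X: "\<forall>t\<in>I. X t \<in> reduced_data A"
  shows "positive_gradient_flow A (\<lambda>t. formal_variations A) I X \<longleftrightarrow> coupled_system I X"
  using X unfolding positive_gradient_flow_def coupled_system_def
  by (simp add: formal_gradient_unique[OF A comp] cong: ball_cong)

theorem theorem2:
  fixes A :: "('a::{t2_space,second_countable_topology}, 6) chart set"
    and B :: "('m::{t2_space,second_countable_topology}, 7) chart set"
    and act :: "complex \<Rightarrow> 'm \<Rightarrow> 'm"
    and \<pi> :: "'m \<Rightarrow> 'a"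
  assumes N: "smooth_atlas A" "compact (UNIV :: 'a set)"
    and M: "smooth_atlas B" "circle_action B act" "free_action act" "orbit_projection B A act \<pi>"
  shows
    "\<comment> \<open>the formal gradient, and to what extent testing determines it\<close>
     (\<forall>S X. ansatz A B act \<pi> S X \<longrightarrow>
       formal_gradient A (admissible_variations A B act \<pi> S X) X (flow_rhs X) \<and>
       (\<forall>G\<in>formal_variations A.
          formal_gradient A (admissible_variations A B act \<pi> S X) X G \<longleftrightarrow>
          (\<forall>V\<in>admissible_variations A B act \<pi> S X.
             L2_pairing A (met X) G V = L2_pairing A (met X) (flow_rhs X) V)) \<and>
       (\<forall>G. formal_gradient A (formal_variations A) X G \<longleftrightarrow> G = flow_rhs X)) \<and>
     \<comment> \<open>the positive gradient flow is the coupled system\<close>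
     (\<forall>I X. is_interval I \<and> 0 \<in> I \<and> (\<forall>t\<in>I. X t \<in> reduced_data A) \<longrightarrow>
       (positive_gradient_flow A (\<lambda>t. formal_variations A) I X \<longleftrightarrow> coupled_system I X) \<and>
       (\<forall>S. (\<forall>t\<in>I. ansatz A B act \<pi> (S t) (X t)) \<and> coupled_system I X \<longrightarrow>
          positive_gradient_flow A (\<lambda>t. admissible_variations A B act \<pi> (S t) (X t)) I X)) \<and>
     \<comment> \<open>exponential evolution, and the resulting evolution of the metric\<close>
     (\<forall>I X. is_interval I \<and> 0 \<in> I \<and> (\<forall>t\<in>I. X t \<in> reduced_data A) \<and> coupled_system I X \<longrightarrow>
       (\<forall>t\<in>I. \<forall>p.
          (\<forall>vs. lee (X t) p vs = exp (- (10 * pi / 9) * t) * lee (X 0) p vs) \<and>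
          lam (X t) p = exp (- (15 * pi / 2) * t) * lam (X 0) p \<and>
          (\<forall>vs. tor (X t) p vs = exp (- pi * t) * tor (X 0) p vs) \<and>
          (\<forall>vs. curv (X t) p vs = exp (- pi * t) * curv (X 0) p vs) \<and>
          (\<forall>vs. ((\<lambda>s. met (X s) p vs) has_real_derivative
             - 2 * pi *
             ((15 / 16 * exp (- 15 * pi * t) * (lam (X 0) p)\<^sup>2 +
               5 / 36 * exp (- (20 * pi / 9) * t) * form_sq (met (X t) p) 1 (lee (X 0) p) +
               1 / 8 * exp (- 2 * pi * t) * form_sq (met (X t) p) 3 (tor (X 0) p) +
               1 / 8 * exp (- 2 * pi * t) * form_sq (met (X t) p) 2 (curv (X 0) p)) *
                 met (X t) p vs
              - 5 / 18 * exp (- (20 * pi / 9) * t) * tensor_square (lee (X 0) p) vs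
              - 1 / 4 * exp (- 2 * pi * t) * circ3 (met (X t) p) (tor (X 0) p) vs
              - 1 / 4 * exp (- 2 * pi * t) * circ2 (met (X t) p) (curv (X 0) p) vs))
             (at t within I))))"
proof (intro conjI allI impI ballI)
  note A = N(1) and comp = N(2)
  fix S X assume "ansatz A B act \<pi> S X"
  then have X: "X \<in> reduced_data A" by (rule ansatz_reduced_data)
  note adm = admissible_formal[of A B act \<pi> S X]
  show fg: "formal_gradient A (admissible_variations A B act \<pi> S X) X (flow_rhs X)"
    by (rule formal_gradient_flow_rhs[OF A comp X adm])
  show "formal_gradient A (formal_variations A) X G \<longleftrightarrow> G = flow_rhs X" for G
    by (rule formal_gradient_unique[OF A comp X])
  fix G assume G: "G \<in> formal_variations A"
  show "formal_gradient A (admissible_variations A B act \<pi> S X) X G \<longleftrightarrow>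
      (\<forall>V\<in>admissible_variations A B act \<pi> S X. L2_pairing A (met X) G V = L2_pairing A (met X) (flow_rhs X) V)"
  proof
    show "\<forall>V\<in>admissible_variations A B act \<pi> S X. L2_pairing A (met X) G V = L2_pairing A (met X) (flow_rhs X) V"
      if "formal_gradient A (admissible_variations A B act \<pi> S X) X G"
      using formal_gradient_pairing[OF A comp X adm that] by blast
    \<comment> \<open>Equal pairings prescribe the same derivative along every test family, so G
      inherits the gradient property from \<open>flow_rhs X\<close>.\<close>
    show "formal_gradient A (admissible_variations A B act \<pi> S X) X G"
      if "\<forall>V\<in>admissible_variations A B act \<pi> S X. L2_pairing A (met X) G V = L2_pairing A (met X) (flow_rhs X) V"
      using fg that G unfolding formal_gradient_def by simp
  qed
next
  note A = N(1) and comp = N(2)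
  fix I :: "real set" and X assume *: "is_interval I \<and> 0 \<in> I \<and> (\<forall>t\<in>I. X t \<in> reduced_data A)"
  then show "positive_gradient_flow A (\<lambda>t. formal_variations A) I X \<longleftrightarrow> coupled_system I X"
    using coupled_system_iff[OF A comp] by blast
  fix S assume S: "(\<forall>t\<in>I. ansatz A B act \<pi> (S t) (X t)) \<and> coupled_system I X"
  show "positive_gradient_flow A (\<lambda>t. admissible_variations A B act \<pi> (S t) (X t)) I X"
    unfolding positive_gradient_flow_def
  proof
    fix t assume t: "t \<in> I"
    then have "X t \<in> reduced_data A" using * by blast
    from formal_gradient_flow_rhs[OF A comp this admissible_formal]
    show "\<exists>G. formal_gradient A (admissible_variations A B act \<pi> (S t) (X t)) (X t) G \<and> has_velocity X G t I"
      using S t unfolding coupled_system_def by blast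
  qed
next
  fix I :: "real set" and X t p
  assume *: "is_interval I \<and> 0 \<in> I \<and> (\<forall>t\<in>I. X t \<in> reduced_data A) \<and> coupled_system I X" and t: "t \<in> I"
  then have I: "is_interval I" "0 \<in> I" "t \<in> I" "coupled_system I X" by auto
  note e = coupled_system_exponential[OF I] and m = coupled_system_metric[OF I]
  show "lee (X t) p vs = exp (- (10 * pi / 9) * t) * lee (X 0) p vs" for vs by (rule e)
  show "lam (X t) p = exp (- (15 * pi / 2) * t) * lam (X 0) p" by (rule e)
  show "tor (X t) p vs = exp (- pi * t) * tor (X 0) p vs" for vs by (rule e)
  show "curv (X t) p vs = exp (- pi * t) * curv (X 0) p vs" for vs by (rule e)
  show "((\<lambda>s. met (X s) p vs) has_real_derivative
             - 2 * pi *
             ((15 / 16 * exp (- 15 * pi * t) * (lam (X 0) p)\<^sup>2 +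
               5 / 36 * exp (- (20 * pi / 9) * t) * form_sq (met (X t) p) 1 (lee (X 0) p) +
               1 / 8 * exp (- 2 * pi * t) * form_sq (met (X t) p) 3 (tor (X 0) p) +
               1 / 8 * exp (- 2 * pi * t) * form_sq (met (X t) p) 2 (curv (X 0) p)) *
                 met (X t) p vs
              - 5 / 18 * exp (- (20 * pi / 9) * t) * tensor_square (lee (X 0) p) vs
              - 1 / 4 * exp (- 2 * pi * t) * circ3 (met (X t) p) (tor (X 0) p) vs
              - 1 / 4 * exp (- 2 * pi * t) * circ2 (met (X t) p) (curv (X 0) p) vs))
             (at t within I)" for vs
    by (rule m)
qed

end
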